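(* The following three sentences are equivalent (provably in ZFC): (i) $\mathbf{Det}(\Sigma^1_1)$: every Gale-Stewart game $G(A)$, where $A\subseteq X^\omega$ ($X$ a finite alphabet) is an $\omega$-language in the class $\Sigma^1_1$ of effective analytic sets, is determined; (ii) $\mathbf{Det}(\mathbf{CFL}_\omega)$: every Gale-Stewart game $G(A)$, where $A\subseteq X^\omega$ ($X$ a finite alphabet) is a context-free $\omega$-language (accepted by a Büchi pushdown automaton), is determined; (iii) $\mathbf{Det}(\mathbf{r}\text{-}\mathbf{BCL}(1)_\omega)$: every Gale-Stewart game $G(A)$, where $A\subseteq X^\omega$ ($X$ a finite alphabet) is accepted by a real-time Büchi $1$-counter automaton, is determined.
   Context: The base theory is ZFC. For a finite alphabet $X$, $X^\star$ is the set of finite words, $\lambda$ is the empty word, $X^\omega$ is the set of infinite words $\sigma=\sigma(1)\sigma(2)\cdots$, and $\sigma[n]=\sigma(1)\cdots\sigma(n)$, $\sigma[0]=\lambda$. An $\omega$-language over $X$ is a subset of $X^\omega$. Gale-Stewart game. For $A\subseteq X^\omega$, in $G(A)$ Player 1 writes $a_1\in X$, then Player 2 writes $b_1\in X$, then Player 1 writes $a_2\in X$, and so on. Player 1 wins the play iff $a_1b_1a_2b_2\cdots\in A$; otherwise Player 2 wins. A strategy for Player 1 is a function $F_1:(X^2)^\star\to X$, followed when $a_n=F_1(a_1b_1\cdots a_{n-1}b_{n-1})$ for all $n\ge1$; a strategy for Player 2 is a function $F_2:(X^2)^\star X\to X$, followed when $b_n=F_2(a_1b_1\cdots a_{n-1}b_{n-1}a_n)$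 for all $n\geq 1$. A strategy is winning if its owner wins every play in which she/he follows it. $G(A)$ is determined iff one of the players has a winning strategy. Class $\Sigma^1_1$ (lightface). $L\subseteq X^\omega$ is in $\Sigma^1_1$ iff there is a recursive relation $R_L\subseteq\mathbb{N}\times\{0,1\}^\star\times X^\star$ such that $L=\{\sigma\in X^\omega\mid \exists\tau\in\{0,1\}^\omega\ \forall n\,\exists m\ (n,\tau[m],\sigma[m])\in R_L\}$. Counter automata. A Büchi $k$-counter automaton ($k\geq 1$) is $\mathcal M=(K,\Sigma,\Delta,q_0,F)$ with $K$ a finite set of states, $\Sigma$ a finite alphabet, $q_0\in K$, $F\subseteq K$ and $\Delta\subseteq K\times(\Sigma\cup\{\lambda\})\times\{0,1\}^k\times K\times\{0,1,-1\}^k$, where $(q,a,i_1,\dots,i_k,q',j_1,\dots,j_k)\in\Delta$ and $i_m=0$ imply $j_m\in\{0,1\}$. Configurations are tuples $(q,c_1,\dots,c_k)\in K\times\mathbb{N}^k$. For $a\in\Sigma\cup\{\lambda\}$, write $a:(q,c_1,\dots,c_k)\mapsto(q',c_1+j_1,\dots,c_k+j_k)$ if $(q,a,i_1,\dots,i_k,q',j_1,\dots,j_k)\in\Delta$, where $i_m=0$ if $c_m=0$ and $i_m=1$ if $c_m>0$. A run on $\sigma\in\Sigma^\omega$ is an infinite sequence of configurations starting at $(q_0,0,\dots,0)$ such that there are $b_i\in\Sigma\cup\{\lambda\}$ with $b_i$: ($i$-th configuration) $\mapsto$ ($(i+1)$-th configuration) for all $i\ge1$ and $b_1b_2\cdots=\sigma$.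 $L(\mathcal M)$ is the set of $\sigma\in\Sigma^\omega$ having a run in which some state of $F$ occurs infinitely often. $\mathcal M$ is real-time iff $\Delta\subseteq K\times\Sigma\times\{0,1\}^k\times K\times\{0,1,-1\}^k$ (no $\lambda$-transitions). $\mathbf{r}\text{-}\mathbf{BCL}(k)_\omega$ is the class of $\omega$-languages accepted by real-time Büchi $k$-counter automata. $\mathbf{CFL}_\omega$ is the class of $\omega$-languages accepted by (non-deterministic) Büchi pushdown automata (finite control with one pushdown stack, $\lambda$-transitions allowed; an infinite word is accepted iff there is a run reading the whole word that visits an accepting state infinitely often). *)

theory Defs
  imports Complex_Main "HOL-Library.Omega_Words_Fun" "HOL-Library.FuncSet" "HOL-Library.Nat_Bijection"
begin

text \<open>
  Alphabets, state sets and stack alphabets are finite sets of natural numbers, so that one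
  formula can quantify over all of them; every finite set is in bijection with such a set.
  Infinite words are functions on the naturals indexed from 0, so \<open>\<sigma> i\<close> is the
  letter written \<open>\<sigma>(i+1)\<close> on paper, while \<open>prefix n \<sigma>\<close> is
  \<open>\<sigma>[n]\<close>, the word of the first \<open>n\<close> letters.
\<close>

definition omega_words :: "nat set \<Rightarrow> nat word set" where
  "omega_words X = (UNIV \<rightarrow> X)"


section \<open>Gale-Stewart games\<close>

text \<open>
  A play is the word \<open>a\<^sub>1 b\<^sub>1 a\<^sub>2 b\<^sub>2 \<dots>\<close>: Player 1 chooses the letters
  at even positions (counted from 0), Player 2 those at odd positions. The set
  \<open>(X\<^sup>2)\<^sup>\<star>\<close> is rendered as the words over \<open>X\<close> of even length and
  \<open>(X\<^sup>2)\<^sup>\<star>X\<close> as those of odd length.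
\<close>

definition strategy1 :: "nat set \<Rightarrow> (nat list \<Rightarrow> nat) \<Rightarrow> bool" where
  "strategy1 X F \<longleftrightarrow> F \<in> {w \<in> lists X. even (length w)} \<rightarrow> X"

definition strategy2 :: "nat set \<Rightarrow> (nat list \<Rightarrow> nat) \<Rightarrow> bool" where
  "strategy2 X F \<longleftrightarrow> F \<in> {w \<in> lists X. odd (length w)} \<rightarrow> X"

definition follows1 :: "(nat list \<Rightarrow> nat) \<Rightarrow> nat word \<Rightarrow> bool" where
  "follows1 F \<sigma> \<longleftrightarrow> (\<forall>n. \<sigma> (2 * n) = F (prefix (2 * n) \<sigma>))"

definition follows2 :: "(nat list \<Rightarrow> nat) \<Rightarrow> nat word \<Rightarrow> bool" where
  "follows2 F \<sigma> \<longleftrightarrow> (\<forall>n. \<sigma> (2 * n + 1) = F (prefix (2 * n + 1) \<sigma>))"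

definition winning1 :: "nat set \<Rightarrow> nat word set \<Rightarrow> (nat list \<Rightarrow> nat) \<Rightarrow> bool" where
  "winning1 X A F \<longleftrightarrow>
     strategy1 X F \<and> (\<forall>\<sigma>\<in>omega_words X. follows1 F \<sigma> \<longrightarrow> \<sigma> \<in> A)"

definition winning2 :: "nat set \<Rightarrow> nat word set \<Rightarrow> (nat list \<Rightarrow> nat) \<Rightarrow> bool" where
  "winning2 X A F \<longleftrightarrow>
     strategy2 X F \<and> (\<forall>\<sigma>\<in>omega_words X. follows2 F \<sigma> \<longrightarrow> \<sigma> \<notin> A)"

definition determined :: "nat set \<Rightarrow> nat word set \<Rightarrow> bool" where
  "determined X A \<longleftrightarrow> (\<exists>F. winning1 X A F) \<or> (\<exists>F. winning2 X A F)"

text \<open>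
  A class of \<open>\<omega>\<close>-languages is given as a function \<open>\<C>\<close> that maps each finite alphabet
  to the members of the class over that alphabet.
\<close>

definition Det :: "(nat set \<Rightarrow> nat word set set) \<Rightarrow> bool" where
  "Det \<C> \<longleftrightarrow> (\<forall>X. finite X \<longrightarrow> (\<forall>A. A \<subseteq> omega_words X \<and> A \<in> \<C> X \<longrightarrow> determined X A))"


section \<open>Recursive relations and the class \<open>\<Sigma>\<^sup>1\<^sub>1\<close>\<close>

text \<open>
  Kleene's partial recursive functions; \<open>rec_eval f xs y\<close> means that \<open>f\<close> converges on
  the arguments \<open>xs\<close> with value \<open>y\<close>. Recursion is on the first argument, and
  unbounded search also runs over the first argument.
\<close>

datatype recf =
    Zero
  | Succ
  | Proj nat
  | Comp recf "recf list"
  | PrimRec recf recf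
  | Mu recf

inductive rec_eval :: "recf \<Rightarrow> nat list \<Rightarrow> nat \<Rightarrow> bool" where
  Zero: "rec_eval Zero xs 0"
| Succ: "rec_eval Succ [x] (Suc x)"
| Proj: "i < length xs \<Longrightarrow> rec_eval (Proj i) xs (xs ! i)"
| Comp: "list_all2 (\<lambda>g y. rec_eval g xs y) gs ys \<Longrightarrow> rec_eval f ys z
    \<Longrightarrow> rec_eval (Comp f gs) xs z"
| PrimRec_0: "rec_eval f xs y \<Longrightarrow> rec_eval (PrimRec f g) (0 # xs) y"
| PrimRec_Suc: "rec_eval (PrimRec f g) (n # xs) y \<Longrightarrow> rec_eval g (n # y # xs) z
    \<Longrightarrow> rec_eval (PrimRec f g) (Suc n # xs) z"
| Mu: "rec_eval f (n # xs) 0 \<Longrightarrow> (\<And>m. m < n \<Longrightarrow> \<exists>y. rec_eval f (m # xs) (Suc y))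
    \<Longrightarrow> rec_eval (Mu f) xs n"

text \<open>
  Finite words are coded by the bijection \<open>list_encode\<close>; a relation is recursive if some total
  recursive function decides membership on the codes.
\<close>

definition recursive_rel :: "(nat \<times> nat list \<times> nat list) set \<Rightarrow> bool" where
  "recursive_rel R \<longleftrightarrow>
     (\<exists>f. \<forall>n u v. rec_eval f [n, list_encode u, list_encode v] (if (n, u, v) \<in> R then 1 else 0))"

definition Sigma11 :: "nat set \<Rightarrow> nat word set set" where
  "Sigma11 X =
     {L. \<exists>R. R \<subseteq> UNIV \<times> lists {0, 1} \<times> lists X \<and> recursive_rel R \<and>
       L = {\<sigma> \<in> omega_words X.
              \<exists>\<tau>\<in>omega_words {0, 1}. \<forall>n. \<exists>m. (n, prefix m \<tau>, prefix m \<sigma>) \<in> R}}"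


section \<open>Labels of runs\<close>

text \<open>
  A transition label is a letter \<open>Some a\<close> or the empty word \<open>None\<close>. The relation
  \<open>spells b \<sigma>\<close> states \<open>b\<^sub>1 b\<^sub>2 \<dots> = \<sigma>\<close>: the finite
  concatenations are prefixes of \<open>\<sigma>\<close> of unbounded length, so the whole infinite word
  is read.
\<close>

definition label_word :: "nat option list \<Rightarrow> nat list" where
  "label_word bs = concat (map (\<lambda>b. case b of None \<Rightarrow> [] | Some a \<Rightarrow> [a]) bs)"

definition spells :: "nat option word \<Rightarrow> nat word \<Rightarrow> bool" where
  "spells b \<sigma> \<longleftrightarrow>
     (\<forall>n. label_word (prefix n b) = prefix (length (label_word (prefix n b))) \<sigma>) \<and>
     (\<forall>l. \<exists>n. l \<le> length (label_word (prefix n b)))"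


section \<open>Buechi k-counter automata\<close>

record counter_automaton =
  ca_states :: "nat set"
  ca_alphabet :: "nat set"
  ca_trans :: "(nat \<times> nat option \<times> nat list \<times> nat \<times> int list) set"
  ca_init :: nat
  ca_final :: "nat set"

definition counter_automaton_wf :: "nat \<Rightarrow> counter_automaton \<Rightarrow> bool" where
  "counter_automaton_wf k M \<longleftrightarrow>
     k \<ge> 1 \<and> finite (ca_states M) \<and> finite (ca_alphabet M) \<and>
     ca_init M \<in> ca_states M \<and> ca_final M \<subseteq> ca_states M \<and>
     (\<forall>(q, a, zs, q', js) \<in> ca_trans M.
        q \<in> ca_states M \<and> a \<in> insert None (Some ` ca_alphabet M) \<and>
        length zs = k \<and> set zs \<subseteq> {0, 1} \<and>
        q' \<in> ca_states M \<and>
        length js = k \<and> set js \<subseteq> {0, 1, -1} \<and>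
        (\<forall>m<k. zs ! m = 0 \<longrightarrow> js ! m \<in> {0, 1}))"

definition real_time :: "counter_automaton \<Rightarrow> bool" where
  "real_time M \<longleftrightarrow> (\<forall>(q, a, zs, q', js) \<in> ca_trans M. a \<noteq> None)"

definition counter_step ::
    "counter_automaton \<Rightarrow> nat option \<Rightarrow> nat \<times> nat list \<Rightarrow> nat \<times> nat list \<Rightarrow> bool" where
  "counter_step M a = (\<lambda>(q, cs) (q', cs').
     \<exists>js. (q, a, map (\<lambda>c. if c = 0 then 0 else 1) cs, q', js) \<in> ca_trans M \<and>
          map int cs' = map2 (\<lambda>c j. int c + j) cs js)"

definition counter_run :: "nat \<Rightarrow> counter_automaton \<Rightarrow> nat word \<Rightarrow> (nat \<times> nat list) word \<Rightarrow> bool" where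
  "counter_run k M \<sigma> r \<longleftrightarrow>
     r 0 = (ca_init M, replicate k 0) \<and>
     (\<exists>b. (\<forall>i. counter_step M (b i) (r i) (r (Suc i))) \<and> spells b \<sigma>)"

definition counter_lang :: "nat \<Rightarrow> counter_automaton \<Rightarrow> nat word set" where
  "counter_lang k M =
     {\<sigma> \<in> omega_words (ca_alphabet M).
        \<exists>r. counter_run k M \<sigma> r \<and> (\<exists>q\<in>ca_final M. \<exists>\<^sub>\<infinity>i. fst (r i) = q)}"

definition r_BCL :: "nat \<Rightarrow> nat set \<Rightarrow> nat word set set" where
  "r_BCL k X =
     {counter_lang k M |M. counter_automaton_wf k M \<and> real_time M \<and> ca_alphabet M = X}"


section \<open>Buechi pushdown automata\<close>

text \<open>
  A transition \<open>(q, a, Z, q', \<beta>)\<close> replaces the topmost stack symbol \<open>Z\<close> by the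
  word \<open>\<beta>\<close>. The stack is written with its top first and initially consists of the
  start symbol alone; no transition applies to the empty stack.
\<close>

record pushdown_automaton =
  pda_states :: "nat set"
  pda_alphabet :: "nat set"
  pda_stack :: "nat set"
  pda_trans :: "(nat \<times> nat option \<times> nat \<times> nat \<times> nat list) set"
  pda_init :: nat
  pda_start :: nat
  pda_final :: "nat set"

definition pushdown_automaton_wf :: "pushdown_automaton \<Rightarrow> bool" where
  "pushdown_automaton_wf M \<longleftrightarrow>
     finite (pda_states M) \<and> finite (pda_alphabet M) \<and> finite (pda_stack M) \<and>
     pda_init M \<in> pda_states M \<and> pda_start M \<in> pda_stack M \<and> pda_final M \<subseteq> pda_states M \<and>
     finite (pda_trans M) \<and>
     pda_trans M \<subseteq> pda_states M \<times> insert None (Some ` pda_alphabet M) \<times> pda_stack M \<times>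
                      pda_states M \<times> lists (pda_stack M)"

definition pda_step ::
    "pushdown_automaton \<Rightarrow> nat option \<Rightarrow> nat \<times> nat list \<Rightarrow> nat \<times> nat list \<Rightarrow> bool" where
  "pda_step M a = (\<lambda>(q, s) (q', s').
     \<exists>Z \<beta> \<gamma>. (q, a, Z, q', \<beta>) \<in> pda_trans M \<and> s = Z # \<gamma> \<and> s' = \<beta> @ \<gamma>)"

definition pda_run :: "pushdown_automaton \<Rightarrow> nat word \<Rightarrow> (nat \<times> nat list) word \<Rightarrow> bool" where
  "pda_run M \<sigma> r \<longleftrightarrow>
     r 0 = (pda_init M, [pda_start M]) \<and>
     (\<exists>b. (\<forall>i. pda_step M (b i) (r i) (r (Suc i))) \<and> spells b \<sigma>)"

definition pda_lang :: "pushdown_automaton \<Rightarrow> nat word set" where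
  "pda_lang M =
     {\<sigma> \<in> omega_words (pda_alphabet M).
        \<exists>r. pda_run M \<sigma> r \<and> (\<exists>q\<in>pda_final M. \<exists>\<^sub>\<infinity>i. fst (r i) = q)}"

definition CFL :: "nat set \<Rightarrow> nat word set set" where
  "CFL X = {pda_lang M |M. pushdown_automaton_wf M \<and> pda_alphabet M = X}"

end

theory Submission
  imports Defs "HOL-Computational_Algebra.Primes"
begin

text \<open>
  Every real-time Buechi 1-counter language is context-free and every context-free language is
  analytic, so the point is to reduce an analytic game \<open>A\<close> over \<open>X\<close> to a 1-counter
  game. A nondeterministic register machine for \<open>A\<close> guesses the witness bit by bit, and its
  registers are kept as a Goedel number in a single counter. To give a real-time automaton enough
  letters for multiplications and divisions of the counter, the game is played over
  \<open>X \<union> {F}\<close> with a new letter \<open>F\<close>: Player 2 has to write blocks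
  \<open>F\<^sup>0, F\<^sup>1, F\<^sup>2, \<dots>\<close> separated by letters of \<open>X\<close>, and real moves are
  made only at separators where Player 1 wants so. Player 1 wins if Player 2 violates the block
  structure, which the automaton detects by guessing two consecutive blocks, or if the machine
  accepts the sequence of real moves. As Player 1 is free to delay the moves, and the
  machine has only finitely many computations on a finite sequence of moves, she can wait until the
  blocks are long enough for all of them; thus winning strategies of either player in the new
  game yield winning strategies in the game for \<open>A\<close>.
\<close>

section \<open>Recursive functions\<close>

text \<open>Why Player 2 writes the blocks: the condition for Player 1 is a union, and a
  nondeterministic automaton handles unions by guessing. A fault of Player 2 is just one more
  alternative. A duty of Player 1 would have to be checked together with the machine, an
  intersection of two conditions that compete for the same counter. So Player 1 has no format to
  obey; an untimely move only leaves the runs of the machine stuck. Why a step takes two blocks: a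
  real-time counter changes by at most one per letter, so it cannot be multiplied in place. With a
  second counter, one would be emptied while the other is filled; here the known length of a block
  replaces it. A block of length l turns c into l - k c, and running that down in the next block
  leaves exactly k c letters on which the result is built. Growth of the blocks by one is what a
  single counter can compare, and it gives every finite computation enough room if it starts late
  enough.\<close>

definition recfn :: "nat \<Rightarrow> (nat list \<Rightarrow> nat) \<Rightarrow> bool" where
  "recfn k F \<longleftrightarrow> (\<exists>f. \<forall>xs. length xs = k \<longrightarrow> rec_eval f xs (F xs))"

definition recdec :: "nat \<Rightarrow> (nat list \<Rightarrow> bool) \<Rightarrow> bool" where
  "recdec k P \<longleftrightarrow> recfn k (\<lambda>xs. if P xs then 1 else 0)"

lemma recfn_cong: "recfn k F \<Longrightarrow> (\<And>xs. length xs = k \<Longrightarrow> F xs = G xs) \<Longrightarrow> recfn k G"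
  unfolding recfn_def by auto

lemma recdec_cong: "recdec k P \<Longrightarrow> (\<And>xs. length xs = k \<Longrightarrow> P xs = Q xs) \<Longrightarrow> recdec k Q"
  unfolding recdec_def by (erule recfn_cong) simp

lemma recfn_nth: "i < k \<Longrightarrow> recfn k (\<lambda>xs. xs ! i)"
  unfolding recfn_def by (metis rec_eval.Proj)

lemma recfn_comp:
  assumes "recfn n G" "\<And>F. F \<in> set Fs \<Longrightarrow> recfn k F" "length Fs = n"
  shows "recfn k (\<lambda>xs. G (map (\<lambda>F. F xs) Fs))"
proof -
  obtain g where g: "\<And>xs. length xs = n \<Longrightarrow> rec_eval g xs (G xs)"
    using assms(1) unfolding recfn_def by auto
  have "\<exists>fs. length fs = length Fs \<and>
      (\<forall>xs. length xs = k \<longrightarrow> list_all2 (\<lambda>f y. rec_eval f xs y) fs (map (\<lambda>F. F xs) Fs))"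
    using assms(2)
  proof (induction Fs)
    case Nil
    then show ?case by simp
  next
    case (Cons F Fs)
    then obtain fs where fs: "length fs = length Fs"
      "\<forall>xs. length xs = k \<longrightarrow> list_all2 (\<lambda>f y. rec_eval f xs y) fs (map (\<lambda>F. F xs) Fs)"
      by auto
    obtain f where "\<forall>xs. length xs = k \<longrightarrow> rec_eval f xs (F xs)"
      using Cons.prems[of F] unfolding recfn_def by auto
    then show ?case using fs by (intro exI[of _ "f # fs"]) simp
  qed
  then obtain fs where fs: "\<And>xs. length xs = k \<Longrightarrow> list_all2 (\<lambda>f y. rec_eval f xs y) fs (map (\<lambda>F. F xs) Fs)"
    by auto
  show ?thesis unfolding recfn_def
  proof (intro exI allI impI)
    fix xs :: "nat list" assume "length xs = k"
    then show "rec_eval (Comp g fs) xs (G (map (\<lambda>F. F xs) Fs))"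
      using fs g assms(3) by (intro rec_eval.Comp[of xs fs]) auto
  qed
qed

lemma recfn_SucD:
  "recfn (Suc k) F \<Longrightarrow> \<exists>f. \<forall>x xs. length xs = k \<longrightarrow> rec_eval f (x # xs) (F (x # xs))"
  unfolding recfn_def by (metis length_Cons)

definition rec1 :: "(nat \<Rightarrow> nat) \<Rightarrow> bool" where
  "rec1 g \<longleftrightarrow> recfn 1 (\<lambda>xs. g (hd xs))"

definition rec2 :: "(nat \<Rightarrow> nat \<Rightarrow> nat) \<Rightarrow> bool" where
  "rec2 g \<longleftrightarrow> recfn 2 (\<lambda>xs. g (hd xs) (hd (tl xs)))"

lemma rec1D: "rec1 g \<Longrightarrow> recfn k F \<Longrightarrow> recfn k (\<lambda>xs. g (F xs))"
  unfolding rec1_def using recfn_comp[of 1 "\<lambda>xs. g (hd xs)" "[F]" k] by simp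

lemma rec2D: "rec2 g \<Longrightarrow> recfn k F \<Longrightarrow> recfn k G \<Longrightarrow> recfn k (\<lambda>xs. g (F xs) (G xs))"
  unfolding rec2_def
  using recfn_comp[of 2 "\<lambda>xs. g (hd xs) (hd (tl xs))" "[F, G]" k] by auto

lemma recfn_hd: "recfn (Suc k) hd"
  by (rule recfn_cong[OF recfn_nth[of 0]]) (auto simp: hd_conv_nth length_Suc_conv)

lemma recfn_tl: "recfn k F \<Longrightarrow> recfn (Suc k) (\<lambda>xs. F (tl xs))"
proof (rule recfn_cong)
  assume "recfn k F"
  then show "recfn (Suc k) (\<lambda>xs. F (map (\<lambda>F. F xs) (map (\<lambda>i xs. xs ! Suc i) [0..<k])))"
    by (rule recfn_comp) (auto intro: recfn_nth)
  show "F (map (\<lambda>F. F xs) (map (\<lambda>i xs. xs ! Suc i) [0..<k])) = F (tl xs)"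
    if "length xs = Suc k" for xs :: "nat list"
    by (rule arg_cong[of _ _ F], rule nth_equalityI) (use that in \<open>auto simp: nth_tl\<close>)
qed

lemma rec1_Suc: "rec1 Suc"
  unfolding rec1_def recfn_def
  by (rule exI[of _ Succ]) (auto simp: length_Suc_conv intro: rec_eval.Succ)

lemmas recfn_Suc = rec1D[OF rec1_Suc]

lemma recfn_const: "recfn k (\<lambda>xs. c)"
proof (induction c)
  case 0
  then show ?case unfolding recfn_def using rec_eval.Zero by auto
next
  case (Suc c)
  then show ?case by (rule recfn_Suc)
qed

text \<open>\<open>PrimRec\<close> recurs on the head of its argument list. The bound
  \<open>N xs\<close> is therefore composed in as an extra first argument, in front of projections
  that restore \<open>xs\<close>. Sums, differences, conditionals and bounded quantifiers below are
  all instances.\<close>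

lemma recfn_rec_nat:
  assumes "recfn k F" "recfn (Suc (Suc k)) (\<lambda>xs. S (hd xs) (hd (tl xs)) (tl (tl xs)))" "recfn k N"
  shows "recfn k (\<lambda>xs. rec_nat (F xs) (\<lambda>i y. S i y xs) (N xs))"
proof -
  obtain f where f: "\<And>xs. length xs = k \<Longrightarrow> rec_eval f xs (F xs)"
    using assms(1) unfolding recfn_def by auto
  obtain s where "\<And>i zs. length zs = Suc k \<Longrightarrow> rec_eval s (i # zs) (S i (hd zs) (tl zs))"
    using recfn_SucD[OF assms(2)] by auto
  then have s: "rec_eval s (i # y # xs) (S i y xs)" if "length xs = k" for i y xs
    using that by (metis length_Cons list.sel(1,3))
  have "rec_eval (PrimRec f s) (n # xs) (rec_nat (F xs) (\<lambda>i y. S i y xs) n)" if "length xs = k" for n xs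
    by (induction n) (auto intro: rec_eval.PrimRec_0 rec_eval.PrimRec_Suc f[OF that] s[OF that])
  then have "recfn (Suc k) (\<lambda>ys. rec_nat (F (tl ys)) (\<lambda>i y. S i y (tl ys)) (hd ys))"
    unfolding recfn_def by (intro exI[of _ "PrimRec f s"]) (auto simp: length_Suc_conv)
  from recfn_comp[OF this, of "N # map (\<lambda>i xs. xs ! i) [0..<k]" k]
  have "recfn k (\<lambda>xs. rec_nat (F (map (\<lambda>i. xs ! i) [0..<k])) (\<lambda>i y. S i y (map (\<lambda>i. xs ! i) [0..<k])) (N xs))"
    using assms(3) by (fastforce intro: recfn_nth simp: comp_def)
  then show ?thesis
    by (rule recfn_cong) (metis map_nth)
qed

lemma recfn_Least:
  assumes "recdec (Suc k) (\<lambda>xs. P (hd xs) (tl xs))" "\<And>xs. length xs = k \<Longrightarrow> \<exists>w. P w xs"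
  shows "recfn k (\<lambda>xs. LEAST w. P w xs)"
proof -
  \<comment> \<open>This function exchanges zero and positive values: \<open>Mu\<close> searches for
    a zero, whereas \<open>recdec\<close> signals truth by 1.\<close>
  have "recfn 1 (\<lambda>xs. rec_nat 1 (\<lambda>i y. 0) (hd xs))"
    unfolding One_nat_def by (intro recfn_rec_nat recfn_const recfn_hd)
  then have "rec1 (rec_nat 1 (\<lambda>i y. 0))"
    unfolding rec1_def by simp
  from rec1D[OF this assms(1)[unfolded recdec_def]]
  have "recfn (Suc k) (\<lambda>xs. if P (hd xs) (tl xs) then 0 else 1)"
    by (rule recfn_cong) auto
  from recfn_SucD[OF this]
  obtain f where f: "\<And>w xs. length xs = k \<Longrightarrow> rec_eval f (w # xs) (if P w xs then 0 else 1)"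
    by auto
  show ?thesis unfolding recfn_def
  proof (intro exI allI impI)
    fix xs :: "nat list" assume len: "length xs = k"
    show "rec_eval (Mu f) xs (LEAST w. P w xs)"
    proof (rule rec_eval.Mu)
      show "rec_eval f ((LEAST w. P w xs) # xs) 0"
        using f[OF len, of "LEAST w. P w xs"] LeastI_ex[OF assms(2)[OF len]] by simp
      show "\<exists>y. rec_eval f (m # xs) (Suc y)" if "m < (LEAST w. P w xs)" for m
        using f[OF len, of m] not_less_Least[OF that] by auto
    qed
  qed
qed

section \<open>Arithmetic and decidable predicates\<close>

lemma recfn_binop_rec:
  assumes "recfn 2 (\<lambda>xs. rec_nat (hd xs) (\<lambda>i y. S i y xs) (hd (tl xs)))"
    "\<And>x n. rec_nat x (\<lambda>i y. S i y [x,n]) n = g x n"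
  shows "rec2 g"
  unfolding rec2_def using assms(1)
  by (rule recfn_cong) (auto simp: numeral_2_eq_2 length_Suc_conv assms(2))

lemma recfn_2nd: "recfn (Suc (Suc k)) (\<lambda>xs. hd (tl xs))"
  by (rule recfn_tl[OF recfn_hd])

lemma rec2_add: "rec2 (+)"
proof (rule recfn_binop_rec[where S = "\<lambda>i y xs. Suc y"])
  show "recfn 2 (\<lambda>xs. rec_nat (hd xs) (\<lambda>i y. Suc y) (hd (tl xs)))"
    unfolding numeral_2_eq_2 by (intro recfn_rec_nat recfn_Suc recfn_2nd recfn_hd)
  show "rec_nat x (\<lambda>i y. Suc y) n = x + n" for x n by (induction n) auto
qed

lemma rec1_pred: "rec1 (\<lambda>x. x - 1)"
proof -
  have "recfn 1 (\<lambda>xs. rec_nat 0 (\<lambda>i y. i) (hd xs))"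
    unfolding One_nat_def by (intro recfn_rec_nat recfn_const recfn_hd)
  moreover have "rec_nat 0 (\<lambda>i y. i) n = n - 1" for n :: nat
    by (cases n) auto
  ultimately show ?thesis unfolding rec1_def by simp
qed

lemma rec2_diff: "rec2 (-)"
proof (rule recfn_binop_rec[where S = "\<lambda>i y xs. y - 1"])
  show "recfn 2 (\<lambda>xs. rec_nat (hd xs) (\<lambda>i y. y - 1) (hd (tl xs)))"
    unfolding numeral_2_eq_2 by (intro recfn_rec_nat rec1D[OF rec1_pred] recfn_2nd recfn_hd)
  show "rec_nat x (\<lambda>i y. y - 1) n = x - n" for x n :: nat by (induction n) auto
qed

lemmas recfn_add = rec2D[OF rec2_add]
lemmas recfn_diff = rec2D[OF rec2_diff]

lemma recfn_if:
  assumes "recdec k P" "recfn k F" "recfn k G"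
  shows "recfn k (\<lambda>xs. if P xs then F xs else G xs)"
proof (rule recfn_cong)
  show "recfn k (\<lambda>xs. rec_nat (G xs) (\<lambda>i y. F xs) (if P xs then 1 else 0))"
    by (intro recfn_rec_nat assms assms(1)[unfolded recdec_def] recfn_tl)
qed simp

lemma recdec_eq_0: "recfn k F \<Longrightarrow> recdec k (\<lambda>xs. F xs = 0)"
  unfolding recdec_def
  by (rule recfn_cong[OF recfn_diff[OF recfn_const[of k 1]]]) auto

lemma recdec_le:
  assumes "recfn k F" "recfn k G"
  shows "recdec k (\<lambda>xs. F xs \<le> G xs)"
  by (rule recdec_cong[OF recdec_eq_0[OF recfn_diff[OF assms]]]) auto

lemma recdec_not: "recdec k P \<Longrightarrow> recdec k (\<lambda>xs. \<not> P xs)"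
  by (rule recdec_cong[OF recdec_eq_0]) (auto simp: recdec_def)

lemma recdec_conj: "recdec k P \<Longrightarrow> recdec k Q \<Longrightarrow> recdec k (\<lambda>xs. P xs \<and> Q xs)"
  unfolding recdec_def[of _ "\<lambda>xs. P xs \<and> Q xs"]
  by (rule recfn_cong[OF recfn_if[of k P "\<lambda>xs. if Q xs then 1 else 0" "\<lambda>_. 0"]])
    (auto simp: recdec_def intro: recfn_const)

lemma recdec_disj: "recdec k P \<Longrightarrow> recdec k Q \<Longrightarrow> recdec k (\<lambda>xs. P xs \<or> Q xs)"
  by (rule recdec_cong[OF recdec_not[OF recdec_conj[OF recdec_not recdec_not]]]) auto

lemma recdec_imp: "recdec k P \<Longrightarrow> recdec k Q \<Longrightarrow> recdec k (\<lambda>xs. P xs \<longrightarrow> Q xs)"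
  by (rule recdec_cong[OF recdec_disj[OF recdec_not]]) auto

lemma recdec_less: "recfn k F \<Longrightarrow> recfn k G \<Longrightarrow> recdec k (\<lambda>xs. F xs < G xs)"
  by (rule recdec_cong[OF recdec_not[OF recdec_le[of k G F]]]) auto

lemma recdec_eq: "recfn k F \<Longrightarrow> recfn k G \<Longrightarrow> recdec k (\<lambda>xs. F xs = G xs)"
  by (rule recdec_cong[OF recdec_conj[OF recdec_le[of k F G] recdec_le[of k G F]]]) auto

lemma recdec_const: "recdec k (\<lambda>xs. b)"
  unfolding recdec_def by (rule recfn_const)

lemma recdec_Bex:
  assumes "finite T" "\<And>t. t \<in> T \<Longrightarrow> recdec k (P t)"
  shows "recdec k (\<lambda>xs. \<exists>t\<in>T. P t xs)"
  using assms by (induction T rule: finite_induct) (simp_all add: recdec_const recdec_disj)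

lemma recdec_all_less:
  assumes "recdec (Suc k) (\<lambda>xs. P (hd xs) (tl xs))" "recfn k N"
  shows "recdec k (\<lambda>xs. \<forall>i<N xs. P i xs)"
proof -
  have "recdec (Suc (Suc k)) (\<lambda>ys. P (hd ys) (tl (tl ys)))"
    unfolding recdec_def
    by (rule recfn_cong[OF recfn_comp[OF assms(1)[unfolded recdec_def],
          of "hd # map (\<lambda>i xs. xs ! Suc (Suc i)) [0..<k]" "Suc (Suc k)"]])
      (auto intro!: recfn_nth recfn_hd simp: comp_def length_Suc_conv map_nth)
  then have "recfn k (\<lambda>xs. rec_nat 1 (\<lambda>i y. if P i xs then y else 0) (N xs))"
    by (intro recfn_rec_nat recfn_if recfn_const recfn_2nd assms(2))
  moreover have "rec_nat 1 (\<lambda>i y. if P i xs then y else 0) n = (if \<forall>i<n. P i xs then 1 else 0::nat)" for n xs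
    by (induction n) (auto simp: less_Suc_eq)
  ultimately show ?thesis unfolding recdec_def by simp
qed

section \<open>Recursive coding of pairs and lists\<close>

lemma rec1_triangle: "rec1 triangle"
proof -
  have "recfn 1 (\<lambda>xs. rec_nat 0 (\<lambda>i y. y + Suc i) (hd xs))"
    unfolding One_nat_def by (intro recfn_rec_nat recfn_const recfn_hd recfn_add recfn_Suc recfn_2nd)
  moreover have "rec_nat 0 (\<lambda>i y. y + Suc i) n = triangle n" for n
    by (induction n) (auto simp: triangle_Suc)
  ultimately show ?thesis unfolding rec1_def by simp
qed

definition pair :: "nat \<Rightarrow> nat \<Rightarrow> nat" where "pair a b = prod_encode (a, b)"
definition pfst :: "nat \<Rightarrow> nat" where "pfst z = fst (prod_decode z)"
definition psnd :: "nat \<Rightarrow> nat" where "psnd z = snd (prod_decode z)"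

lemma pfst_pair [simp]: "pfst (pair a b) = a" and psnd_pair [simp]: "psnd (pair a b) = b"
  by (simp_all add: pair_def pfst_def psnd_def)

lemma pair_surj [simp]: "pair (pfst z) (psnd z) = z"
  by (simp add: pair_def pfst_def psnd_def)

lemma pair_0 [simp]: "pair 0 0 = 0"
  by (simp add: pair_def prod_encode_def)

lemma pfst_0 [simp]: "pfst 0 = 0" and psnd_0 [simp]: "psnd 0 = 0"
  using pfst_pair[of 0 0] psnd_pair[of 0 0] by simp_all

lemma rec2_pair: "rec2 pair"
  unfolding rec2_def pair_def prod_encode_def numeral_2_eq_2 case_prod_conv
  by (intro recfn_add rec1D[OF rec1_triangle] recfn_hd recfn_2nd)

lemma triangle_mono: "a \<le> b \<Longrightarrow> triangle a \<le> triangle b"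
  by (induction b) (auto simp: le_Suc_eq)

text \<open>\<open>prod_encode\<close> puts (a, b) at place a of the antidiagonal a + b, which
  starts at \<open>triangle (a + b)\<close>. A search for the antidiagonal thus makes both
  projections recursive, by subtraction.\<close>

lemma pair_root: "(LEAST s. z < triangle (Suc s)) = pfst z + psnd z"
proof (rule Least_equality)
  have z: "z = triangle (pfst z + psnd z) + pfst z"
    using pair_surj[of z] by (simp add: pair_def prod_encode_def)
  show "z < triangle (Suc (pfst z + psnd z))" by (subst z) simp
  show "pfst z + psnd z \<le> y" if "z < triangle (Suc y)" for y
    using that z triangle_mono[of "Suc y" "pfst z + psnd z"] by (intro leI) force
qed

lemma rec1_root: "rec1 (\<lambda>z. LEAST s. z < triangle (Suc s))"
  unfolding rec1_def
proof (rule recfn_Least)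
  show "recdec (Suc 1) (\<lambda>xs. hd (tl xs) < triangle (Suc (hd xs)))"
    unfolding One_nat_def
    by (intro recdec_less recfn_2nd rec1D[OF rec1_triangle] recfn_Suc recfn_hd)
  show "\<exists>w. hd xs < triangle (Suc w)" for xs
    using triangle_Suc by (intro exI[of _ "hd xs"]) (auto simp: triangle_Suc)
qed

lemma rec1_pfst: "rec1 pfst"
proof -
  have *: "pfst z = z - triangle (pfst z + psnd z)" for z
    using pair_surj[of z] by (simp add: pair_def prod_encode_def)
  have "rec1 (\<lambda>z. z - triangle (LEAST s. z < triangle (Suc s)))"
    unfolding rec1_def One_nat_def
    by (intro recfn_diff recfn_hd rec1D[OF rec1_triangle] rec1D[OF rec1_root])
  then show ?thesis unfolding pair_root *[symmetric] .
qed

lemma rec1_psnd: "rec1 psnd"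
proof -
  have "rec1 (\<lambda>z. (LEAST s. z < triangle (Suc s)) - pfst z)"
    unfolding rec1_def One_nat_def
    by (intro recfn_diff recfn_hd rec1D[OF rec1_pfst] rec1D[OF rec1_root])
  then show ?thesis unfolding pair_root by simp
qed

definition lcons :: "nat \<Rightarrow> nat \<Rightarrow> nat" where "lcons x c = Suc (pair x c)"
definition ltl :: "nat \<Rightarrow> nat" where "ltl c = psnd (c - 1)"
definition lhd :: "nat \<Rightarrow> nat" where "lhd c = pfst (c - 1)"
definition lnth :: "nat \<Rightarrow> nat \<Rightarrow> nat" where "lnth c i = lhd ((ltl ^^ i) c)"
definition llen :: "nat \<Rightarrow> nat" where "llen c = length (list_decode c)"

lemma list_encode_Cons: "list_encode (x # xs) = lcons x (list_encode xs)"
  by (simp add: lcons_def pair_def)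

lemma ltl_encode [simp]: "ltl (list_encode xs) = list_encode (tl xs)"
  using psnd_0 by (cases xs) (simp_all add: ltl_def psnd_def)

lemma lhd_lcons [simp]: "lhd (lcons x c) = x" and ltl_lcons [simp]: "ltl (lcons x c) = c"
  by (simp_all add: lhd_def ltl_def lcons_def)

lemma ltl_pow_encode: "(ltl ^^ i) (list_encode xs) = list_encode (drop i xs)"
  by (induction i) (simp_all add: drop_Suc tl_drop)

lemma lnth_encode: "i < length xs \<Longrightarrow> lnth (list_encode xs) i = xs ! i"
  unfolding lnth_def ltl_pow_encode
  by (simp add: Cons_nth_drop_Suc[symmetric] list_encode_Cons del: list_encode.simps)

lemma llen_encode [simp]: "llen (list_encode xs) = length xs"
  by (simp add: llen_def)

lemma rec2_lcons: "rec2 lcons"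
  unfolding rec2_def lcons_def numeral_2_eq_2
  by (intro recfn_Suc rec2D[OF rec2_pair] recfn_hd recfn_2nd)

lemma rec1_lhd: "rec1 lhd" and rec1_ltl: "rec1 ltl"
  unfolding rec1_def lhd_def ltl_def One_nat_def
  by (intro rec1D[OF rec1_psnd] rec1D[OF rec1_pfst] recfn_diff recfn_hd recfn_const)+

lemma rec2_ltl_pow: "rec2 (\<lambda>c i. (ltl ^^ i) c)"
proof (rule recfn_binop_rec[where S = "\<lambda>i y xs. ltl y"])
  show "recfn 2 (\<lambda>xs. rec_nat (hd xs) (\<lambda>i y. ltl y) (hd (tl xs)))"
    unfolding numeral_2_eq_2 by (intro recfn_rec_nat rec1D[OF rec1_ltl] recfn_2nd recfn_hd)
  show "rec_nat x (\<lambda>i. ltl) n = (ltl ^^ n) x" for x n :: nat by (induction n) auto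
qed

lemma rec2_lnth: "rec2 lnth"
  unfolding rec2_def lnth_def numeral_2_eq_2
  by (intro rec1D[OF rec1_lhd] rec2D[OF rec2_ltl_pow] recfn_hd recfn_2nd)

text \<open>Since \<open>ltl\<close> maps the empty code 0 to 0, iterated tails reach 0 exactly at
  the length of the list and stay there.\<close>

lemma llen_Least: "llen c = (LEAST i. (ltl ^^ i) c = 0)"
proof -
  have "(ltl ^^ i) c = 0 \<longleftrightarrow> length (list_decode c) \<le> i" for i
    using ltl_pow_encode[of i "list_decode c"] list_encode_eq[of "drop i (list_decode c)" "[]"]
    by simp
  then show ?thesis by (simp add: llen_def Least_equality[symmetric])
qed

lemma rec1_llen: "rec1 llen"
  unfolding rec1_def llen_Least
proof (rule recfn_Least)
  show "recdec (Suc 1) (\<lambda>xs. (ltl ^^ hd xs) (hd (tl xs)) = 0)"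
    unfolding One_nat_def
    by (intro recdec_eq rec2D[OF rec2_ltl_pow] recfn_2nd recfn_const recfn_hd)
  show "\<exists>w. (ltl ^^ w) (hd xs) = 0" for xs
    using ltl_pow_encode[of "length (list_decode (hd xs))" "list_decode (hd xs)"] by auto
qed

lemmas recfn_intros =
  recfn_if recdec_eq recdec_le recdec_less recdec_conj recdec_disj recdec_imp
  recdec_not recfn_Suc recfn_add recfn_diff rec2D[OF rec2_pair] rec1D[OF rec1_pfst]
  rec1D[OF rec1_psnd] rec2D[OF rec2_lcons] rec1D[OF rec1_lhd] rec1D[OF rec1_ltl]
  rec2D[OF rec2_lnth] rec1D[OF rec1_llen] recfn_hd recfn_tl[OF recfn_hd]
  recfn_tl[OF recfn_tl[OF recfn_hd]]

lemma lcode_eqI: "llen s = llen t \<Longrightarrow> (\<And>i. i < llen t \<Longrightarrow> lnth s i = lnth t i) \<Longrightarrow> s = t"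
  unfolding llen_def
  by (metis lnth_encode list_decode_inverse nth_equalityI)

section \<open>Context-free languages are analytic\<close>

lemma recdec_comp4:
  assumes "recdec 4 P" "recfn k F0" "recfn k F1" "recfn k F2" "recfn k F3"
  shows "recdec k (\<lambda>xs. P [F0 xs, F1 xs, F2 xs, F3 xs])"
  using recfn_comp[OF assms(1)[unfolded recdec_def], of "[F0,F1,F2,F3]" k] assms(2-)
  unfolding recdec_def by auto

lemma recdec_subset:
  assumes "finite A" "recfn k F"
  shows "recdec k (\<lambda>xs. set (list_decode (F xs)) \<subseteq> A)"
proof (rule recdec_cong)
  show "recdec k (\<lambda>xs. \<forall>i<llen (F xs). \<exists>a\<in>A. lnth (F xs) i = a)"
    by (intro recdec_all_less recdec_Bex assms(1) recdec_eq rec2D[OF rec2_lnth] recfn_tl assms(2)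
        recfn_hd recfn_const rec1D[OF rec1_llen])
  show "(\<forall>i<llen (F xs). \<exists>a\<in>A. lnth (F xs) i = a) = (set (list_decode (F xs)) \<subseteq> A)" for xs
    using lnth_encode[of _ "list_decode (F xs)"] by (auto simp: llen_def set_conv_nth)
qed

lemma set_prefix_subset: "w \<in> omega_words X \<Longrightarrow> prefix n w \<in> lists X"
  by (auto simp: omega_words_def Pi_iff)

text \<open>
  The witness \<open>\<tau>\<close> marks the graph of a sequence \<open>g\<close>: the bit at \<open>pair i e\<close>
  says that \<open>e\<close> is a possible value of \<open>g i\<close>.
\<close>

lemma Sigma11_local:
  assumes X: "finite X" and P: "recdec 4 P" and pos: "rec1 pos"
  shows "{\<sigma> \<in> omega_words X. \<exists>g. \<forall>i. P [i, g i, g (Suc i), \<sigma> (pos (g i))]} \<in> Sigma11 X"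
proof -
  \<comment> \<open>The index \<open>n\<close> codes two kinds of demand. If
    \<open>pfst n = 0\<close>, some prefix of the witness must end in a set bit whose place belongs
    to index \<open>psnd n\<close>: a value of \<open>g\<close> there exists. Otherwise
    \<open>psnd n\<close> codes (i, e, e'), and if e and e' are marked at i and i + 1, then
    \<open>P\<close> must hold of them; here the prefix only has to be long enough to show the bits
    and the letter.\<close>
  define Q where "Q n u v \<longleftrightarrow> set (list_decode u) \<subseteq> {0, 1} \<and> set (list_decode v) \<subseteq> X \<and>
    ((pfst n = 0 \<and> 0 < llen u \<and> lnth u (llen u - 1) = 1 \<and> pfst (llen u - 1) = psnd n) \<or>
     (0 < pfst n \<and> pair (pfst (psnd n)) (pfst (psnd (psnd n))) < llen u \<and>
      pair (Suc (pfst (psnd n))) (psnd (psnd (psnd n))) < llen u \<and>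
      pos (pfst (psnd (psnd n))) < llen v \<and>
      (lnth u (pair (pfst (psnd n)) (pfst (psnd (psnd n)))) = 1 \<and>
       lnth u (pair (Suc (pfst (psnd n))) (psnd (psnd (psnd n)))) = 1 \<longrightarrow>
       P [pfst (psnd n), pfst (psnd (psnd n)), psnd (psnd (psnd n)), lnth v (pos (pfst (psnd (psnd n))))])))"
    for n u v
  define R where "R = {(n, u, v). Q n (list_encode u) (list_encode v)}"
  have "recdec 3 (\<lambda>xs. Q (xs ! 0) (xs ! 1) (xs ! 2))"
    unfolding Q_def
    by (intro recfn_intros recdec_subset X finite.intros recfn_nth recfn_const recdec_comp4[OF P]
        rec1D[OF pos]) simp_all
  then obtain f where f: "\<And>xs. length xs = 3 \<Longrightarrow> rec_eval f xs (if Q (xs ! 0) (xs ! 1) (xs ! 2) then 1 else 0)"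
    unfolding recdec_def recfn_def by auto
  have rec: "recursive_rel R"
    unfolding recursive_rel_def R_def
    using f[of "[n, list_encode u, list_encode v]" for n u v] by (intro exI[of _ f]) simp
  have sub: "R \<subseteq> UNIV \<times> lists {0, 1} \<times> lists X"
    unfolding R_def Q_def by auto
  have "(\<exists>g. \<forall>i. P [i, g i, g (Suc i), \<sigma> (pos (g i))]) \<longleftrightarrow>
     (\<exists>\<tau>\<in>omega_words {0, 1}. \<forall>n. \<exists>m. (n, prefix m \<tau>, prefix m \<sigma>) \<in> R)" (is "?L \<longleftrightarrow> ?R")
    if \<sigma>: "\<sigma> \<in> omega_words X" for \<sigma>
  proof
    assume ?L
    then obtain g where g: "\<And>i. P [i, g i, g (Suc i), \<sigma> (pos (g i))]" by blast
    define \<tau> :: "nat word" where "\<tau> z = (if psnd z = g (pfst z) then 1 else 0)" for z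
    have \<tau>: "\<tau> \<in> omega_words {0, 1}" by (auto simp: omega_words_def \<tau>_def)
    have sets: "set (prefix m \<tau>) \<subseteq> {0, 1} \<and> set (prefix m \<sigma>) \<subseteq> X" for m
      using set_prefix_subset[OF \<tau>] set_prefix_subset[OF \<sigma>] unfolding in_lists_conv_set by blast
    have "\<exists>m. (n, prefix m \<tau>, prefix m \<sigma>) \<in> R" for n
    proof (cases "pfst n = 0")
      case True
      define z m where "z = pair (psnd n) (g (psnd n))" and "m = Suc z"
      have "m - 1 = z" "0 < m" "\<tau> z = 1" "pfst z = psnd n"
        by (simp_all add: m_def z_def \<tau>_def)
      moreover from this have "lnth (list_encode (prefix m \<tau>)) z = 1"
        by (subst lnth_encode) (simp_all add: m_def nth_append)
      ultimately show ?thesis using True sets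
        unfolding R_def Q_def by (intro exI[of _ m]) simp
    next
      case False
      define i e e' where "i = pfst (psnd n)" "e = pfst (psnd (psnd n))" "e' = psnd (psnd (psnd n))"
      define m where "m = Suc (pair i e + pair (Suc i) e' + pos e)"
      have m: "pair i e < m" "pair (Suc i) e' < m" "pos e < m" by (auto simp: m_def)
      have "lnth (list_encode (prefix m w)) z = w z" if "z < m" for z and w :: "nat word"
        using that by (subst lnth_encode) simp_all
      with m g sets False show ?thesis unfolding R_def Q_def
        by (intro exI[of _ m]) (simp add: i_e_e'_def[symmetric] \<tau>_def)
    qed
    with \<tau> show ?R by blast
  next
    assume ?R
    then obtain \<tau> where \<tau>: "\<And>n. \<exists>m. (n, prefix m \<tau>, prefix m \<sigma>) \<in> R" by blast
    have "\<exists>e. \<tau> (pair i e) = 1" for i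
    proof -
      obtain m where m: "Q (pair 0 i) (list_encode (prefix m \<tau>)) (list_encode (prefix m \<sigma>))"
        using \<tau>[of "pair 0 i"] unfolding R_def by auto
      then have "0 < m" "\<tau> (m - 1) = 1" "pfst (m - 1) = i"
        unfolding Q_def by (auto simp: lnth_encode)
      then show ?thesis by (metis pair_surj)
    qed
    \<comment> \<open>Several values may be marked for the same index. Any choice works, as the
      second demand speaks of all pairs of marked values.\<close>
    then obtain g where g: "\<And>i. \<tau> (pair i (g i)) = 1" by metis
    have "P [i, g i, g (Suc i), \<sigma> (pos (g i))]" for i
    proof -
      obtain m where m: "Q (pair 1 (pair i (pair (g i) (g (Suc i))))) (list_encode (prefix m \<tau>)) (list_encode (prefix m \<sigma>))"
        using \<tau>[of "pair 1 (pair i (pair (g i) (g (Suc i))))"] unfolding R_def by auto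
      then show ?thesis unfolding Q_def using g by (auto simp: lnth_encode)
    qed
    then show ?L by blast
  qed
  then show ?thesis
    unfolding Sigma11_def using sub rec by (intro CollectI exI[of _ R]) auto
qed

section \<open>Local conditions for accepting runs\<close>

lemma label_word_Suc:
  "label_word (prefix (Suc n) b) = label_word (prefix n b) @ (case b n of None \<Rightarrow> [] | Some a \<Rightarrow> [a])"
  by (simp add: label_word_def)

text \<open>With \<open>p i\<close> as the number of letters read before step \<open>i\<close>,
  comparing whole prefixes reduces to a check of each single step. That the lengths are unbounded
  becomes the recurrence of steps that read a letter.\<close>

lemma spells_iff:
  "spells b \<sigma> \<longleftrightarrow> (\<exists>p. p 0 = 0 \<and> (\<forall>i. case b i of None \<Rightarrow> p (Suc i) = p i
      | Some a \<Rightarrow> p (Suc i) = Suc (p i) \<and> \<sigma> (p i) = a) \<and> (\<exists>\<^sub>\<infinity>i. b i \<noteq> None))" (is "?L \<longleftrightarrow> ?R")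
proof
  assume L: ?L
  define p where "p i = length (label_word (prefix i b))" for i
  have "case b i of None \<Rightarrow> p (Suc i) = p i | Some a \<Rightarrow> p (Suc i) = Suc (p i) \<and> \<sigma> (p i) = a" for i
  proof (cases "b i")
    case None
    then show ?thesis unfolding p_def label_word_Suc by simp
  next
    case (Some a)
    have "label_word (prefix (Suc i) b) = prefix (p (Suc i)) \<sigma>"
      using L unfolding spells_def p_def by blast
    moreover have "p (Suc i) = Suc (p i)" unfolding p_def label_word_Suc using Some by simp
    ultimately have "label_word (prefix i b) @ [a] = prefix (p i) \<sigma> @ [\<sigma> (p i)]"
      unfolding label_word_Suc using Some by simp
    then show ?thesis using Some \<open>p (Suc i) = Suc (p i)\<close> by simp
  qed
  moreover have "\<exists>\<^sub>\<infinity>i. b i \<noteq> None"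
  proof (rule ccontr)
    assume "\<not> ?thesis"
    then obtain n where n: "\<And>i. i \<ge> n \<Longrightarrow> b i = None"
      by (auto simp: INFM_nat_le)
    have "p i \<le> p n" for i
    proof (cases "i \<le> n")
      case True
      then show ?thesis
      proof (induction rule: inc_induct)
        case (step m)
        then show ?case unfolding p_def label_word_Suc by (cases "b m") auto
      qed simp
    next
      case False
      then have "n \<le> i" by simp
      then show ?thesis
        by (induction rule: dec_induct) (auto simp: p_def label_word_def n)
    qed
    moreover obtain i where "Suc (p n) \<le> p i" using L unfolding spells_def p_def by blast
    ultimately show False using not_less_eq_eq by blast
  qed
  moreover have "p 0 = 0" by (simp add: p_def label_word_def)
  ultimately show ?R by blast
next
  assume ?R
  then obtain p where p: "p 0 = 0" "\<And>i. case b i of None \<Rightarrow> p (Suc i) = p i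
      | Some a \<Rightarrow> p (Suc i) = Suc (p i) \<and> \<sigma> (p i) = a" "\<exists>\<^sub>\<infinity>i. b i \<noteq> None" by blast
  have lw: "label_word (prefix n b) = prefix (p n) \<sigma>" for n
  proof (induction n)
    case 0
    then show ?case by (simp add: p(1) label_word_def)
  next
    case (Suc n)
    then show ?case using p(2)[of n] unfolding label_word_Suc by (cases "b n") auto
  qed
  have mono: "p i \<le> p (Suc i)" for i using p(2)[of i] by (cases "b i") auto
  have "\<exists>n. l \<le> p n" for l
  proof (induction l)
    case (Suc l)
    then obtain n where n: "l \<le> p n" by blast
    obtain m where m: "m \<ge> n" "b m \<noteq> None" using p(3) unfolding INFM_nat_le by blast
    have "p n \<le> p m" using lift_Suc_mono_le[of p, OF mono m(1)] .
    then show ?case using n m(2) p(2)[of m] by (intro exI[of _ "Suc m"]) auto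
  qed simp
  then show ?L unfolding spells_def lw by simp
qed

text \<open>Makes recurrence local: the distance to the next hit drops by one at every step that is
  not a hit. Conversely, any ranking with this property forces infinitely many hits, as a natural
  number cannot drop forever.\<close>

definition countdown :: "(nat \<Rightarrow> bool) \<Rightarrow> nat \<Rightarrow> nat" where
  "countdown Q i = (LEAST k. Q (i + k))"

lemma countdown:
  assumes "\<exists>\<^sub>\<infinity>i. Q i"
  shows "Q i \<and> countdown Q i = 0 \<or> countdown Q i = Suc (countdown Q (Suc i))"
proof (cases "Q i")
  case True
  then show ?thesis by (simp add: countdown_def Least_equality)
next
  case False
  obtain j where "j \<ge> i" "Q j" using assms unfolding INFM_nat_le by blast
  then have "Q (i + (j - i))" by simp
  then show ?thesis
    using Least_Suc[of "\<lambda>k. Q (i + k)" "j - i"] False unfolding countdown_def by simp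
qed

lemma countdown_INFM:
  assumes "\<And>i. Q i \<or> l i = Suc (l (Suc i))"
  shows "\<exists>\<^sub>\<infinity>i. Q i"
proof -
  have "\<exists>j\<ge>i. Q j" if "l i = n" for i n
    using that
  proof (induction n arbitrary: i)
    case 0
    then show ?case using assms[of i] by auto
  next
    case (Suc n)
    then show ?case using assms[of i] Suc.IH[of "Suc i"] by (metis Suc_inject Suc_leD le_refl)
  qed
  then show ?thesis unfolding INFM_nat_le by blast
qed

lemma INFM_finite_Bex:
  assumes "finite F"
  shows "(\<exists>\<^sub>\<infinity>i. f i \<in> F) \<longleftrightarrow> (\<exists>q\<in>F. \<exists>\<^sub>\<infinity>i. f i = q)"
  using frequently_bex_finite_distrib[OF assms, of "\<lambda>i q. f i = q" cofinite] by simp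

lemma lhd_Suc_prod_encode [simp]: "lhd (Suc (prod_encode (x, c))) = x"
  and ltl_Suc_prod_encode [simp]: "ltl (Suc (prod_encode (x, c))) = c"
  using lhd_lcons[of x c] ltl_lcons[of x c] by (simp_all add: lcons_def pair_def)

lemma list_encode_append: "list_encode (\<beta> @ \<gamma>) = foldr lcons \<beta> (list_encode \<gamma>)"
  by (induction \<beta>) (simp_all add: list_encode_Cons del: list_encode.simps)

lemma recfn_foldr_lcons: "recfn k F \<Longrightarrow> recfn k (\<lambda>xs. foldr lcons \<beta> (F xs))"
  by (induction \<beta>) (simp_all add: rec2D[OF rec2_lcons] recfn_const)

text \<open>A code \<open>e\<close> holds the state, the coded stack, the number of letters read,
  and two countdowns: \<open>l\<close> to the next final state and \<open>d\<close> to the next step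
  that reads a letter. The countdowns are constrained only between hits. The fourth argument is the
  letter of the input at the position stored in \<open>e\<close>.\<close>

definition pda_local :: "pushdown_automaton \<Rightarrow> nat list \<Rightarrow> bool" where
  "pda_local M xs \<longleftrightarrow>
     (let q = pfst; s = (\<lambda>e. pfst (psnd e)); p = (\<lambda>e. pfst (psnd (psnd e)));
          l = (\<lambda>e. pfst (psnd (psnd (psnd e)))); d = (\<lambda>e. psnd (psnd (psnd (psnd e))));
          e = xs ! 1; e' = xs ! 2
      in (xs ! 0 = 0 \<longrightarrow> q e = pda_init M \<and> s e = list_encode [pda_start M] \<and> p e = 0) \<and>
         (\<exists>t\<in>pda_trans M. q e = fst t \<and> q e' = fst (snd (snd (snd t))) \<and> s e \<noteq> 0 \<and>
            lhd (s e) = fst (snd (snd t)) \<and>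
            s e' = foldr lcons (snd (snd (snd (snd t)))) (ltl (s e)) \<and>
            (if fst (snd t) = None then p e' = p e \<and> d e = Suc (d e')
             else xs ! 3 = the (fst (snd t)) \<and> p e' = Suc (p e))) \<and>
         ((\<exists>f\<in>pda_final M. q e = f) \<or> l e = Suc (l e')))"

lemma recdec_if:
  assumes "b \<Longrightarrow> recdec k P" "\<not> b \<Longrightarrow> recdec k Q"
  shows "recdec k (\<lambda>xs. if b then P xs else Q xs)"
  using assms by (cases b) simp_all

lemma recdec_pda_local:
  assumes "pushdown_automaton_wf M"
  shows "recdec 4 (pda_local M)"
proof -
  have fin: "finite (pda_trans M)" "finite (pda_final M)"
    using assms unfolding pushdown_automaton_wf_def by (auto intro: finite_subset)
  show ?thesis unfolding pda_local_def Let_def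
    by (intro recfn_intros recdec_Bex fin recdec_if recfn_foldr_lcons recfn_nth recfn_const) simp_all
qed

lemma pda_lang_local:
  assumes "pushdown_automaton_wf M"
  shows "pda_lang M = {\<sigma> \<in> omega_words (pda_alphabet M).
    \<exists>g. \<forall>i. pda_local M [i, g i, g (Suc i), \<sigma> (pfst (psnd (psnd (g i))))]}"
proof -
  have fin: "finite (pda_final M)"
    using assms unfolding pushdown_automaton_wf_def by (auto intro: finite_subset)
  have "(\<exists>r. pda_run M \<sigma> r \<and> (\<exists>\<^sub>\<infinity>i. fst (r i) \<in> pda_final M)) \<longleftrightarrow>
    (\<exists>g. \<forall>i. pda_local M [i, g i, g (Suc i), \<sigma> (pfst (psnd (psnd (g i))))])" (is "?L \<longleftrightarrow> ?R") for \<sigma>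
  proof
    assume ?L
    then obtain r b where r: "r 0 = (pda_init M, [pda_start M])"
      "\<And>i. pda_step M (b i) (r i) (r (Suc i))" and "spells b \<sigma>" and
      F: "\<exists>\<^sub>\<infinity>i. fst (r i) \<in> pda_final M" unfolding pda_run_def by blast
    then obtain p where p: "p 0 = 0" "\<And>i. case b i of None \<Rightarrow> p (Suc i) = p i
      | Some a \<Rightarrow> p (Suc i) = Suc (p i) \<and> \<sigma> (p i) = a" and b: "\<exists>\<^sub>\<infinity>i. b i \<noteq> None"
      unfolding spells_iff by blast
    define g where "g i = pair (fst (r i)) (pair (list_encode (snd (r i))) (pair (p i)
        (pair (countdown (\<lambda>i. fst (r i) \<in> pda_final M) i) (countdown (\<lambda>i. b i \<noteq> None) i))))" for i
    have "pda_local M [i, g i, g (Suc i), \<sigma> (pfst (psnd (psnd (g i))))]" for i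
    proof -
      obtain q Z q' \<beta> \<gamma> where t: "(q, b i, Z, q', \<beta>) \<in> pda_trans M"
        and ri: "r i = (q, Z # \<gamma>)" "r (Suc i) = (q', \<beta> @ \<gamma>)"
        using r(2)[of i] unfolding pda_step_def by (auto split: prod.splits)
      have 1: "(if b i = None then p (Suc i) = p i \<and>
          countdown (\<lambda>i. b i \<noteq> None) i = Suc (countdown (\<lambda>i. b i \<noteq> None) (Suc i))
             else \<sigma> (p i) = the (b i) \<and> p (Suc i) = Suc (p i))"
        using p(2)[of i] countdown[OF b, of i] by (cases "b i") auto
      have 2: "i = 0 \<longrightarrow> q = pda_init M \<and> Z # \<gamma> = [pda_start M] \<and> p i = 0"
        using r(1) ri(1) p(1) by auto
      show ?thesis unfolding pda_local_def Let_def
        apply (simp add: g_def ri list_encode_append)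
        apply (intro conjI)
        subgoal using r(1) p(1) by simp
        subgoal
          by (rule bexI[OF _ t]) (use 1 in \<open>auto split: if_splits\<close>)
        subgoal using countdown[OF F, of i] by (auto simp: ri)
        done
    qed
    then show ?R by blast
  next
    assume ?R
    then obtain g where g: "\<And>i. pda_local M [i, g i, g (Suc i), \<sigma> (pfst (psnd (psnd (g i))))]" by blast
    define q s p l d where "q i = pfst (g i)" and "s i = pfst (psnd (g i))" and "p i = pfst (psnd (psnd (g i)))"
      and "l i = pfst (psnd (psnd (psnd (g i))))" and "d i = psnd (psnd (psnd (psnd (g i))))" for i
    note defs = q_def s_def p_def l_def d_def
    have nths: "[x, y, z, w] ! 0 = x" "[x, y, z, w] ! 1 = y" "[x, y, z, w] ! 2 = z"
      "[x, y, z, w] ! 3 = w" for x y z w :: nat by simp_all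
    have g0: "q 0 = pda_init M \<and> s 0 = list_encode [pda_start M] \<and> p 0 = 0"
      using g[of 0] unfolding pda_local_def Let_def defs by simp
    have "\<forall>i. \<exists>t\<in>pda_trans M. q i = fst t \<and> q (Suc i) = fst (snd (snd (snd t))) \<and> s i \<noteq> 0 \<and>
            lhd (s i) = fst (snd (snd t)) \<and>
            s (Suc i) = foldr lcons (snd (snd (snd (snd t)))) (ltl (s i)) \<and>
            (if fst (snd t) = None then p (Suc i) = p i \<and> d i = Suc (d (Suc i))
             else \<sigma> (p i) = the (fst (snd t)) \<and> p (Suc i) = Suc (p i))"
      using g unfolding pda_local_def Let_def defs nths by blast
    from choice[OF this[unfolded Bex_def]]
    obtain t where t: "\<And>i. t i \<in> pda_trans M" "\<And>i. q i = fst (t i)"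
      "\<And>i. q (Suc i) = fst (snd (snd (snd (t i))))" "\<And>i. s i \<noteq> 0"
      "\<And>i. lhd (s i) = fst (snd (snd (t i)))"
      "\<And>i. s (Suc i) = foldr lcons (snd (snd (snd (snd (t i))))) (ltl (s i))"
      "\<And>i. (if fst (snd (t i)) = None then p (Suc i) = p i \<and> d i = Suc (d (Suc i))
             else \<sigma> (p i) = the (fst (snd (t i))) \<and> p (Suc i) = Suc (p i))"
      by blast
    define b where "b i = fst (snd (t i))" for i
    define r where "r i = (q i, list_decode (s i))" for i
    have bi: "case b i of None \<Rightarrow> p (Suc i) = p i | Some a \<Rightarrow> p (Suc i) = Suc (p i) \<and> \<sigma> (p i) = a"
      "b i \<noteq> None \<or> d i = Suc (d (Suc i))" for i
      using t(7)[of i] unfolding b_def by (cases "fst (snd (t i))"; simp)+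
    have "spells b \<sigma>" unfolding spells_iff
      using bi(1) countdown_INFM[of "\<lambda>i. b i \<noteq> None" d, OF bi(2)] g0 by blast
    moreover have "pda_step M (b i) (r i) (r (Suc i))" for i
    proof -
      obtain Z \<gamma> where Z: "s i = list_encode (Z # \<gamma>)"
        using t(4)[of i] by (metis list_decode_inverse list_encode.simps(1) neq_Nil_conv)
      have "lhd (s i) = Z" "ltl (s i) = list_encode \<gamma>"
        unfolding Z by (simp_all add: list_encode_Cons del: list_encode.simps)
      then show ?thesis
        using t(1)[of i] t(2,3,5,6)[of i] Z unfolding pda_step_def r_def b_def
        by (cases "t i") (auto simp: list_encode_append[symmetric] simp del: list_encode.simps)
    qed
    moreover have "\<exists>\<^sub>\<infinity>i. fst (r i) \<in> pda_final M"
      by (rule countdown_INFM[of _ l]) (use g in \<open>simp add: pda_local_def Let_def defs r_def\<close>)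
    moreover have "r 0 = (pda_init M, [pda_start M])"
      using g0 by (simp add: r_def del: list_encode.simps)
    ultimately show ?L unfolding pda_run_def by blast
  qed
  then show ?thesis unfolding pda_lang_def INFM_finite_Bex[OF fin, symmetric] by blast
qed

lemma CFL_subset_Sigma11: "CFL X \<subseteq> Sigma11 X"
proof
  fix L assume "L \<in> CFL X"
  then obtain M where M: "pushdown_automaton_wf M" "pda_alphabet M = X" "L = pda_lang M"
    unfolding CFL_def by blast
  have "rec1 (\<lambda>e. pfst (psnd (psnd e)))"
    unfolding rec1_def One_nat_def
    by (intro rec1D[OF rec1_pfst] rec1D[OF rec1_psnd] recfn_hd)
  from Sigma11_local[OF _ recdec_pda_local[OF M(1)] this, of X]
  show "L \<in> Sigma11 X"
    using M unfolding pda_lang_local[OF M(1)] M(3) pushdown_automaton_wf_def by simp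
qed

section \<open>Analytic sets by step functions\<close>

lemma recdec_comp3:
  assumes "recdec 3 P" "recfn k F0" "recfn k F1" "recfn k F2"
  shows "recdec k (\<lambda>xs. P [F0 xs, F1 xs, F2 xs])"
  using recfn_comp[OF assms(1)[unfolded recdec_def], of "[F0,F1,F2]" k] assms(2-)
  unfolding recdec_def by auto

text \<open>States of the machine keep the prefixes reversed, since a code can be extended only at
  its head. \<open>revtake\<close> recovers the code of the first \<open>j\<close> letters in their
  proper order.\<close>

definition revtake :: "nat \<Rightarrow> nat \<Rightarrow> nat" where
  "revtake j c = list_encode (map (\<lambda>i. lnth c (llen c - 1 - i)) [0..<j])"

lemma revtake_encode:
  assumes "j \<le> length xs"
  shows "revtake j (list_encode (rev xs)) = list_encode (take j xs)"
  unfolding revtake_def list_encode_eq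
  by (rule nth_equalityI) (use assms in \<open>auto simp: lnth_encode rev_nth\<close>)

lemma revtake_Least:
  "revtake j c = (LEAST t. llen t = j \<and> (\<forall>i<j. lnth t i = lnth c (llen c - 1 - i)))"
proof -
  have "llen t = j \<and> (\<forall>i<j. lnth t i = lnth c (llen c - 1 - i)) \<longleftrightarrow> t = revtake j c" for t
    using lcode_eqI[of t "revtake j c"] by (auto simp: revtake_def lnth_encode)
  then show ?thesis by (simp add: Least_equality)
qed

lemma rec2_revtake: "rec2 revtake"
  unfolding rec2_def revtake_Least
proof (rule recfn_Least)
  show "recdec (Suc 2) (\<lambda>xs. llen (hd xs) = hd (tl xs) \<and>
      (\<forall>i<hd (tl xs). lnth (hd xs) i = lnth (hd (tl (tl xs))) (llen (hd (tl (tl xs))) - 1 - i)))"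
    unfolding numeral_2_eq_2
    by (intro recdec_all_less recfn_intros recfn_const recfn_tl[OF recfn_tl[OF recfn_tl[OF recfn_hd]]])
  show "\<exists>w. llen w = hd xs \<and> (\<forall>i<hd xs. lnth w i = lnth (hd (tl xs)) (llen (hd (tl xs)) - 1 - i))" for xs
    by (intro exI[of _ "revtake (hd xs) (hd (tl xs))"]) (simp add: revtake_def lnth_encode)
qed

text \<open>A step consumes one guessed bit and a letter of each player, because the block game
  delivers real moves in pairs, one pair at a separator.\<close>

fun state_seq :: "(nat list \<Rightarrow> nat) \<Rightarrow> nat word \<Rightarrow> nat word \<Rightarrow> nat \<Rightarrow> nat" where
  "state_seq step \<tau> \<sigma> 0 = 0"
| "state_seq step \<tau> \<sigma> (Suc m) = step [state_seq step \<tau> \<sigma> m, \<tau> m, \<sigma> (2 * m), \<sigma> (2 * m + 1)]"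

text \<open>
  A state codes \<open>(n, j, u, v)\<close>, where \<open>u\<close> and \<open>v\<close> are the reversed prefixes of
  \<open>\<tau>\<close> and \<open>\<sigma>\<close> read so far. Each step tests whether \<open>j\<close> witnesses \<open>n\<close>;
  on success \<open>n\<close> is increased and the search restarts with \<open>j = 0\<close>.
\<close>

lemma Sigma11_machine:
  assumes "A \<in> Sigma11 X"
  obtains step acc where "recfn 4 step" "recfn 1 acc"
    "A = {\<sigma> \<in> omega_words X. \<exists>\<tau>\<in>omega_words {0, 1}. \<exists>\<^sub>\<infinity>m. acc [state_seq step \<tau> \<sigma> (Suc m)] = 0}"
proof -
  obtain R where rec: "recursive_rel R"
    and A: "A = {\<sigma> \<in> omega_words X. \<exists>\<tau>\<in>omega_words {0, 1}. \<forall>n. \<exists>m. (n, prefix m \<tau>, prefix m \<sigma>) \<in> R}"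
    using assms unfolding Sigma11_def by blast
  define Q where "Q xs \<longleftrightarrow> (xs ! 0, list_decode (xs ! 1), list_decode (xs ! 2)) \<in> R" for xs :: "nat list"
  obtain f where f: "\<And>n u v. rec_eval f [n, list_encode u, list_encode v] (if (n, u, v) \<in> R then 1 else 0)"
    using rec unfolding recursive_rel_def by blast
  have Q: "recdec 3 Q"
    unfolding recdec_def recfn_def
  proof (intro exI allI impI)
    fix xs :: "nat list" assume "length xs = 3"
    then obtain a b c where "xs = [a, b, c]" by (auto simp: numeral_3_eq_3 length_Suc_conv)
    then show "rec_eval f xs (if Q xs then 1 else 0)"
      using f[of a "list_decode b" "list_decode c"] by (simp add: Q_def)
  qed
  define N J U V where "N z = pfst z" and "J z = pfst (psnd z)" and "U z = pfst (psnd (psnd z))"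
    and "V z = psnd (psnd (psnd z))" for z
  define U' V' where "U' xs = lcons (xs ! 1) (U (xs ! 0))"
    and "V' xs = lcons (xs ! 3) (lcons (xs ! 2) (V (xs ! 0)))" for xs :: "nat list"
  define test where "test xs \<longleftrightarrow>
     Q [N (xs ! 0), revtake (J (xs ! 0)) (U' xs), revtake (J (xs ! 0)) (V' xs)]" for xs :: "nat list"
  define step where "step xs =
     (if test xs then pair (Suc (N (xs ! 0))) (pair 0 (pair (U' xs) (V' xs)))
      else pair (N (xs ! 0)) (pair (Suc (J (xs ! 0))) (pair (U' xs) (V' xs))))" for xs
  define acc where "acc xs = J (hd xs)" for xs
  have rt: "recdec 4 test"
    unfolding test_def N_def J_def U_def V_def U'_def V'_def
    by (intro recdec_comp3[OF Q] recfn_intros rec2D[OF rec2_revtake] recfn_nth) simp_all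
  have rs: "recfn 4 step"
    unfolding step_def N_def J_def U_def V_def U'_def V'_def
    by (intro recfn_intros rt recfn_nth recfn_const) simp_all
  have ra: "recfn 1 acc"
    unfolding acc_def J_def One_nat_def by (intro recfn_intros)
  have "(\<forall>n. \<exists>m. (n, prefix m \<tau>, prefix m \<sigma>) \<in> R) \<longleftrightarrow>
      (\<exists>\<^sub>\<infinity>m. acc [state_seq step \<tau> \<sigma> (Suc m)] = 0)" for \<tau> \<sigma>
  proof -
    define S where "S = state_seq step \<tau> \<sigma>"
    have UV: "U (S m) = list_encode (rev (prefix m \<tau>)) \<and> V (S m) = list_encode (rev (prefix (2 * m) \<sigma>))" for m
      by (induction m) (simp_all add: S_def step_def U_def V_def U'_def V'_def list_encode_Cons del: list_encode.simps,
          simp_all)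
    \<comment> \<open>The search index never overtakes the clock, so the prefixes tested at step
      \<open>m\<close> lie within the bits and letters read by then.\<close>
    have Jm: "J (S m) \<le> m" for m
      by (induction m) (simp_all add: S_def step_def J_def)
    have tst: "test [S m, \<tau> m, \<sigma> (2 * m), \<sigma> (2 * m + 1)] \<longleftrightarrow>
        (N (S m), prefix (J (S m)) \<tau>, prefix (J (S m)) \<sigma>) \<in> R" for m
    proof -
      have "U' [S m, \<tau> m, \<sigma> (2 * m), \<sigma> (2 * m + 1)] = list_encode (rev (prefix (Suc m) \<tau>))"
        "V' [S m, \<tau> m, \<sigma> (2 * m), \<sigma> (2 * m + 1)] = list_encode (rev (prefix (2 * Suc m) \<sigma>))"
        by (simp_all add: U'_def V'_def UV list_encode_Cons del: list_encode.simps)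
      moreover have "take (J (S m)) (prefix (Suc m) \<tau>) = prefix (J (S m)) \<tau>"
        "take (J (S m)) (prefix (2 * Suc m) \<sigma>) = prefix (J (S m)) \<sigma>"
        using Jm[of m] by (auto intro!: nth_equalityI simp: nth_append)
      moreover have "revtake (J (S m)) (list_encode (rev (prefix (Suc m) \<tau>))) =
            list_encode (take (J (S m)) (prefix (Suc m) \<tau>))"
        "revtake (J (S m)) (list_encode (rev (prefix (2 * Suc m) \<sigma>))) =
            list_encode (take (J (S m)) (prefix (2 * Suc m) \<sigma>))"
        using Jm[of m] by (intro revtake_encode; simp)+
      moreover have "Q [a, b, c] \<longleftrightarrow> (a, list_decode b, list_decode c) \<in> R" for a b c
        by (simp add: Q_def)
      ultimately show ?thesis unfolding test_def nth_Cons_0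
        by (simp only: list_encode_inverse)
    qed
    have step: "N (S (Suc m)) = (if (N (S m), prefix (J (S m)) \<tau>, prefix (J (S m)) \<sigma>) \<in> R then Suc (N (S m)) else N (S m))"
      "J (S (Suc m)) = (if (N (S m), prefix (J (S m)) \<tau>, prefix (J (S m)) \<sigma>) \<in> R then 0 else Suc (J (S m)))" for m
      using tst[of m] by (simp_all add: S_def step_def N_def J_def)
    show ?thesis
    proof
      assume all: "\<forall>n. \<exists>m. (n, prefix m \<tau>, prefix m \<sigma>) \<in> R"
      have "\<exists>m\<ge>k. J (S (Suc m)) = 0" for k
      proof (rule ccontr)
        assume "\<not> ?thesis"
        then have no: "\<And>m. m \<ge> k \<Longrightarrow> (N (S m), prefix (J (S m)) \<tau>, prefix (J (S m)) \<sigma>) \<notin> R"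
          unfolding step by auto
        \<comment> \<open>The last restart up to time \<open>k\<close>. From there on no test
          succeeds, so \<open>j\<close> runs through all lengths for one fixed \<open>n\<close>,
          although this \<open>n\<close> has a witness.\<close>
        define k' where "k' = (GREATEST k'. k' \<le> k \<and> J (S k') = 0)"
        have "J (S 0) = 0" by (simp add: S_def J_def)
        then have k': "k' \<le> k \<and> J (S k') = 0" unfolding k'_def
          by (intro GreatestI_nat[where P = "\<lambda>k'. k' \<le> k \<and> J (S k') = 0" and b = k]) auto
        have no': "(N (S m), prefix (J (S m)) \<tau>, prefix (J (S m)) \<sigma>) \<notin> R" if "m \<ge> k'" for m
        proof (cases "m \<ge> k")
          case False
          show ?thesis
          proof
            assume "(N (S m), prefix (J (S m)) \<tau>, prefix (J (S m)) \<sigma>) \<in> R"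
            then have "J (S (Suc m)) = 0" using step by simp
            then have "Suc m \<le> k'" unfolding k'_def using False
              by (intro Greatest_le_nat[where b = k]) auto
            then show False using that by simp
          qed
        qed (rule no)
        have "N (S (k' + i)) = N (S k') \<and> J (S (k' + i)) = i" for i
        proof (induction i)
          case (Suc i)
          then show ?case using no'[of "k' + i"] step[of "k' + i"] by auto
        qed (use k' in simp)
        then have "(N (S k'), prefix i \<tau>, prefix i \<sigma>) \<notin> R" for i
          using no'[of "k' + i"] by simp
        then show False using all by blast
      qed
      then show "\<exists>\<^sub>\<infinity>m. acc [state_seq step \<tau> \<sigma> (Suc m)] = 0"
        unfolding INFM_nat_le acc_def S_def by simp
    next
      assume "\<exists>\<^sub>\<infinity>m. acc [state_seq step \<tau> \<sigma> (Suc m)] = 0"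
      then have inf: "\<And>k. \<exists>m\<ge>k. J (S (Suc m)) = 0"
        unfolding INFM_nat_le acc_def S_def by simp
      have mono: "N (S m) \<le> N (S (Suc m))" for m by (simp add: step)
      have unb: "\<exists>m. N (S m) \<ge> n" for n
      proof (induction n)
        case (Suc n)
        then obtain m where m: "N (S m) \<ge> n" by blast
        obtain m' where m': "m' \<ge> m" "J (S (Suc m')) = 0" using inf by blast
        have "N (S m) \<le> N (S m')" using lift_Suc_mono_le[of "\<lambda>m. N (S m)", OF mono m'(1)] .
        with m m'(2) show ?case by (intro exI[of _ "Suc m'"]) (auto simp: step split: if_splits)
      qed simp
      \<comment> \<open>\<open>N\<close> grows by one at a time, and it can pass \<open>n\<close>
        only through a successful test for \<open>n\<close>.\<close>
      have "n < N (S m) \<Longrightarrow> \<exists>i. (n, prefix i \<tau>, prefix i \<sigma>) \<in> R" for n m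
      proof (induction m)
        case 0
        then show ?case by (simp add: S_def N_def)
      next
        case (Suc m)
        then show ?case unfolding step(1) by (cases "n < N (S m)") (auto simp: less_Suc_eq split: if_splits)
      qed
      then show "\<forall>n. \<exists>m. (n, prefix m \<tau>, prefix m \<sigma>) \<in> R"
        using unb by (meson Suc_le_eq)
    qed
  qed
  then show ?thesis using that[OF rs ra] A by simp
qed

section \<open>Register programs\<close>

type_synonym store = "nat \<Rightarrow> nat"

datatype instr = Inc nat | Dec nat | Tst nat | Nop

fun instr_rel :: "instr \<Rightarrow> (store \<times> store) set" where
  "instr_rel (Inc r) = {(s, s'). s' = s(r := Suc (s r))}"
| "instr_rel (Dec r) = {(s, s'). s r \<noteq> 0 \<and> s' = s(r := s r - 1)}"
| "instr_rel (Tst r) = {(s, s'). s r = 0 \<and> s' = s}"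
| "instr_rel Nop = Id"

definition nstep :: "(nat \<times> instr \<times> nat) set \<Rightarrow> ((nat \<times> store) \<times> (nat \<times> store)) set" where
  "nstep T = {((q, s), (q', s')). \<exists>I. (q, I, q') \<in> T \<and> (s, s') \<in> instr_rel I}"

text \<open>A program is a finite nondeterministic graph with entry 0 and exit 1, and only the
  relation between the stores at entry and exit matters. Stuck or diverging branches contribute no
  pair, so guesses, tests and partial functions can all be combined by operations on
  relations.\<close>

definition impl :: "(store \<times> store) set \<Rightarrow> bool" where
  "impl R \<longleftrightarrow> (\<exists>T. finite T \<and> (\<forall>s s'. ((0, s), (1, s')) \<in> (nstep T)\<^sup>* \<longleftrightarrow> (s, s') \<in> R))"

definition relabel :: "(nat \<Rightarrow> nat) \<Rightarrow> (nat \<times> instr \<times> nat) set \<Rightarrow> (nat \<times> instr \<times> nat) set" where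
  "relabel f T = (\<lambda>(q, I, q'). (f q, I, f q')) ` T"

lemma relabel_iff: "(p, I, p') \<in> relabel f T \<longleftrightarrow> (\<exists>q q'. p = f q \<and> p' = f q' \<and> (q, I, q') \<in> T)"
  unfolding relabel_def by force

lemma finite_relabel: "finite T \<Longrightarrow> finite (relabel f T)"
  unfolding relabel_def by simp

lemma nstep_relabel_rtrancl:
  assumes "((q, s), (q', s')) \<in> (nstep T)\<^sup>*" "relabel f T \<subseteq> T'"
  shows "((f q, s), (f q', s')) \<in> (nstep T')\<^sup>*"
  using assms(1)
proof (induction rule: rtrancl_induct2)
  case (step p t p' t')
  then have "((f p, t), (f p', t')) \<in> nstep T'"
    using assms(2) unfolding nstep_def by (force simp: relabel_def)
  with step(3) show ?case by simp
qed simp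

lemma nstep_NopI: "(q, Nop, q') \<in> T \<Longrightarrow> ((q, s), (q', s)) \<in> nstep T"
  unfolding nstep_def by force

lemma impl_instrs:
  assumes "finite C"
  shows "impl (\<Union>I\<in>C. instr_rel I)"
  unfolding impl_def
proof (intro exI conjI allI iffI)
  define T where "T = (\<lambda>I. (0::nat, I, 1::nat)) ` C"
  show "finite T" using assms by (simp add: T_def)
  show "(s, s') \<in> (\<Union>I\<in>C. instr_rel I)" if "((0, s), 1, s') \<in> (nstep T)\<^sup>*" for s s'
  proof -
    from that obtain z where z: "((0, s), z) \<in> nstep T" "(z, (1, s')) \<in> (nstep T)\<^sup>*"
      by (rule converse_rtranclE) auto
    then obtain I t where t: "z = (1, t)" "I \<in> C" "(s, t) \<in> instr_rel I" unfolding nstep_def T_def by auto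
    from z(2) have "z = (1, s')"
      unfolding t(1) by (rule converse_rtranclE) (auto simp: nstep_def T_def)
    with t show ?thesis by auto
  qed
  show "((0, s), 1, s') \<in> (nstep T)\<^sup>*" if "(s, s') \<in> (\<Union>I\<in>C. instr_rel I)" for s s'
    using that by (intro r_into_rtrancl) (auto simp: nstep_def T_def)
qed

lemma impl_empty: "impl {}" and impl_instr: "impl (instr_rel I)"
  using impl_instrs[of "{}"] impl_instrs[of "{I}"] by simp_all

lemma impl_relcomp:
  assumes "impl R" "impl S"
  shows "impl (R O S)"
proof -
  obtain TR where TR: "finite TR" "\<And>s s'. ((0, s), (1, s')) \<in> (nstep TR)\<^sup>* \<longleftrightarrow> (s, s') \<in> R"
    using assms(1) unfolding impl_def by blast
  obtain TS where TS: "finite TS" "\<And>s s'. ((0, s), (1, s')) \<in> (nstep TS)\<^sup>* \<longleftrightarrow> (s, s') \<in> S"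
    using assms(2) unfolding impl_def by blast
  \<comment> \<open>Disjoint copies of the two state sets that avoid 0 and 1. A component may return
    to its entry or continue beyond its exit, so neither can be reused as entry or exit of the whole
    program.\<close>
  define f g :: "nat \<Rightarrow> nat" where "f q = 2 * q + 2" and "g q = 2 * q + 3" for q
  have inj [simp]: "f q = f q' \<longleftrightarrow> q = q'" "g q = g q' \<longleftrightarrow> q = q'" "f q \<noteq> g q'" "g q' \<noteq> f q"
    "f q \<noteq> 0" "f q \<noteq> 1" "g q \<noteq> 0" "g q \<noteq> 1" "0 \<noteq> f q" "1 \<noteq> f q" "0 \<noteq> g q" "1 \<noteq> g q"
    "f q \<noteq> Suc 0" "g q \<noteq> Suc 0" "Suc 0 \<noteq> f q" "Suc 0 \<noteq> g q" for q q'
    unfolding f_def g_def by presburger+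
  define T where "T = {(0, Nop, f 0), (f 1, Nop, g 0), (g 1, Nop, 1)} \<union> relabel f TR \<union> relabel g TS"
  have sub: "relabel f TR \<subseteq> T" "relabel g TS \<subseteq> T" unfolding T_def by auto
  show ?thesis unfolding impl_def
  proof (intro exI[of _ T] conjI allI iffI)
    show "finite T" unfolding T_def by (simp add: TR TS finite_relabel)
  next
    fix s s' assume run: "((0, s), 1, s') \<in> (nstep T)\<^sup>*"
    have inv: "(fst x = 0 \<and> snd x = s) \<or> (\<exists>q. fst x = f q \<and> ((0, s), (q, snd x)) \<in> (nstep TR)\<^sup>*) \<or>
       (\<exists>q u. fst x = g q \<and> (s, u) \<in> R \<and> ((0, u), (q, snd x)) \<in> (nstep TS)\<^sup>*) \<or>
       (fst x = 1 \<and> (s, snd x) \<in> R O S)" if "((0, s), x) \<in> (nstep T)\<^sup>*" for x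
      using that
    proof (induction rule: rtrancl_induct)
      case (step x y)
      obtain I where I: "(fst x, I, fst y) \<in> T" "(snd x, snd y) \<in> instr_rel I"
        using step(2) unfolding nstep_def by auto
      from I(1) consider "fst x = 0" "I = Nop" "fst y = f 0" | "fst x = f 1" "I = Nop" "fst y = g 0"
        | "fst x = g 1" "I = Nop" "fst y = 1"
        | q q' where "fst x = f q" "fst y = f q'" "(q, I, q') \<in> TR"
        | q q' where "fst x = g q" "fst y = g q'" "(q, I, q') \<in> TS"
        unfolding T_def by (auto simp: relabel_iff)
      then show ?case
      proof cases
        case 1 then show ?thesis using step(3) I(2) by auto
      next
        case 2 then show ?thesis using step(3) I(2) TR(2)[of s "snd x"] by auto
      next
        case 3 then show ?thesis using step(3) I(2) TS(2)[of _ "snd x"] by auto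
      next
        case 4
        then have "((q, snd x), (q', snd y)) \<in> nstep TR" using I(2) unfolding nstep_def by auto
        then show ?thesis using step(3) 4 by (auto intro: rtrancl_into_rtrancl)
      next
        case 5
        then have "((q, snd x), (q', snd y)) \<in> nstep TS" using I(2) unfolding nstep_def by auto
        then show ?thesis using step(3) 5 by (auto intro: rtrancl_into_rtrancl)
      qed
    qed simp
    from inv[OF run] show "(s, s') \<in> R O S" by auto
  next
    fix s s' assume "(s, s') \<in> R O S"
    then obtain u where u: "(s, u) \<in> R" "(u, s') \<in> S" by blast
    have "((0, s), (f 0, s)) \<in> nstep T" "((f 1, u), (g 0, u)) \<in> nstep T" "((g 1, s'), (1, s')) \<in> nstep T"
      by (intro nstep_NopI; simp add: T_def)+
    moreover have "((f 0, s), (f 1, u)) \<in> (nstep T)\<^sup>*" "((g 0, u), (g 1, s')) \<in> (nstep T)\<^sup>*"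
      using u TR TS sub nstep_relabel_rtrancl by blast+
    ultimately show "((0, s), 1, s') \<in> (nstep T)\<^sup>*"
      by (meson converse_rtrancl_into_rtrancl rtrancl_into_rtrancl rtrancl_trans)
  qed
qed

lemma impl_rtrancl:
  assumes "impl R"
  shows "impl (R\<^sup>*)"
proof -
  obtain TR where TR: "finite TR" "\<And>s s'. ((0, s), (1, s')) \<in> (nstep TR)\<^sup>* \<longleftrightarrow> (s, s') \<in> R"
    using assms(1) unfolding impl_def by blast
  define f :: "nat \<Rightarrow> nat" where "f q = q + 2" for q
  have inj [simp]: "f q = f q' \<longleftrightarrow> q = q'" "f q \<noteq> 0" "f q \<noteq> 1" "f q \<noteq> Suc 0" "Suc 0 \<noteq> f q" for q q'
    unfolding f_def by presburger+
  define T where "T = {(0, Nop, f 0), (0, Nop, 1), (f 1, Nop, 0)} \<union> relabel f TR"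
  have sub: "relabel f TR \<subseteq> T" unfolding T_def by auto
  show ?thesis unfolding impl_def
  proof (intro exI[of _ T] conjI allI iffI)
    show "finite T" unfolding T_def by (simp add: TR finite_relabel)
  next
    fix s s' assume run: "((0, s), 1, s') \<in> (nstep T)\<^sup>*"
    have inv: "(fst x \<in> {0, 1} \<and> (s, snd x) \<in> R\<^sup>*) \<or>
       (\<exists>q u. fst x = f q \<and> (s, u) \<in> R\<^sup>* \<and> ((0, u), (q, snd x)) \<in> (nstep TR)\<^sup>*)"
      if "((0, s), x) \<in> (nstep T)\<^sup>*" for x
      using that
    proof (induction rule: rtrancl_induct)
      case (step x y)
      obtain I where I: "(fst x, I, fst y) \<in> T" "(snd x, snd y) \<in> instr_rel I"
        using step(2) unfolding nstep_def by auto
      from I(1) consider "fst x = 0" "I = Nop" "fst y = f 0" | "fst x = 0" "I = Nop" "fst y = 1"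
        | "fst x = f 1" "I = Nop" "fst y = 0"
        | q q' where "fst x = f q" "fst y = f q'" "(q, I, q') \<in> TR"
        unfolding T_def by (auto simp: relabel_iff)
      then show ?case
      proof cases
        case 1 then show ?thesis using step(3) I(2) by auto
      next
        case 2 then show ?thesis using step(3) I(2) by auto
      next
        case 3 then show ?thesis using step(3) I(2) TR(2)[of _ "snd x"] by (auto intro: rtrancl_into_rtrancl)
      next
        case 4
        then have "((q, snd x), (q', snd y)) \<in> nstep TR" using I(2) unfolding nstep_def by auto
        then show ?thesis using step(3) 4 by (auto intro: rtrancl_into_rtrancl)
      qed
    qed simp
    from inv[OF run] show "(s, s') \<in> R\<^sup>*" by auto
  next
    fix s s' assume "(s, s') \<in> R\<^sup>*"
    then have "((0, s), 0, s') \<in> (nstep T)\<^sup>*"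
    proof (induction rule: rtrancl_induct)
      case (step u v)
      have "((0, u), (f 0, u)) \<in> nstep T" "((f 1, v), (0, v)) \<in> nstep T"
        by (intro nstep_NopI; simp add: T_def)+
      moreover have "((f 0, u), (f 1, v)) \<in> (nstep T)\<^sup>*"
        using step TR sub nstep_relabel_rtrancl by blast
      ultimately show ?case using step.IH
        by (meson rtrancl_into_rtrancl rtrancl_trans)
    qed simp
    moreover have "((0, s'), (1, s')) \<in> nstep T"
      by (intro nstep_NopI) (simp add: T_def)
    ultimately show "((0, s), 1, s') \<in> (nstep T)\<^sup>*"
      by (meson rtrancl_into_rtrancl)
  qed
qed

lemmas impl_intros = impl_relcomp impl_rtrancl impl_instr

text \<open>Loops are written as a star followed by a zero test: the star may stop at any time, and
  the test discards every exit that comes before the register is empty.\<close>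

definition clr :: "nat \<Rightarrow> (store \<times> store) set" where
  "clr r = (instr_rel (Dec r))\<^sup>* O instr_rel (Tst r)"

definition move :: "nat \<Rightarrow> nat \<Rightarrow> nat \<Rightarrow> (store \<times> store) set" where
  "move a b c = (instr_rel (Dec a) O instr_rel (Inc b) O instr_rel (Inc c))\<^sup>* O instr_rel (Tst a)"

text \<open>Moving is destructive, so the value is sent to \<open>b\<close> and \<open>t\<close> and
  brought back from \<open>t\<close>. The second \<open>clr b\<close> is needed because the way back
  adds the value to \<open>b\<close> once more.\<close>

definition copy :: "nat \<Rightarrow> nat \<Rightarrow> nat \<Rightarrow> (store \<times> store) set" where
  "copy a b t = clr b O clr t O move a b t O clr b O move t a b"

lemma impl_clr: "impl (clr r)" and impl_move: "impl (move a b c)"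
  unfolding clr_def move_def by (intro impl_intros)+

lemma impl_copy: "impl (copy a b t)"
  unfolding copy_def by (intro impl_intros impl_clr impl_move)

lemma clr_iff: "(s, s') \<in> clr r \<longleftrightarrow> s' = s(r := 0)"
proof
  assume "(s, s') \<in> clr r"
  then have "(s, s') \<in> (instr_rel (Dec r))\<^sup>*" "s' r = 0" unfolding clr_def by auto
  from this(1) have "\<forall>x. x \<noteq> r \<longrightarrow> s' x = s x"
    by (induction rule: rtrancl_induct) auto
  with \<open>s' r = 0\<close> show "s' = s(r := 0)" by (auto simp: fun_eq_iff)
next
  have "(s, s(r := 0)) \<in> (instr_rel (Dec r))\<^sup>*" if "s r = n" for n
    using that
  proof (induction n arbitrary: s)
    case 0
    then have "s(r := 0) = s" by auto
    then show ?case by simp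
  next
    case (Suc n)
    then have "(s, s(r := n)) \<in> instr_rel (Dec r)" by simp
    moreover have "(s(r := n), s(r := 0)) \<in> (instr_rel (Dec r))\<^sup>*"
      using Suc.IH[of "s(r := n)"] by (simp only: fun_upd_same fun_upd_upd simp_thms)
    ultimately show ?case by (rule converse_rtrancl_into_rtrancl)
  qed
  then show "(s, s') \<in> clr r" if "s' = s(r := 0)" unfolding clr_def using that by auto
qed

lemma move_iff:
  assumes "a \<noteq> b" "a \<noteq> c" "b \<noteq> c"
  shows "(s, s') \<in> move a b c \<longleftrightarrow> s' = s(a := 0, b := s b + s a, c := s c + s a)"
proof
  let ?B = "instr_rel (Dec a) O instr_rel (Inc b) O instr_rel (Inc c)"
  have B: "(s, s') \<in> ?B \<longleftrightarrow> s a \<noteq> 0 \<and> s' = s(a := s a - 1, b := Suc (s b), c := Suc (s c))" for s s'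
    using assms by (auto simp: relcomp_unfold)
  {
    assume "(s, s') \<in> move a b c"
    then have "(s, s') \<in> ?B\<^sup>*" "s' a = 0" unfolding move_def by auto
    from this(1) have "s' a \<le> s a \<and> s' b = s b + (s a - s' a) \<and> s' c = s c + (s a - s' a) \<and>
        (\<forall>x. x \<notin> {a, b, c} \<longrightarrow> s' x = s x)"
    proof (induction rule: rtrancl_induct)
      case (step y z)
      have "y a \<noteq> 0" "z = y(a := y a - 1, b := Suc (y b), c := Suc (y c))"
        using step(2) B[of y z] by auto
      moreover from this step(3) have "s a - (y a - 1) = Suc (s a - y a)" by arith
      ultimately show ?case using step(3) assms by simp
    qed simp
    then show "s' = s(a := 0, b := s b + s a, c := s c + s a)"
      using \<open>s' a = 0\<close> by (intro ext) simp
  }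
  have "(s, s(a := 0, b := s b + s a, c := s c + s a)) \<in> ?B\<^sup>*" if "s a = n" for n
    using that
  proof (induction n arbitrary: s)
    case 0
    then have "s(a := 0, b := s b + s a, c := s c + s a) = s" by (auto simp: fun_eq_iff)
    then show ?case by (simp only: rtrancl.rtrancl_refl)
  next
    case (Suc n)
    let ?s = "s(a := n, b := Suc (s b), c := Suc (s c))"
    have "(s, ?s) \<in> ?B" using B Suc.prems by simp
    moreover have "(?s, s(a := 0, b := s b + s a, c := s c + s a)) \<in> ?B\<^sup>*"
    proof -
      have "?s(a := 0, b := ?s b + ?s a, c := ?s c + ?s a) = s(a := 0, b := s b + s a, c := s c + s a)"
        using assms Suc.prems by (auto simp: fun_eq_iff)
      then show ?thesis using Suc.IH[of ?s] assms by (metis fun_upd_apply)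
    qed
    ultimately show ?case by (rule converse_rtrancl_into_rtrancl)
  qed
  then show "(s, s') \<in> move a b c" if "s' = s(a := 0, b := s b + s a, c := s c + s a)"
    unfolding move_def using that assms by (auto intro!: relcompI)
qed

lemma copy_iff:
  assumes "a \<noteq> b" "a \<noteq> t" "b \<noteq> t"
  shows "(s, s') \<in> copy a b t \<longleftrightarrow> s' = s(b := s a, t := 0)"
proof -
  have "s(b := 0, t := 0, a := 0, b := s a, t := s a, b := 0, t := 0, a := s a, b := s a) = s(b := s a, t := 0)"
    using assms by (auto simp: fun_eq_iff)
  then show ?thesis
    unfolding copy_def using assms
    by (simp add: relcomp_unfold clr_iff move_iff)
qed

definition clean :: "nat \<Rightarrow> store \<Rightarrow> bool" where
  "clean b s \<longleftrightarrow> (\<forall>r\<ge>b. s r = 0)"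

lemma clean_mono: "clean b s \<Longrightarrow> b \<le> c \<Longrightarrow> clean c s"
  by (auto simp: clean_def)

lemma clean_upd: "clean b s \<Longrightarrow> r < b \<Longrightarrow> clean b (s(r := x))"
  by (auto simp: clean_def)

text \<open>The registers from \<open>b\<close> on are scratch space: zero before and after the computation.\<close>

definition computes :: "(store \<times> store) set \<Rightarrow> recf \<Rightarrow> nat list \<Rightarrow> nat \<Rightarrow> nat \<Rightarrow> bool" where
  "computes R f as r b \<longleftrightarrow> impl R \<and>
     (\<forall>s s'. clean b s \<longrightarrow> ((s, s') \<in> R \<longleftrightarrow> (\<exists>y. rec_eval f (map s as) y \<and> s' = s(r := y))))"

section \<open>Register programs for recursive functions\<close>

lemma relcomp_iff: "(x, z) \<in> R O S \<longleftrightarrow> (\<exists>y. (x, y) \<in> R \<and> (y, z) \<in> S)"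
  by blast

lemma computesI:
  assumes "impl R"
    "\<And>s s'. clean b s \<Longrightarrow> (s, s') \<in> R \<longleftrightarrow> (\<exists>y. rec_eval f (map s as) y \<and> s' = s(r := y))"
  shows "computes R f as r b"
  using assms unfolding computes_def by blast

lemma computesD:
  assumes "computes R f as r b" "clean b s"
  shows "(s, s') \<in> R \<longleftrightarrow> (\<exists>y. rec_eval f (map s as) y \<and> s' = s(r := y))"
  using assms unfolding computes_def by blast

lemma computes_relcompD:
  assumes "computes R f as r b" "clean b s"
  shows "(s, s') \<in> R O S \<longleftrightarrow> (\<exists>y. rec_eval f (map s as) y \<and> (s(r := y), s') \<in> S)"
  unfolding relcomp_iff computesD[OF assms] by auto

lemma computes_impl: "computes R f as r b \<Longrightarrow> impl R"
  unfolding computes_def by blast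

lemma map_fun_upd_fresh: "r \<notin> set as \<Longrightarrow> map (s(r := x)) as = map s as"
  by (induction as) auto

definition block_upd :: "store \<Rightarrow> nat \<Rightarrow> nat list \<Rightarrow> store" where
  "block_upd s d ys = (\<lambda>r. if d \<le> r \<and> r < d + length ys then ys ! (r - d) else s r)"

lemma block_upd_Nil [simp]: "block_upd s d [] = s"
  by (auto simp: block_upd_def)

lemma block_upd_Cons: "block_upd s d (y # ys) = block_upd (s(d := y)) (Suc d) ys"
  by (auto simp: block_upd_def fun_eq_iff nth_Cons' le_Suc_eq Suc_le_eq)

lemma map_block_upd: "map (block_upd s d ys) [d..<d + length ys] = ys"
  by (rule nth_equalityI) (auto simp: block_upd_def)

text \<open>All functions use the same scratch bound \<open>c\<close>, which lies above the whole
  block of results. Hence computing one argument cannot damage those already stored.\<close>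

lemma computes_list:
  assumes "\<And>g as r b. g \<in> set gs \<Longrightarrow> set as \<subseteq> {..<b} \<Longrightarrow> r < b \<Longrightarrow> \<exists>R. computes R g as r b"
    "set as \<subseteq> {..<d}" "d + length gs \<le> c"
  shows "\<exists>R. impl R \<and> (\<forall>s s'. clean c s \<longrightarrow>
     ((s, s') \<in> R \<longleftrightarrow> (\<exists>ys. list_all2 (\<lambda>g y. rec_eval g (map s as) y) gs ys \<and> s' = block_upd s d ys)))"
  using assms
proof (induction gs arbitrary: d)
  case Nil
  then show ?case by (intro exI[of _ "instr_rel Nop"] conjI impl_instr) auto
next
  case (Cons g gs)
  have sub: "set as \<subseteq> {..<c}" "d < c" using Cons.prems(2,3) by auto
  obtain R where R: "computes R g as d c" using Cons.prems(1)[OF _ sub] by auto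
  have "\<exists>R. impl R \<and> (\<forall>s s'. clean c s \<longrightarrow>
     ((s, s') \<in> R \<longleftrightarrow> (\<exists>ys. list_all2 (\<lambda>g y. rec_eval g (map s as) y) gs ys \<and> s' = block_upd s (Suc d) ys)))"
    by (rule Cons.IH) (use Cons.prems in auto)
  then obtain R' where R': "impl R'" "\<And>s s'. clean c s \<Longrightarrow>
     ((s, s') \<in> R' \<longleftrightarrow> (\<exists>ys. list_all2 (\<lambda>g y. rec_eval g (map s as) y) gs ys \<and> s' = block_upd s (Suc d) ys))"
    by blast
  have fresh: "d \<notin> set as" using Cons.prems(2) by auto
  have "(s, s') \<in> R O R' \<longleftrightarrow> (\<exists>ys. list_all2 (\<lambda>g y. rec_eval g (map s as) y) (g # gs) ys \<and> s' = block_upd s d ys)"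
    if s: "clean c s" for s s'
  proof -
    have "(s, s') \<in> R O R' \<longleftrightarrow> (\<exists>y. rec_eval g (map s as) y \<and> (s(d := y), s') \<in> R')"
      by (rule computes_relcompD[OF R s])
    also have "\<dots> \<longleftrightarrow> (\<exists>y. rec_eval g (map s as) y \<and> (\<exists>ys. list_all2 (\<lambda>g y. rec_eval g (map s as) y) gs ys \<and>
        s' = block_upd (s(d := y)) (Suc d) ys))"
      using R'(2)[OF clean_upd[OF s sub(2)]] by (simp add: map_fun_upd_fresh[OF fresh])
    also have "\<dots> \<longleftrightarrow> (\<exists>ys. list_all2 (\<lambda>g y. rec_eval g (map s as) y) (g # gs) ys \<and> s' = block_upd s d ys)"
    proof -
      have "(\<exists>ys. list_all2 P (g # gs) ys \<and> Q ys) \<longleftrightarrow> (\<exists>y. P g y \<and> (\<exists>ys. list_all2 P gs ys \<and> Q (y # ys)))" for P Q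
        by (auto simp: list_all2_Cons1)
      from this[symmetric] show ?thesis unfolding block_upd_Cons[symmetric] .
    qed
    finally show ?thesis .
  qed
  then show ?case using R' computes_impl[OF R] by (intro exI[of _ "R O R'"]) (auto intro: impl_relcomp)
qed

lemma clr_range:
  "\<exists>R. impl R \<and> (\<forall>s s'. (s, s') \<in> R \<longleftrightarrow> s' = (\<lambda>r. if d \<le> r \<and> r < d + n then 0 else s r))"
proof (induction n)
  case 0
  then show ?case by (intro exI[of _ "instr_rel Nop"] conjI impl_instr) auto
next
  case (Suc n)
  then obtain R where R: "impl R" "\<And>s s'. (s, s') \<in> R \<longleftrightarrow> s' = (\<lambda>r. if d \<le> r \<and> r < d + n then 0 else s r)"
    by blast
  have "(\<lambda>r. if d \<le> r \<and> r < d + n then 0 else s r)(d + n := 0) =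
      (\<lambda>r. if d \<le> r \<and> r < d + Suc n then 0 else s r)" for s :: store
    by (auto simp: fun_eq_iff)
  then show ?case
    by (intro exI[of _ "R O clr (d + n)"] conjI impl_relcomp R(1) impl_clr)
      (simp add: relcomp_iff R(2) clr_iff)
qed

section \<open>Compilation of the constructors of recursive functions\<close>

lemma rec_eval_Zero: "rec_eval Zero xs y \<longleftrightarrow> y = 0"
  by (subst rec_eval.simps) auto

lemma rec_eval_Succ: "rec_eval Succ xs y \<longleftrightarrow> (\<exists>x. xs = [x] \<and> y = Suc x)"
  by (subst rec_eval.simps) auto

lemma rec_eval_Proj: "rec_eval (Proj i) xs y \<longleftrightarrow> i < length xs \<and> y = xs ! i"
  by (subst rec_eval.simps) auto

lemma rec_eval_Comp: "rec_eval (Comp f gs) xs z \<longleftrightarrow>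
    (\<exists>ys. list_all2 (\<lambda>g y. rec_eval g xs y) gs ys \<and> rec_eval f ys z)"
  by (subst rec_eval.simps) auto

lemma rec_eval_PrimRec_Nil: "\<not> rec_eval (PrimRec f g) [] y"
  by (subst rec_eval.simps) auto

lemma rec_eval_PrimRec_0: "rec_eval (PrimRec f g) (0 # xs) y \<longleftrightarrow> rec_eval f xs y"
  by (subst rec_eval.simps) auto

lemma rec_eval_PrimRec_Suc: "rec_eval (PrimRec f g) (Suc n # xs) z \<longleftrightarrow>
    (\<exists>y. rec_eval (PrimRec f g) (n # xs) y \<and> rec_eval g (n # y # xs) z)"
  by (subst rec_eval.simps) auto

lemma rec_eval_Mu: "rec_eval (Mu f) xs n \<longleftrightarrow>
    rec_eval f (n # xs) 0 \<and> (\<forall>m<n. \<exists>y. rec_eval f (m # xs) (Suc y))"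
  by (subst rec_eval.simps) auto

lemma computes_empty:
  "(\<And>xs y. length xs = length as \<Longrightarrow> \<not> rec_eval f xs y) \<Longrightarrow> \<exists>R. computes R f as r b"
  by (intro exI[of _ "{}"] computesI impl_empty) auto

lemma computes_Comp:
  assumes "\<And>g as r b. g \<in> set gs \<Longrightarrow> set as \<subseteq> {..<b} \<Longrightarrow> r < b \<Longrightarrow> \<exists>R. computes R g as r b"
    "\<And>as r b. set as \<subseteq> {..<b} \<Longrightarrow> r < b \<Longrightarrow> \<exists>R. computes R f as r b"
    "set as \<subseteq> {..<b}" "r < b"
  shows "\<exists>R. computes R (Comp f gs) as r b"
proof -
  define n c where "n = length gs" and "c = b + n"
  obtain R1 where R1: "impl R1" "\<And>s s'. clean c s \<Longrightarrow>
     ((s, s') \<in> R1 \<longleftrightarrow> (\<exists>ys. list_all2 (\<lambda>g y. rec_eval g (map s as) y) gs ys \<and> s' = block_upd s b ys))"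
    using computes_list[of gs as b c, OF assms(1)] assms(3) unfolding c_def n_def by auto
  obtain R2 where R2: "computes R2 f [b..<c] r c"
  proof -
    have "set [b..<c] \<subseteq> {..<c}" "r < c" using assms(4) unfolding c_def by auto
    from assms(2)[OF this] that show thesis by blast
  qed
  obtain R3 where R3: "impl R3" "\<And>s s'. (s, s') \<in> R3 \<longleftrightarrow> s' = (\<lambda>r. if b \<le> r \<and> r < b + n then 0 else s r)"
    using clr_range by meson
  have "(s, s') \<in> R1 O R2 O R3 \<longleftrightarrow> (\<exists>y. rec_eval (Comp f gs) (map s as) y \<and> s' = s(r := y))"
    if s: "clean b s" for s s'
  proof -
    have sc: "clean c s" using clean_mono[OF s] unfolding c_def by simp
    have len: "length ys = n" if "list_all2 (\<lambda>g y. rec_eval g (map s as) y) gs ys" for ys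
      using list_all2_lengthD[OF that] by (simp add: n_def)
    have cu: "clean c (block_upd s b ys)" if "length ys = n" for ys
      using sc that unfolding clean_def block_upd_def c_def by auto
    have fin: "(\<lambda>q. if b \<le> q \<and> q < b + n then 0 else ((block_upd s b ys)(r := z)) q) = s(r := z)"
      if "length ys = n" for ys z
      using that s assms(4) unfolding clean_def block_upd_def by (auto simp: fun_eq_iff)
    have "(s, s') \<in> R1 O R2 O R3 \<longleftrightarrow>
        (\<exists>ys. list_all2 (\<lambda>g y. rec_eval g (map s as) y) gs ys \<and> (block_upd s b ys, s') \<in> R2 O R3)"
      unfolding relcomp_iff using R1(2)[OF sc] by auto
    also have "\<dots> \<longleftrightarrow> (\<exists>ys. list_all2 (\<lambda>g y. rec_eval g (map s as) y) gs ys \<and>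
        (\<exists>z. rec_eval f ys z \<and> s' = s(r := z)))"
    proof (intro ex_cong1 conj_cong refl)
      fix ys assume "list_all2 (\<lambda>g y. rec_eval g (map s as) y) gs ys"
      note l = len[OF this]
      have m: "map (block_upd s b ys) [b..<c] = ys" using map_block_upd[of s b ys] l by (simp add: c_def)
      have "(block_upd s b ys, s') \<in> R2 O R3 \<longleftrightarrow>
         (\<exists>z. rec_eval f ys z \<and> ((block_upd s b ys)(r := z), s') \<in> R3)"
        using computes_relcompD[OF R2 cu[OF l]] m by simp
      also have "\<dots> \<longleftrightarrow> (\<exists>z. rec_eval f ys z \<and> s' = s(r := z))"
        unfolding R3(2) fin[OF l] ..
      finally show "(block_upd s b ys, s') \<in> R2 O R3 \<longleftrightarrow> (\<exists>z. rec_eval f ys z \<and> s' = s(r := z))" .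
    qed
    also have "\<dots> \<longleftrightarrow> (\<exists>y. rec_eval (Comp f gs) (map s as) y \<and> s' = s(r := y))"
      unfolding rec_eval_Comp by blast
    finally show ?thesis .
  qed
  then show ?thesis
    by (intro exI[of _ "R1 O R2 O R3"] computesI impl_relcomp R1(1) R3(1) computes_impl[OF R2])
qed

lemma computes_PrimRec:
  assumes IHf: "\<And>as r b. set as \<subseteq> {..<b} \<Longrightarrow> r < b \<Longrightarrow> \<exists>R. computes R f as r b"
    and IHg: "\<And>as r b. set as \<subseteq> {..<b} \<Longrightarrow> r < b \<Longrightarrow> \<exists>R. computes R g as r b"
    and as: "set as \<subseteq> {..<b}" and r: "r < b"
  shows "\<exists>R. computes R (PrimRec f g) as r b"
proof (cases as)
  case Nil
  then show ?thesis using computes_empty[of as "PrimRec f g" r b] rec_eval_PrimRec_Nil by auto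
next
  case (Cons a as')
  \<comment> \<open>Loop index \<open>i\<close>, current value \<open>y\<close>, next value
    \<open>y'\<close>, remaining iterations \<open>n\<close>, scratch \<open>t\<close> for copying.
    The argument \<open>a\<close> is saved in \<open>n\<close>, and \<open>r\<close> is written only
    at the end, as \<open>r\<close> may be one of the argument registers.\<close>
  define i y y' n t c where "i = b" and "y = b + 1" and "y' = b + 2" and "n = b + 3" and "t = b + 4" and "c = b + 5"
  note defs = i_def y_def y'_def n_def t_def c_def
  have lt: "a < b" "set as' \<subseteq> {..<b}" using as Cons by auto
  then have fresh: "i \<notin> set as'" "y \<notin> set as'" "y' \<notin> set as'" "n \<notin> set as'" unfolding defs by auto
  have neq [simp]: "a \<noteq> n" "a \<noteq> t" "n \<noteq> t" "n \<noteq> a" "t \<noteq> a" "t \<noteq> n" "y \<noteq> r" "y \<noteq> t" "r \<noteq> t" "y' \<noteq> y" "y' \<noteq> t"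
     "n \<noteq> y" "y \<noteq> n" "i \<noteq> y" "y \<noteq> i" "y \<noteq> y'" "n \<noteq> i" "i \<noteq> n" "i \<noteq> y'" "y' \<noteq> i" "n \<noteq> y'" "y' \<noteq> n" "t \<noteq> y"
     "t \<noteq> y'" "t \<noteq> i" "i \<noteq> t" "r \<noteq> i" "r \<noteq> y" "r \<noteq> y'" "r \<noteq> n" "i \<noteq> r" "y' \<noteq> r" "n \<noteq> r"
    using lt r unfolding defs by auto
  have ltc: "i < c" "y < c" "y' < c" "n < c" "t < c" unfolding defs by auto
  obtain Rf where Rf: "computes Rf f as' y c" using IHf[of as' c y] lt unfolding defs by fastforce
  obtain Rg where Rg: "computes Rg g (i # y # as') y' c" using IHg[of "i # y # as'" c y'] lt unfolding defs by fastforce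
  define body where "body = instr_rel (Dec n) O Rg O copy y' y t O clr y' O instr_rel (Inc i)"
  define R where "R = copy a n t O Rf O body\<^sup>* O instr_rel (Tst n) O copy y r t O clr y O clr i"
  have impl: "impl R" unfolding R_def body_def
    by (intro impl_relcomp impl_rtrancl impl_instr impl_copy impl_clr computes_impl[OF Rf] computes_impl[OF Rg])
  have "(s, s') \<in> R \<longleftrightarrow> (\<exists>z. rec_eval (PrimRec f g) (map s as) z \<and> s' = s(r := z))"
    if s: "clean b s" for s s'
  proof -
    define st where "st m k v = s(n := m, i := k, y := v)" for m k v
    define xs where "xs = map s as'"
    have zero: "s i = 0" "s y = 0" "s y' = 0" "s n = 0" "s t = 0"
      using s unfolding clean_def defs by auto
    have sc: "clean c s" using clean_mono[OF s] unfolding c_def by simp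
    have stc: "clean c (st m k v)" for m k v
      unfolding st_def by (intro clean_upd sc ltc)
    have stx: "map (st m k v) as' = xs" for m k v
      unfolding st_def xs_def using fresh by (simp add: map_fun_upd_fresh)
    have stval: "st m k v n = m" "st m k v i = k" "st m k v y = v" "st m k v y' = 0" "st m k v t = 0" for m k v
      by (simp_all add: st_def zero)
    have stu: "(st m k v)(n := m') = st m' k v" "(st m k v)(i := k') = st m k' v" "(st m k v)(y := v') = st m k v'"
       "(st m k v)(y' := 0) = st m k v" "(st m k v)(t := 0) = st m k v" for m k v m' k' v'
      by (auto simp: st_def zero fun_eq_iff)
    have body: "(st m k v, u) \<in> body \<longleftrightarrow> (\<exists>m' v'. m = Suc m' \<and> rec_eval g (k # v # xs) v' \<and> u = st m' (Suc k) v')"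
      for m k v u
    proof -
      have 1: "(st m k v, u) \<in> body \<longleftrightarrow> (\<exists>m'. m = Suc m' \<and> (st m' k v, u) \<in> Rg O copy y' y t O clr y' O instr_rel (Inc i))"
        unfolding body_def by (cases m) (auto simp: relcomp_iff stval stu)
      have 2: "(st m' k v, u) \<in> Rg O copy y' y t O clr y' O instr_rel (Inc i) \<longleftrightarrow>
         (\<exists>v'. rec_eval g (k # v # xs) v' \<and> ((st m' k v)(y' := v'), u) \<in> copy y' y t O clr y' O instr_rel (Inc i))" for m'
        using computes_relcompD[OF Rg stc[of m' k v]] by (simp add: stval stx)
      have 3: "((st m' k v)(y' := v'), u) \<in> copy y' y t O clr y' O instr_rel (Inc i) \<longleftrightarrow> u = st m' (Suc k) v'" for m' v'
      proof -
        have "(st m' k v)(y' := v', y := v', t := 0, y' := 0) = st m' k v'"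
          by (auto simp: st_def zero fun_eq_iff)
        then show ?thesis by (simp add: relcomp_iff copy_iff clr_iff stval stu)
      qed
      show ?thesis unfolding 1 2 3 by blast
    qed
    \<comment> \<open>After \<open>k\<close> iterations \<open>n\<close> holds N - k, so the zero
      test that follows the star singles out k = N.\<close>
    have loop: "(\<exists>v0. rec_eval f xs v0 \<and> (st N 0 v0, u) \<in> body\<^sup>*) \<longleftrightarrow>
        (\<exists>k v. k \<le> N \<and> rec_eval (PrimRec f g) (k # xs) v \<and> u = st (N - k) k v)" for N u
    proof
      assume "\<exists>v0. rec_eval f xs v0 \<and> (st N 0 v0, u) \<in> body\<^sup>*"
      then obtain v0 where v0: "rec_eval f xs v0" "(st N 0 v0, u) \<in> body\<^sup>*" by blast
      from v0(2) show "\<exists>k v. k \<le> N \<and> rec_eval (PrimRec f g) (k # xs) v \<and> u = st (N - k) k v"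
      proof (induction rule: rtrancl_induct)
        case base
        have "0 \<le> N \<and> rec_eval (PrimRec f g) (0 # xs) v0 \<and> st N 0 v0 = st (N - 0) 0 v0"
          using v0(1) by (simp add: rec_eval_PrimRec_0)
        then show ?case by blast
      next
        case (step u u')
        then obtain k v where kv: "k \<le> N" "rec_eval (PrimRec f g) (k # xs) v" "u = st (N - k) k v" by blast
        with step(2) body obtain m' v' where m': "N - k = Suc m'" "rec_eval g (k # v # xs) v'" "u' = st m' (Suc k) v'"
          by auto
        then have "N - Suc k = m'" by simp
        then have "Suc k \<le> N \<and> rec_eval (PrimRec f g) (Suc k # xs) v' \<and> u' = st (N - Suc k) (Suc k) v'"
          using kv m' by (auto simp: rec_eval_PrimRec_Suc)
        then show ?case by blast
      qed
    next
      assume "\<exists>k v. k \<le> N \<and> rec_eval (PrimRec f g) (k # xs) v \<and> u = st (N - k) k v"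
      then obtain k v where "k \<le> N" "rec_eval (PrimRec f g) (k # xs) v" "u = st (N - k) k v" by blast
      then show "\<exists>v0. rec_eval f xs v0 \<and> (st N 0 v0, u) \<in> body\<^sup>*"
      proof (induction k arbitrary: v u)
        case 0
        then show ?case by (auto simp: rec_eval_PrimRec_0)
      next
        case (Suc k)
        then obtain w where w: "rec_eval (PrimRec f g) (k # xs) w" "rec_eval g (k # w # xs) v"
          by (auto simp: rec_eval_PrimRec_Suc)
        obtain v0 where "rec_eval f xs v0" "(st N 0 v0, st (N - k) k w) \<in> body\<^sup>*"
          using Suc.IH[OF _ w(1) refl] Suc.prems(1) by auto
        moreover have "(st (N - k) k w, u) \<in> body"
        proof -
          have "N - k = Suc (N - Suc k) \<and> rec_eval g (k # w # xs) v \<and> u = st (N - Suc k) (Suc k) v"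
            using Suc.prems w by auto
          then show ?thesis unfolding body by blast
        qed
        ultimately show ?case by (meson rtrancl_into_rtrancl)
      qed
    qed
    have fin: "(st 0 k v, s') \<in> copy y r t O clr y O clr i \<longleftrightarrow> s' = s(r := v)" for k v
    proof -
      have "(st 0 k v)(r := v, t := 0, y := 0, i := 0) = s(r := v)"
        by (auto simp: st_def zero fun_eq_iff)
      then show ?thesis by (simp add: relcomp_iff copy_iff clr_iff stval)
    qed
    have "(s, s') \<in> R \<longleftrightarrow> (\<exists>v0 u. rec_eval f xs v0 \<and> (st (s a) 0 v0, u) \<in> body\<^sup>* \<and>
        (u, s') \<in> instr_rel (Tst n) O copy y r t O clr y O clr i)"
    proof -
      have s1: "s(n := s a, t := 0) = st (s a) 0 0" by (auto simp: st_def zero fun_eq_iff)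
      have "(s, s') \<in> R \<longleftrightarrow> (st (s a) 0 0, s') \<in> Rf O body\<^sup>* O instr_rel (Tst n) O copy y r t O clr y O clr i"
        unfolding R_def relcomp_iff[of _ _ "copy a n t"] by (simp add: copy_iff s1)
      also have "\<dots> \<longleftrightarrow> (\<exists>v0. rec_eval f xs v0 \<and> (st (s a) 0 v0, s') \<in> body\<^sup>* O instr_rel (Tst n) O copy y r t O clr y O clr i)"
        using computes_relcompD[OF Rf stc[of "s a" 0 0]] by (simp add: stx stu)
      also have "\<dots> \<longleftrightarrow> (\<exists>v0 u. rec_eval f xs v0 \<and> (st (s a) 0 v0, u) \<in> body\<^sup>* \<and>
        (u, s') \<in> instr_rel (Tst n) O copy y r t O clr y O clr i)" by blast
      finally show ?thesis .
    qed
    also have "\<dots> \<longleftrightarrow> (\<exists>u. (\<exists>v0. rec_eval f xs v0 \<and> (st (s a) 0 v0, u) \<in> body\<^sup>*) \<and> 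
        u n = 0 \<and> (u, s') \<in> copy y r t O clr y O clr i)"
      unfolding relcomp_iff[of _ _ "instr_rel (Tst n)"] by auto
    also have "\<dots> \<longleftrightarrow> (\<exists>v. rec_eval (PrimRec f g) (s a # xs) v \<and> (st 0 (s a) v, s') \<in> copy y r t O clr y O clr i)"
      (is "?A \<longleftrightarrow> ?B")
    proof
      assume ?A
      then obtain u k v where u: "k \<le> s a" "rec_eval (PrimRec f g) (k # xs) v" "u = st (s a - k) k v" "u n = 0"
        "(u, s') \<in> copy y r t O clr y O clr i" unfolding loop by blast
      then have "k = s a" by (simp add: stval)
      then have "rec_eval (PrimRec f g) (s a # xs) v \<and> (st 0 (s a) v, s') \<in> copy y r t O clr y O clr i"
        using u by simp
      then show ?B by blast
    next
      assume ?B
      then obtain v where v: "rec_eval (PrimRec f g) (s a # xs) v" "(st 0 (s a) v, s') \<in> copy y r t O clr y O clr i"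
        by blast
      have "s a \<le> s a \<and> rec_eval (PrimRec f g) (s a # xs) v \<and> st 0 (s a) v = st (s a - s a) (s a) v \<and> st 0 (s a) v n = 0"
        using v(1) by (simp add: stval)
      then show ?A unfolding loop using v(2) by blast
    qed
    also have "\<dots> \<longleftrightarrow> (\<exists>z. rec_eval (PrimRec f g) (map s as) z \<and> s' = s(r := z))"
      unfolding fin by (simp add: Cons xs_def)
    finally show ?thesis .
  qed
  then show ?thesis using computesI[OF impl] by blast
qed

lemma computes_Mu:
  assumes IHf: "\<And>as r b. set as \<subseteq> {..<b} \<Longrightarrow> r < b \<Longrightarrow> \<exists>R. computes R f as r b"
    and as: "set as \<subseteq> {..<b}" and r: "r < b"
  shows "\<exists>R. computes R (Mu f) as r b"
proof -
  define i y t c where "i = b" and "y = b + 1" and "t = b + 2" and "c = b + 3"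
  note defs = i_def y_def t_def c_def
  have neq [simp]: "y \<noteq> r" "y \<noteq> t" "r \<noteq> t" "i \<noteq> y" "y \<noteq> i" "t \<noteq> y" "t \<noteq> i" "i \<noteq> t" "r \<noteq> i" "r \<noteq> y" "i \<noteq> r"
    using r unfolding defs by auto
  have fresh: "i \<notin> set as" using as unfolding defs by auto
  have ltc: "i < c" "y < c" "t < c" unfolding defs by auto
  obtain Rf where Rf: "computes Rf f (i # as) y c" using IHf[of "i # as" c y] as unfolding defs by fastforce
  \<comment> \<open>\<open>Dec y\<close> blocks on the value 0, and a diverging call of
    \<open>f\<close> blocks as well. So the star passes only candidates with a defined positive
    value, as \<open>Mu\<close> demands, and the \<open>Tst y\<close> after it verifies that the
    search stops at a zero.\<close>
  define body where "body = Rf O instr_rel (Dec y) O clr y O instr_rel (Inc i)"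
  define R where "R = body\<^sup>* O Rf O instr_rel (Tst y) O copy i r t O clr i"
  have impl: "impl R" unfolding R_def body_def
    by (intro impl_relcomp impl_rtrancl impl_instr impl_copy impl_clr computes_impl[OF Rf])
  have "(s, s') \<in> R \<longleftrightarrow> (\<exists>z. rec_eval (Mu f) (map s as) z \<and> s' = s(r := z))"
    if s: "clean b s" for s s'
  proof -
    define st where "st k = s(i := k)" for k
    define xs where "xs = map s as"
    have zero: "s i = 0" "s y = 0" "s t = 0" using s unfolding clean_def defs by auto
    have sc: "clean c s" using clean_mono[OF s] unfolding c_def by simp
    have stc: "clean c (st k)" for k unfolding st_def by (intro clean_upd sc ltc)
    have stx: "map (st k) (i # as) = k # xs" for k
      unfolding st_def xs_def using fresh by (simp add: map_fun_upd_fresh)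
    have Rf': "(st k, u) \<in> Rf O S \<longleftrightarrow> (\<exists>v. rec_eval f (k # xs) v \<and> ((st k)(y := v), u) \<in> S)" for k u S
      using computes_relcompD[OF Rf stc] unfolding stx .
    have stu: "(st k)(y := 0) = st k" "(st k)(i := k') = st k'" for k k' by (auto simp: st_def zero fun_eq_iff)
    have sti: "st k i = k" for k by (simp add: st_def)
    have body: "(st k, u) \<in> body \<longleftrightarrow> (\<exists>v. rec_eval f (k # xs) (Suc v)) \<and> u = st (Suc k)" for k u
    proof -
      have "((st k)(y := v), u) \<in> instr_rel (Dec y) O clr y O instr_rel (Inc i) \<longleftrightarrow> v \<noteq> 0 \<and> u = st (Suc k)" for v
        by (auto simp: relcomp_iff clr_iff stu sti)
      then have "(st k, u) \<in> body \<longleftrightarrow> (\<exists>v. rec_eval f (k # xs) v \<and> v \<noteq> 0 \<and> u = st (Suc k))"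
        unfolding body_def Rf' by simp
      then show ?thesis by (auto simp: gr0_conv_Suc)
    qed
    have loop: "(st 0, u) \<in> body\<^sup>* \<longleftrightarrow> (\<exists>k. (\<forall>m<k. \<exists>v. rec_eval f (m # xs) (Suc v)) \<and> u = st k)" for u
    proof
      assume "(st 0, u) \<in> body\<^sup>*"
      then show "\<exists>k. (\<forall>m<k. \<exists>v. rec_eval f (m # xs) (Suc v)) \<and> u = st k"
      proof (induction rule: rtrancl_induct)
        case (step u u')
        then obtain k where "\<forall>m<k. \<exists>v. rec_eval f (m # xs) (Suc v)" "u = st k" by blast
        with step(2) body show ?case by (intro exI[of _ "Suc k"]) (auto simp: less_Suc_eq)
      qed auto
    next
      assume "\<exists>k. (\<forall>m<k. \<exists>v. rec_eval f (m # xs) (Suc v)) \<and> u = st k"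
      then obtain k where "\<forall>m<k. \<exists>v. rec_eval f (m # xs) (Suc v)" "u = st k" by blast
      then show "(st 0, u) \<in> body\<^sup>*"
      proof (induction k arbitrary: u)
        case (Suc k)
        then have "(st 0, st k) \<in> body\<^sup>*" by simp
        moreover have "(st k, u) \<in> body" using Suc.prems unfolding body by auto
        ultimately show ?case by (rule rtrancl_into_rtrancl)
      qed simp
    qed
    have st0: "s = st 0" by (auto simp: st_def zero fun_eq_iff)
    have fin: "(st k, s') \<in> Rf O instr_rel (Tst y) O copy i r t O clr i \<longleftrightarrow> rec_eval f (k # xs) 0 \<and> s' = s(r := k)" for k
    proof -
      have "((st k)(y := v), s') \<in> instr_rel (Tst y) O copy i r t O clr i \<longleftrightarrow> v = 0 \<and> s' = s(r := k)" for v
      proof -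
        have "(st k)(r := k, t := 0, i := 0) = s(r := k)" by (auto simp: st_def zero fun_eq_iff)
        then show ?thesis by (auto simp: relcomp_iff copy_iff clr_iff stu sti)
      qed
      then show ?thesis unfolding Rf' by simp
    qed
    have "(s, s') \<in> R \<longleftrightarrow> (st 0, s') \<in> body\<^sup>* O (Rf O instr_rel (Tst y) O copy i r t O clr i)"
      unfolding R_def by (subst st0) (rule refl)
    also have "\<dots> \<longleftrightarrow> (\<exists>u. (st 0, u) \<in> body\<^sup>* \<and> (u, s') \<in> Rf O instr_rel (Tst y) O copy i r t O clr i)"
      by (rule relcomp_iff)
    also have "\<dots> \<longleftrightarrow> (\<exists>k. (\<forall>m<k. \<exists>v. rec_eval f (m # xs) (Suc v)) \<and>
        (st k, s') \<in> Rf O instr_rel (Tst y) O copy i r t O clr i)"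
      unfolding loop by auto
    also have "\<dots> \<longleftrightarrow> (\<exists>k. (\<forall>m<k. \<exists>v. rec_eval f (m # xs) (Suc v)) \<and> rec_eval f (k # xs) 0 \<and> s' = s(r := k))"
      unfolding fin ..
    also have "\<dots> \<longleftrightarrow> (\<exists>z. rec_eval (Mu f) (map s as) z \<and> s' = s(r := z))"
      unfolding rec_eval_Mu xs_def[symmetric] by blast
    finally show ?thesis .
  qed
  then show ?thesis using computesI[OF impl] by blast
qed

lemma computes_copy:
  assumes "a < b" "r < b" "r \<noteq> a"
  shows "clean b s \<Longrightarrow> (s, s') \<in> copy a r b \<longleftrightarrow> s' = s(r := s a)"
proof -
  assume "clean b s"
  then have "s(r := s a, b := 0) = s(r := s a)" using assms by (auto simp: clean_def fun_eq_iff)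
  then show ?thesis using assms by (simp add: copy_iff)
qed

lemma computes_exists:
  assumes "set as \<subseteq> {..<b}" "r < b"
  shows "\<exists>R. computes R f as r b"
  using assms
proof (induction f arbitrary: as r b)
  case Zero
  show ?case
    by (intro exI[of _ "clr r"] computesI impl_clr) (auto simp: clr_iff rec_eval_Zero)
next
  case Succ
  show ?case
  proof (cases "length as = 1")
    case False
    then show ?thesis by (intro computes_empty) (auto simp: rec_eval_Succ)
  next
    case True
    then obtain a where a: "as = [a]" by (auto simp: length_Suc_conv)
    show ?thesis
    proof (cases "r = a")
      case True
      then show ?thesis
        by (intro exI[of _ "instr_rel (Inc a)"] computesI impl_instr) (auto simp: a rec_eval_Succ)
    next
      case False
      then show ?thesis using Succ computes_copy[of a b r]
        by (intro exI[of _ "copy a r b O instr_rel (Inc r)"] computesI impl_relcomp impl_copy impl_instr)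
          (auto simp: a rec_eval_Succ relcomp_iff)
    qed
  qed
next
  case (Proj i)
  show ?case
  proof (cases "i < length as")
    case False
    then show ?thesis by (intro computes_empty) (auto simp: rec_eval_Proj)
  next
    case True
    then have a: "as ! i < b" using Proj.prems(1) by (auto dest: nth_mem)
    show ?thesis
    proof (cases "r = as ! i")
      case True
      then show ?thesis using \<open>i < length as\<close>
        by (intro exI[of _ "instr_rel Nop"] computesI impl_instr) (auto simp: rec_eval_Proj)
    next
      case False
      then show ?thesis using Proj computes_copy[of "as ! i" b r] a True
        by (intro exI[of _ "copy (as ! i) r b"] computesI impl_copy) (auto simp: rec_eval_Proj)
    qed
  qed
next
  case (Comp f gs)
  then show ?case by (intro computes_Comp) blast+
next
  case (PrimRec f g)
  then show ?case by (intro computes_PrimRec) blast+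
next
  case (Mu f)
  then show ?case by (intro computes_Mu) blast+
qed

section \<open>Goedel numbers of stores\<close>

text \<open>Programs are specified through the relation \<open>rec_eval\<close>, the machine through
  the functions \<open>step\<close> and \<open>acc\<close>. Determinism identifies any value that a
  program yields with the intended one.\<close>

lemma rec_eval_det: "rec_eval f xs y \<Longrightarrow> rec_eval f xs z \<Longrightarrow> y = z"
proof (induction f arbitrary: xs y z)
  case (Comp f gs)
  then obtain ys zs where ys: "list_all2 (\<lambda>g y. rec_eval g xs y) gs ys" "rec_eval f ys y"
    and zs: "list_all2 (\<lambda>g y. rec_eval g xs y) gs zs" "rec_eval f zs z"
    unfolding rec_eval_Comp by blast
  have "ys = zs"
    using ys(1) zs(1) Comp.IH(2)
  proof (induction gs arbitrary: ys zs)
    case (Cons g gs)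
    then show ?case by (fastforce simp: list_all2_Cons1)
  qed simp
  then show ?case using Comp.IH(1) ys zs by blast
next
  case (PrimRec f g)
  show ?case
  proof (cases xs)
    case Nil
    then show ?thesis using PrimRec.prems rec_eval_PrimRec_Nil by blast
  next
    case (Cons n xs')
    have "rec_eval (PrimRec f g) (n # xs') y \<Longrightarrow> rec_eval (PrimRec f g) (n # xs') z \<Longrightarrow> y = z" for y z
    proof (induction n arbitrary: y z)
      case 0
      then show ?case using PrimRec.IH(1) by (auto simp: rec_eval_PrimRec_0)
    next
      case (Suc n)
      then show ?case using PrimRec.IH(2) unfolding rec_eval_PrimRec_Suc by blast
    qed
    then show ?thesis using PrimRec.prems Cons by blast
  qed
next
  case (Mu f)
  have "\<not> y < z" if "rec_eval (Mu f) xs y" "rec_eval (Mu f) xs z" for y z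
    using that Mu.IH unfolding rec_eval_Mu by (metis nat.distinct(1))
  then show ?case using Mu.prems by (meson nat_neq_iff)
qed (auto simp: rec_eval_Zero rec_eval_Succ rec_eval_Proj)

lemma impl_const: "\<exists>R. impl R \<and> (\<forall>s s'. (s, s') \<in> R \<longleftrightarrow> s' = s(r := k))"
proof (induction k)
  case 0
  then show ?case by (intro exI[of _ "clr r"] conjI allI impl_clr clr_iff)
next
  case (Suc k)
  then obtain R where "impl R" "\<And>s s'. (s, s') \<in> R \<longleftrightarrow> s' = s(r := k)" by blast
  then show ?case
    by (intro exI[of _ "R O instr_rel (Inc r)"] conjI impl_relcomp impl_instr) (auto simp: relcomp_iff)
qed

text \<open>The letters and the guess \<open>fl\<close> are constants of the program, since a finite
  control can remember them; only the state and the guessed bit are register contents. The guess is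
  verified by testing the value of \<open>acc\<close> in register 4, with \<open>Tst\<close> for
  zero and \<open>Dec\<close> for positive.\<close>

lemma impl_round:
  assumes "recfn 4 step" "recfn 1 acc"
  shows "\<exists>R. impl R \<and> (\<forall>s s'. clean 1 s \<longrightarrow> ((s, s') \<in> R \<longleftrightarrow>
     (\<exists>b\<in>{0, 1}. s' = s(0 := step [s 0, b, x, y]) \<and> (fl \<longleftrightarrow> acc [step [s 0, b, x, y]] = 0))))"
proof -
  obtain f where f: "\<And>xs. length xs = 4 \<Longrightarrow> rec_eval f xs (step xs)"
    using assms(1) unfolding recfn_def by blast
  obtain g where g: "\<And>xs. length xs = 1 \<Longrightarrow> rec_eval g xs (acc xs)"
    using assms(2) unfolding recfn_def by blast
  have f_iff: "rec_eval f [a, b, c, d] z \<longleftrightarrow> z = step [a, b, c, d]" for a b c d z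
    using f[of "[a, b, c, d]"] rec_eval_det by auto
  have g_iff: "rec_eval g [a] z \<longleftrightarrow> z = acc [a]" for a z
    using g[of "[a]"] rec_eval_det by auto
  obtain Rf where Rf: "computes Rf f [0, 1, 2, 3] 4 5"
    using computes_exists[of "[0, 1, 2, 3]" 5 4 f] by auto
  obtain Rg where Rg: "computes Rg g [0] 4 5"
    using computes_exists[of "[0]" 5 4 g] by auto
  obtain C where C: "\<And>r k. impl (C r k)" "\<And>r k s s'. (s, s') \<in> C r k \<longleftrightarrow> s' = s(r := k)"
    using impl_const by metis
  define R1 where "R1 = clr 1 O (\<Union>I\<in>{Nop, Inc 1}. instr_rel I) O C 2 x O C 3 y O Rf O clr 1 O clr 2 O clr 3 O copy 4 0 5 O clr 4"
  define R2 where "R2 = Rg O instr_rel (if fl then Tst 4 else Dec 4) O clr 4"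
  have "impl (R1 O R2)" unfolding R1_def R2_def
    by (intro impl_relcomp impl_instrs impl_clr impl_copy impl_instr C(1) computes_impl[OF Rf] computes_impl[OF Rg]) simp
  moreover have "(s, s') \<in> R1 O R2 \<longleftrightarrow>
     (\<exists>b\<in>{0, 1}. s' = s(0 := step [s 0, b, x, y]) \<and> (fl \<longleftrightarrow> acc [step [s 0, b, x, y]] = 0))"
    if s: "clean 1 s" for s s'
  proof -
    have zero: "s 1 = 0" "s (Suc 0) = 0" "s 2 = 0" "s 3 = 0" "s 4 = 0" "s 5 = 0"
      using s unfolding clean_def by auto
    define S where "S b = step [s 0, b, x, y]" for b
    have cl: "clean 5 (s(1 := b, 2 := x, 3 := y))" "clean 5 (s(0 := b))" for b
      using s unfolding clean_def by auto
    have m: "map (s(1 := b, 2 := x, 3 := y)) [0, 1, 2, 3] = [s 0, b, x, y]" for b by simp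
    have 1: "(s(1 := b, 2 := x, 3 := y), u) \<in> Rf O clr 1 O clr 2 O clr 3 O copy 4 0 5 O clr 4
        \<longleftrightarrow> u = s(0 := S b)" for u b
    proof -
      have "s(1 := b, 2 := x, 3 := y, 4 := S b, 1 := 0, 2 := 0, 3 := 0, 0 := S b, 5 := 0, 4 := 0) = s(0 := S b)"
        using zero by (auto simp: fun_eq_iff)
      then show ?thesis
        unfolding computes_relcompD[OF Rf cl(1)] m f_iff
        by (simp add: relcomp_iff clr_iff copy_iff S_def)
    qed
    have "(s, u) \<in> R1 \<longleftrightarrow> (\<exists>b\<in>{0, 1}. (s(1 := b, 2 := x, 3 := y), u) \<in> Rf O clr 1 O clr 2 O clr 3 O copy 4 0 5 O clr 4)" for u
    proof -
      have CR: "(s, s') \<in> C r k O Z \<longleftrightarrow> (s(r := k), s') \<in> Z" for s s' r k Z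
        unfolding relcomp_iff C(2) by blast
      have bit: "(s, u) \<in> clr 1 O (\<Union>I\<in>{Nop, Inc 1}. instr_rel I) O Z \<longleftrightarrow>
          (\<exists>b\<in>{0, 1}. (s(1 := b), u) \<in> Z)" for Z
        unfolding relcomp_iff[of _ _ "clr 1"] clr_iff by (auto simp: relcomp_iff)
      show ?thesis unfolding R1_def bit CR ..
    qed
    then have R1: "(s, u) \<in> R1 \<longleftrightarrow> (\<exists>b\<in>{0, 1}. u = s(0 := S b))" for u
      unfolding 1 .
    have R2: "(s(0 := v), s') \<in> R2 \<longleftrightarrow> s' = s(0 := v) \<and> (fl \<longleftrightarrow> acc [v] = 0)" for v
    proof -
      have "s(0 := v, 4 := w, 4 := 0) = s(0 := v)" for w using zero by (auto simp: fun_eq_iff)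
      then show ?thesis
        unfolding R2_def computes_relcompD[OF Rg cl(2)] using g_iff
        by (auto simp: relcomp_iff clr_iff)
    qed
    have "(s, s') \<in> R1 O R2 \<longleftrightarrow> (\<exists>b\<in>{0, 1}. (s(0 := S b), s') \<in> R2)"
      unfolding relcomp_iff R1 by blast
    then show ?thesis unfolding R2 S_def .
  qed
  ultimately show ?thesis by blast
qed

section \<open>Multiplicative operations on a single counter\<close>

datatype cop = Mul nat | Div nat | NDiv nat

fun cop_rel :: "cop \<Rightarrow> nat \<Rightarrow> nat \<Rightarrow> bool" where
  "cop_rel (Mul k) c c' \<longleftrightarrow> c' = k * c"
| "cop_rel (Div m) c c' \<longleftrightarrow> m dvd c \<and> c' = c div m"
| "cop_rel (NDiv m) c c' \<longleftrightarrow> \<not> m dvd c \<and> c' = c"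

fun cop_arg :: "cop \<Rightarrow> nat" where
  "cop_arg (Mul k) = k" | "cop_arg (Div k) = k" | "cop_arg (NDiv k) = k"

definition cstep :: "(nat \<times> cop \<times> nat) set \<Rightarrow> ((nat \<times> nat) \<times> (nat \<times> nat)) set" where
  "cstep T = {((q, c), (q', c')). \<exists>I. (q, I, q') \<in> T \<and> cop_rel I c c'}"

abbreviation nprime :: "nat \<Rightarrow> nat" where
  "nprime \<equiv> enumerate {p. prime p}"

lemma prime_nprime: "prime (nprime i)"
  using enumerate_in_set[OF primes_infinite] by simp

lemma nprime_eq: "nprime i = nprime j \<longleftrightarrow> i = j"
  using strict_mono_enumerate[OF primes_infinite] by (simp add: strict_mono_eq)

definition goedel :: "nat \<Rightarrow> store \<Rightarrow> nat" where
  "goedel K s = (\<Prod>r<K. nprime r ^ s r)"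

lemma nprime_dvd_goedel:
  assumes "r < K"
  shows "nprime r dvd goedel K s \<longleftrightarrow> s r \<noteq> 0"
proof
  assume "nprime r dvd goedel K s"
  then obtain q where q: "nprime r dvd nprime q ^ s q"
    unfolding goedel_def by (auto simp: prime_dvd_prod_iff prime_nprime)
  then have "nprime r = nprime q"
    using prime_dvd_power[OF prime_nprime] primes_dvd_imp_eq[OF prime_nprime prime_nprime] by blast
  then show "s r \<noteq> 0" using q prime_nprime[of r] by (auto simp: nprime_eq intro!: Nat.gr0I)
next
  assume "s r \<noteq> 0"
  then have "nprime r dvd nprime r ^ s r" by (intro dvd_power) auto
  also have "\<dots> dvd goedel K s"
    unfolding goedel_def using assms by (intro dvd_prodI) auto
  finally show "nprime r dvd goedel K s" .
qed

lemma goedel_Suc: "r < K \<Longrightarrow> goedel K (s(r := Suc (s r))) = nprime r * goedel K s"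
  unfolding goedel_def
  by (simp add: prod.remove[of "{..<K}" r] mult.assoc)

fun cop_of :: "instr \<Rightarrow> cop" where
  "cop_of (Inc r) = Mul (nprime r)"
| "cop_of (Dec r) = Div (nprime r)"
| "cop_of (Tst r) = NDiv (nprime r)"
| "cop_of Nop = Mul 1"

fun instr_reg :: "instr \<Rightarrow> nat" where
  "instr_reg (Inc r) = r" | "instr_reg (Dec r) = r" | "instr_reg (Tst r) = r" | "instr_reg Nop = 0"

lemma cop_rel_goedel:
  assumes "instr_reg I < K"
  shows "cop_rel (cop_of I) (goedel K s) c \<longleftrightarrow> (\<exists>s'. (s, s') \<in> instr_rel I \<and> c = goedel K s')"
proof (cases I)
  case (Dec r)
  have "goedel K s div nprime r = goedel K (s(r := s r - 1))" if "s r \<noteq> 0"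
    using goedel_Suc[of r K "s(r := s r - 1)"] that assms Dec prime_gt_0_nat[OF prime_nprime[of r]] by simp
  then show ?thesis using assms Dec by (auto simp: nprime_dvd_goedel)
qed (use assms in \<open>auto simp: goedel_Suc nprime_dvd_goedel\<close>)

lemma impl_goedel:
  assumes "impl R"
  shows "\<exists>T K. finite T \<and> (\<forall>q I q'. (q, I, q') \<in> T \<longrightarrow> cop_arg I > 0) \<and> K > 0 \<and>
    (\<forall>s c. ((0, goedel K s), (1, c)) \<in> (cstep T)\<^sup>* \<longleftrightarrow> (\<exists>s'. (s, s') \<in> R \<and> c = goedel K s'))"
proof -
  obtain T where T: "finite T" "\<And>s s'. ((0, s), (1, s')) \<in> (nstep T)\<^sup>* \<longleftrightarrow> (s, s') \<in> R"
    using assms unfolding impl_def by blast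
  \<comment> \<open>\<open>K\<close> exceeds every register that the program mentions, so each
    instruction acts on a prime factor that is present in the product.\<close>
  define K where "K = Suc (Max (insert 0 ((\<lambda>(q, I, q'). instr_reg I) ` T)))"
  have K: "instr_reg I < K" if "(q, I, q') \<in> T" for q I q'
    unfolding K_def less_Suc_eq_le using that T(1) by (intro Max_ge) force+
  define T' where "T' = (\<lambda>(q, I, q'). (q, cop_of I, q')) ` T"
  have T': "(q, J, q') \<in> T' \<longleftrightarrow> (\<exists>I. J = cop_of I \<and> (q, I, q') \<in> T)" for q J q'
    unfolding T'_def by force
  have step_iff: "((q, goedel K s), (q', c)) \<in> cstep T' \<longleftrightarrow> (\<exists>s'. ((q, s), (q', s')) \<in> nstep T \<and> c = goedel K s')" for q s q' c
    unfolding cstep_def nstep_def using cop_rel_goedel[OF K] by (auto simp: T') blast+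
  have "((0, goedel K s), (1, c)) \<in> (cstep T')\<^sup>* \<longleftrightarrow> (\<exists>s'. ((0, s), (1, s')) \<in> (nstep T)\<^sup>* \<and> c = goedel K s')" for s c
  proof
    assume "((0, goedel K s), (1, c)) \<in> (cstep T')\<^sup>*"
    then show "\<exists>s'. ((0, s), (1, s')) \<in> (nstep T)\<^sup>* \<and> c = goedel K s'"
    proof (induction rule: rtrancl_induct2)
      case (step q c q' c')
      from step(3) obtain t where t: "((0, s), (q, t)) \<in> (nstep T)\<^sup>*" "c = goedel K t" by blast
      with step(2) obtain t' where t': "((q, t), (q', t')) \<in> nstep T" "c' = goedel K t'"
        using step_iff by blast
      show ?case using rtrancl_into_rtrancl[OF t(1) t'(1)] t'(2) by blast
    qed auto
  next
    assume "\<exists>s'. ((0, s), (1, s')) \<in> (nstep T)\<^sup>* \<and> c = goedel K s'"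
    then obtain s' where s': "((0, s), (1, s')) \<in> (nstep T)\<^sup>*" "c = goedel K s'" by blast
    from s'(1) have "((0, goedel K s), (1, goedel K s')) \<in> (cstep T')\<^sup>*"
    proof (induction rule: rtrancl_induct2)
      case (step q t q' t')
      then have "((q, goedel K t), (q', goedel K t')) \<in> cstep T'"
        by (auto simp: step_iff)
      with step.IH show ?case by (rule rtrancl_into_rtrancl)
    qed auto
    with s'(2) show "((0, goedel K s), (1, c)) \<in> (cstep T')\<^sup>*" by simp
  qed
  moreover have "cop_arg J > 0" if "(q, J, q') \<in> T'" for q J q'
  proof -
    have "cop_arg (cop_of I) > 0" for I
      using prime_gt_0_nat[OF prime_nprime] by (cases I) auto
    then show ?thesis using that by (auto simp: T')
  qed
  moreover have "finite T'" "K > 0" unfolding T'_def K_def using T(1) by auto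
  ultimately show ?thesis using T(2) by (intro exI[of _ T'] exI[of _ K]) blast
qed

text \<open>Between rounds only register 0 may be nonzero, so the counter is a power of
  \<open>nprime 0\<close>, whatever number \<open>K\<close> of registers the individual program
  uses. This is what allows programs for different letters to work one after the other on the same
  counter.\<close>

lemma round_programs:
  assumes "recfn 4 step" "recfn 1 acc"
  shows "\<exists>T. finite T \<and> (\<forall>q I q'. (q, I, q') \<in> T \<longrightarrow> cop_arg I > 0) \<and>
    (\<forall>S c. ((0, nprime 0 ^ S), (1, c)) \<in> (cstep T)\<^sup>* \<longleftrightarrow>
       (\<exists>b\<in>{0, 1}. c = nprime 0 ^ step [S, b, x, y] \<and> (fl \<longleftrightarrow> acc [step [S, b, x, y]] = 0)))"
proof -
  obtain R where R: "impl R" "\<And>s s'. clean 1 s \<Longrightarrow> ((s, s') \<in> R \<longleftrightarrow>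
     (\<exists>b\<in>{0, 1}. s' = s(0 := step [s 0, b, x, y]) \<and> (fl \<longleftrightarrow> acc [step [s 0, b, x, y]] = 0)))"
    using impl_round[OF assms, of x y fl] by blast
  obtain T K where T: "finite T" "\<And>q I q'. (q, I, q') \<in> T \<Longrightarrow> cop_arg I > 0" "K > 0"
    "\<And>s c. ((0, goedel K s), (1, c)) \<in> (cstep T)\<^sup>* \<longleftrightarrow> (\<exists>s'. (s, s') \<in> R \<and> c = goedel K s')"
    using impl_goedel[OF R(1)] by blast
  define st :: "nat \<Rightarrow> store" where "st S = (\<lambda>_. 0)(0 := S)" for S
  have gst: "goedel K (st S) = nprime 0 ^ S" for S
    using T(3) unfolding goedel_def st_def by (simp add: prod.remove[of "{..<K}" 0])
  have "clean 1 (st S)" "(st S)(0 := S') = st S'" "st S 0 = S" for S S'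
    by (auto simp: clean_def st_def)
  then have "(\<exists>s'. (st S, s') \<in> R \<and> c = goedel K s') \<longleftrightarrow>
     (\<exists>b\<in>{0, 1}. c = nprime 0 ^ step [S, b, x, y] \<and> (fl \<longleftrightarrow> acc [step [S, b, x, y]] = 0))" for S c
    using R(2)[of "st S"] by (auto simp: gst)
  then show ?thesis using T(1,2) T(4)[of "st _", unfolded gst] by (intro exI[of _ T]) simp
qed

section \<open>One-counter automata reading rounds\<close>

text \<open>
  One step of \<open>tr\<close> reads a letter of each player. The counter automaton remembers the
  letter of Player 1 in its state and changes the counter at the letter of Player 2.
\<close>

definition round_run ::
  "('q \<Rightarrow> bool \<Rightarrow> nat \<Rightarrow> nat \<Rightarrow> 'q \<Rightarrow> int \<Rightarrow> bool) \<Rightarrow> 'q \<Rightarrow> nat word \<Rightarrow> ('q \<times> nat) word \<Rightarrow> bool" where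
  "round_run tr q0 \<rho> r \<longleftrightarrow> r 0 = (q0, 0) \<and>
     (\<forall>i. tr (fst (r i)) (snd (r i) = 0) (\<rho> (2 * i)) (\<rho> (2 * i + 1)) (fst (r (Suc i)))
        (int (snd (r (Suc i))) - int (snd (r i))))"

lemma spells_Some_iff: "(\<forall>i. b i \<noteq> None) \<Longrightarrow> spells b \<sigma> \<longleftrightarrow> b = (\<lambda>i. Some (\<sigma> i))"
proof
  assume b: "\<forall>i. b i \<noteq> None" and "spells b \<sigma>"
  then obtain p where p: "p 0 = 0" "\<And>i. case b i of None \<Rightarrow> p (Suc i) = p i
      | Some a \<Rightarrow> p (Suc i) = Suc (p i) \<and> \<sigma> (p i) = a" unfolding spells_iff by blast
  have "p (Suc i) = Suc (p i) \<and> b i = Some (\<sigma> (p i))" for i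
    using p(2)[of i] b[rule_format, of i] by (cases "b i") auto
  moreover from this have "p i = i" for i by (induction i) (auto simp: p)
  ultimately show "b = (\<lambda>i. Some (\<sigma> i))" by auto
next
  assume "b = (\<lambda>i. Some (\<sigma> i))"
  then show "spells b \<sigma>" unfolding spells_iff by (intro exI[of _ "\<lambda>i. i"]) simp
qed

lemma even_odd_induct_nat: "(\<And>i. P (2 * i)) \<Longrightarrow> (\<And>i. P (2 * i + 1)) \<Longrightarrow> P (n::nat)"
  by (metis odd_two_times_div_two_succ dvd_mult_div_cancel)

lemma INFM_even:
  assumes "\<And>i. P (2 * i) \<longleftrightarrow> Q i" "\<And>i. \<not> P (2 * i + 1)"
  shows "(\<exists>\<^sub>\<infinity>i. P i) \<longleftrightarrow> (\<exists>\<^sub>\<infinity>i::nat. Q i)"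
proof
  assume P: "\<exists>\<^sub>\<infinity>i. P i"
  show "\<exists>\<^sub>\<infinity>i. Q i" unfolding INFM_nat_le
  proof
    fix m
    obtain n where n: "n \<ge> 2 * m" "P n" using P unfolding INFM_nat_le by blast
    then have "even n" using assms(2) by (metis odd_two_times_div_two_succ)
    then obtain i where "n = 2 * i" by (rule evenE)
    then show "\<exists>n\<ge>m. Q n" using n assms(1) by (intro exI[of _ i]) auto
  qed
next
  assume Q: "\<exists>\<^sub>\<infinity>i. Q i"
  show "\<exists>\<^sub>\<infinity>i. P i" unfolding INFM_nat_le
  proof
    fix m
    obtain n where "n \<ge> m" "Q n" using Q unfolding INFM_nat_le by blast
    then show "\<exists>n\<ge>m. P n" using assms(1) by (intro exI[of _ "2 * n"]) auto
  qed
qed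

lemma round_automaton:
  fixes tr :: "'q \<Rightarrow> bool \<Rightarrow> nat \<Rightarrow> nat \<Rightarrow> 'q \<Rightarrow> int \<Rightarrow> bool"
  assumes fin: "finite Q" "finite Y" and init: "q0 \<in> Q" and acc: "Acc \<subseteq> Q"
    and closed: "\<And>q z p y q' d. q \<in> Q \<Longrightarrow> tr q z p y q' d \<Longrightarrow> q' \<in> Q \<and> d \<in> {-1, 0, 1} \<and> (z \<longrightarrow> d \<noteq> -1)"
  shows "{\<rho> \<in> omega_words Y. \<exists>r. round_run tr q0 \<rho> r \<and> (\<exists>\<^sub>\<infinity>i. fst (r i) \<in> Acc)} \<in> r_BCL 1 Y"
proof -
  \<comment> \<open>In \<open>(q, None)\<close> the automaton waits for Player 1, in
    \<open>(q, Some p)\<close> it has stored her letter \<open>p\<close>. Final states are chosen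
    among the former, so they occur at even positions only.\<close>
  define OY where "OY = insert None (Some ` Y)"
  have "finite (Q \<times> OY)" using fin by (simp add: OY_def)
  then obtain e :: "'q \<times> nat option \<Rightarrow> nat" where e: "inj_on e (Q \<times> OY)"
    using finite_imp_inj_to_nat_seg by meson
  have e_eq: "e (q, a) = e (q', a') \<longleftrightarrow> q = q' \<and> a = a'" if "q \<in> Q" "q' \<in> Q" "a \<in> OY" "a' \<in> OY" for q q' a a'
    using inj_on_eq_iff[OF e] that by auto
  have OY: "None \<in> OY" "Some p \<in> OY \<longleftrightarrow> p \<in> Y" for p by (auto simp: OY_def)
  define T1 where "T1 = {(e (q, None), Some p, [z], e (q, Some p), [0::int]) |q p z. q \<in> Q \<and> p \<in> Y \<and> z \<in> {0, 1::nat}}"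
  define T2 where "T2 = {(e (q, Some p), Some y, [if z then 0 else 1::nat], e (q', None), [d]) |q p y z q' d.
     q \<in> Q \<and> p \<in> Y \<and> y \<in> Y \<and> tr q z p y q' d}"
  define M where "M = \<lparr>ca_states = e ` (Q \<times> OY), ca_alphabet = Y, ca_trans = T1 \<union> T2,
     ca_init = e (q0, None), ca_final = (\<lambda>q. e (q, None)) ` Acc\<rparr>"
  have wf: "counter_automaton_wf 1 M"
    unfolding counter_automaton_wf_def
  proof (intro conjI ballI)
    show "finite (ca_states M)" "finite (ca_alphabet M)" "ca_init M \<in> ca_states M" "ca_final M \<subseteq> ca_states M"
      using fin init acc by (auto simp: M_def OY_def)
    fix t assume "t \<in> ca_trans M"
    then consider "t \<in> T1" | "t \<in> T2" by (auto simp: M_def)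
    then show "case t of (q, a, zs, q', js) \<Rightarrow>
        q \<in> ca_states M \<and> a \<in> insert None (Some ` ca_alphabet M) \<and> length zs = 1 \<and> set zs \<subseteq> {0, 1} \<and>
        q' \<in> ca_states M \<and> length js = 1 \<and> set js \<subseteq> {0, 1, -1} \<and> (\<forall>m<1. zs ! m = 0 \<longrightarrow> js ! m \<in> {0, 1})"
    proof cases
      case 1
      then show ?thesis by (auto simp: T1_def M_def OY_def)
    next
      case 2
      then obtain q p y z q' d where t: "t = (e (q, Some p), Some y, [if z then 0 else 1], e (q', None), [d])"
        "q \<in> Q" "p \<in> Y" "y \<in> Y" "tr q z p y q' d" unfolding T2_def by blast
      with closed[OF t(2,5)] show ?thesis by (auto simp: M_def OY_def)
    qed
  qed simp
  have rt: "real_time M"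
    unfolding real_time_def M_def T1_def T2_def by auto
  have step1: "counter_step M (Some a) (e (q, None), [c]) x \<longleftrightarrow> a \<in> Y \<and> x = (e (q, Some a), [c])"
    if "q \<in> Q" for a q c x
  proof -
    have no2: "(e (q, None), a', z, q', js) \<notin> T2" for a' z q' js
      using that e_eq[of q _ None "Some _"] OY unfolding T2_def by fastforce
    have "(e (q, None), Some a, z, q', js) \<in> T1 \<longleftrightarrow> a \<in> Y \<and> z \<in> {[0], [1]} \<and> q' = e (q, Some a) \<and> js = [0]" for z q' js
      using that e_eq[of q _ None None] OY(1) unfolding T1_def by auto
    then show ?thesis
      unfolding counter_step_def M_def using no2 by (cases x) (auto simp: map_eq_Cons_conv)
  qed
  have step2: "counter_step M (Some a) (e (q, Some p), [c]) x \<longleftrightarrow>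
      (a \<in> Y \<and> (\<exists>q' c'. x = (e (q', None), [c']) \<and> tr q (c = 0) p a q' (int c' - int c)))"
    if "q \<in> Q" "p \<in> Y" for a q p c x
  proof -
    have no1: "(e (q, Some p), a', z, q', js) \<notin> T1" for a' z q' js
      using that e_eq[of q _ "Some p" None] OY unfolding T1_def by fastforce
    have T2: "(e (q, Some p), Some a, z, p', js) \<in> T2 \<longleftrightarrow>
       (\<exists>b q' d. a \<in> Y \<and> z = [if b then 0 else 1] \<and> p' = e (q', None) \<and> js = [d] \<and> tr q b p a q' d)" for z p' js
      using that e_eq[of q _ "Some p" "Some _"] OY(2) unfolding T2_def by blast
    show ?thesis
    proof
      assume "counter_step M (Some a) (e (q, Some p), [c]) x"
      then obtain js where js: "(e (q, Some p), Some a, [if c = 0 then 0 else 1], fst x, js) \<in> T2"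
        "map int (snd x) = map2 (\<lambda>c j. int c + j) [c] js"
        unfolding counter_step_def M_def using no1 by (cases x) auto
      from js(1) obtain b q' d where b: "a \<in> Y" "[if c = 0 then 0 else 1::nat] = [if b then 0 else 1]" "fst x = e (q', None)" "js = [d]" "tr q b p a q' d"
        unfolding T2 by blast
      from js(2) b(4) obtain c' where "snd x = [c']" "int c' = int c + d" by auto
      moreover have "b = (c = 0)" using b(2) by (auto split: if_splits)
      ultimately show "a \<in> Y \<and> (\<exists>q' c'. x = (e (q', None), [c']) \<and> tr q (c = 0) p a q' (int c' - int c))"
        using b by (intro conjI exI[of _ q'] exI[of _ c']) (auto simp: prod_eq_iff)
    next
      assume "a \<in> Y \<and> (\<exists>q' c'. x = (e (q', None), [c']) \<and> tr q (c = 0) p a q' (int c' - int c))"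
      then obtain q' c' where x: "a \<in> Y" "x = (e (q', None), [c'])" "tr q (c = 0) p a q' (int c' - int c)" by blast
      then have "(e (q, Some p), Some a, [if c = 0 then 0 else 1], e (q', None), [int c' - int c]) \<in> T2"
        unfolding T2 by blast
      then show "counter_step M (Some a) (e (q, Some p), [c]) x"
        unfolding counter_step_def x(2) M_def by auto
    qed
  qed
  have run_iff: "(\<exists>r. counter_run 1 M \<rho> r \<and> (\<exists>q\<in>ca_final M. \<exists>\<^sub>\<infinity>i. fst (r i) = q)) \<longleftrightarrow>
     (\<exists>r. round_run tr q0 \<rho> r \<and> (\<exists>\<^sub>\<infinity>i. fst (r i) \<in> Acc))" (is "?L \<longleftrightarrow> ?R") if \<rho>: "\<rho> \<in> omega_words Y" for \<rho>
  proof -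
    have \<rho>Y: "\<rho> i \<in> Y" for i using \<rho> by (auto simp: omega_words_def)
    have finfin: "finite (ca_final M)" using fin acc finite_subset unfolding M_def by auto
    have crun: "counter_run 1 M \<rho> r \<longleftrightarrow> r 0 = (e (q0, None), [0]) \<and>
       (\<forall>i. counter_step M (Some (\<rho> i)) (r i) (r (Suc i)))" for r
    proof -
      have nn: "b i \<noteq> None" if "counter_step M (b i) (r i) (r (Suc i))" for b i
        using that rt unfolding counter_step_def real_time_def by (auto split: prod.splits)
      have "(\<exists>b. (\<forall>i. counter_step M (b i) (r i) (r (Suc i))) \<and> spells b \<rho>) \<longleftrightarrow>
         (\<forall>i. counter_step M (Some (\<rho> i)) (r i) (r (Suc i)))"
      proof
        assume "\<exists>b. (\<forall>i. counter_step M (b i) (r i) (r (Suc i))) \<and> spells b \<rho>"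
        then obtain b where b: "\<And>i. counter_step M (b i) (r i) (r (Suc i))" "spells b \<rho>" by blast
        then have "b = (\<lambda>i. Some (\<rho> i))" using spells_Some_iff[of b \<rho>] nn by blast
        with b show "\<forall>i. counter_step M (Some (\<rho> i)) (r i) (r (Suc i))" by simp
      next
        assume "\<forall>i. counter_step M (Some (\<rho> i)) (r i) (r (Suc i))"
        then show "\<exists>b. (\<forall>i. counter_step M (b i) (r i) (r (Suc i))) \<and> spells b \<rho>"
          by (intro exI[of _ "\<lambda>i. Some (\<rho> i)"]) (simp add: spells_Some_iff)
      qed
      then show ?thesis unfolding counter_run_def M_def by simp
    qed
    show ?thesis
    proof
      assume ?L
      then obtain r where r0: "r 0 = (e (q0, None), [0])"
        and r: "\<And>i. counter_step M (Some (\<rho> i)) (r i) (r (Suc i))"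
        and F: "\<exists>\<^sub>\<infinity>i. fst (r i) \<in> ca_final M"
        unfolding crun INFM_finite_Bex[OF finfin, symmetric] by blast
      have two: "r (Suc (2 * i)) = (e (q, Some (\<rho> (2 * i))), [c]) \<and>
          (\<exists>q' c'. r (2 * Suc i) = (e (q', None), [c']) \<and> q' \<in> Q \<and> tr q (c = 0) (\<rho> (2 * i)) (\<rho> (2 * i + 1)) q' (int c' - int c))"
        if "r (2 * i) = (e (q, None), [c])" "q \<in> Q" for i q c
      proof -
        have 1: "r (Suc (2 * i)) = (e (q, Some (\<rho> (2 * i))), [c])"
          using r[of "2 * i"] that step1[OF that(2)] by simp
        then show ?thesis
          using r[of "Suc (2 * i)"] step2[OF that(2) \<rho>Y] closed[OF that(2)] by fastforce
      qed
      have ex: "\<exists>q c. r (2 * i) = (e (q, None), [c]) \<and> q \<in> Q" for i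
      proof (induction i)
        case 0
        then show ?case using r0 init by auto
      next
        case (Suc i)
        then show ?case using two by blast
      qed
      then obtain q c where qc: "\<And>i. r (2 * i) = (e (q i, None), [c i])" "\<And>i. q i \<in> Q" by metis
      have tr: "tr (q i) (c i = 0) (\<rho> (2 * i)) (\<rho> (2 * i + 1)) (q (Suc i)) (int (c (Suc i)) - int (c i))" for i
        using two[OF qc(1) qc(2), of i] qc(1)[of "Suc i"] qc(2) e_eq OY(1) by auto
      have "q 0 = q0" "c 0 = 0" using r0 qc(1)[of 0] e_eq[OF qc(2) init OY(1) OY(1)] by auto
      then have "round_run tr q0 \<rho> (\<lambda>i. (q i, c i))" unfolding round_run_def using tr by simp
      moreover have "\<exists>\<^sub>\<infinity>i. q i \<in> Acc"
      proof -
        have A: "fst (r (2 * i)) \<in> ca_final M \<longleftrightarrow> q i \<in> Acc" for i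
          using qc acc e_eq OY(1) unfolding M_def by (auto simp: image_iff)
        have B: "fst (r (2 * i + 1)) \<notin> ca_final M" for i
          using two[OF qc(1) qc(2), of i] qc(2)[of i] acc e_eq[of "q i" _ "Some (\<rho> (2 * i))" None] OY \<rho>Y[of "2 * i"] unfolding M_def by auto
        show ?thesis using F INFM_even[of "\<lambda>i. fst (r i) \<in> ca_final M", OF A B] by blast
      qed
      ultimately show ?R by (intro exI[of _ "\<lambda>i. (q i, c i)"]) simp
    next
      assume ?R
      then obtain r where r: "round_run tr q0 \<rho> r" and F: "\<exists>\<^sub>\<infinity>i. fst (r i) \<in> Acc" by blast
      have Q: "fst (r i) \<in> Q" for i
        using r init closed unfolding round_run_def by (induction i) (simp, blast)
      define r' where "r' i = (if even i then (e (fst (r (i div 2)), None), [snd (r (i div 2))])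
          else (e (fst (r (i div 2)), Some (\<rho> (i - 1))), [snd (r (i div 2))]))" for i
      have r'e: "r' (2 * i) = (e (fst (r i), None), [snd (r i)])"
        and r'o: "r' (2 * i + 1) = (e (fst (r i), Some (\<rho> (2 * i))), [snd (r i)])" for i
        unfolding r'_def by simp_all
      have "counter_step M (Some (\<rho> i)) (r' i) (r' (Suc i))" for i
      proof (rule even_odd_induct_nat[of _ i])
        fix i
        show "counter_step M (Some (\<rho> (2 * i))) (r' (2 * i)) (r' (Suc (2 * i)))"
          using r'o[of i] unfolding r'e step1[OF Q] by (simp add: \<rho>Y)
        show "counter_step M (Some (\<rho> (2 * i + 1))) (r' (2 * i + 1)) (r' (Suc (2 * i + 1)))"
          using r'e[of "Suc i"] r \<rho>Y unfolding r'o step2[OF Q \<rho>Y] round_run_def by auto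
      qed
      moreover have "r' 0 = (e (q0, None), [0])" using r'e[of 0] r unfolding round_run_def by simp
      moreover have "\<exists>\<^sub>\<infinity>i. fst (r' i) \<in> ca_final M"
      proof -
        have A: "fst (r' (2 * i)) \<in> ca_final M \<longleftrightarrow> fst (r i) \<in> Acc" for i
          using Q acc e_eq OY(1) unfolding M_def r'e by (auto simp: image_iff)
        have B: "fst (r' (2 * i + 1)) \<notin> ca_final M" for i
          using Q[of i] acc e_eq[of "fst (r i)" _ "Some (\<rho> (2 * i))" None] OY \<rho>Y[of "2 * i"] unfolding M_def r'o by auto
        show ?thesis using F INFM_even[of "\<lambda>i. fst (r' i) \<in> ca_final M", OF A B] by blast
      qed
      ultimately show ?L unfolding crun INFM_finite_Bex[OF finfin, symmetric] by blast
    qed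
  qed
  have "counter_lang 1 M = {\<rho> \<in> omega_words Y. \<exists>r. round_run tr q0 \<rho> r \<and> (\<exists>\<^sub>\<infinity>i. fst (r i) \<in> Acc)}"
    unfolding counter_lang_def using run_iff by (auto simp: M_def)
  moreover have "ca_alphabet M = Y" by (simp add: M_def)
  ultimately show ?thesis unfolding r_BCL_def using wf rt by blast
qed

text \<open>A counter is a unary stack: \<open>c\<close> ones above a bottom marker 0. The top
  symbol answers the zero test, and a change by \<open>j\<close> replaces a one on top by 1 + j
  ones, or puts \<open>j\<close> ones on the bottom marker.\<close>

lemma r_BCL_subset_CFL: "r_BCL 1 X \<subseteq> CFL X"
proof
  fix L assume "L \<in> r_BCL 1 X"
  then obtain M where M: "counter_automaton_wf 1 M" "ca_alphabet M = X" "L = counter_lang 1 M"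
    unfolding r_BCL_def by blast
  define st where "st c = replicate c 1 @ [0::nat]" for c :: nat
  define tr where "tr = (\<lambda>(q, a, zs, q', js). (q, a, hd zs, q',
      if hd zs = (0::nat) then st (nat (hd js)) else replicate (nat (1 + hd js)) (1::nat)) ::
      nat \<times> nat option \<times> nat \<times> nat \<times> nat list)"
  define P where "P = \<lparr>pda_states = ca_states M, pda_alphabet = X, pda_stack = {0, 1},
     pda_trans = tr ` ca_trans M, pda_init = ca_init M, pda_start = 0, pda_final = ca_final M\<rparr>"
  have fin: "finite (ca_states M)" "finite (ca_alphabet M)" using M(1) unfolding counter_automaton_wf_def by auto
  \<comment> \<open>Pushdown automata have to come with a finite set of transitions. For the counter
    automaton this follows from the bounded shape of its tuples.\<close>
  have "ca_trans M \<subseteq> ca_states M \<times> insert None (Some ` ca_alphabet M) \<times> {zs. set zs \<subseteq> {0, 1} \<and> length zs = 1}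
     \<times> ca_states M \<times> {js. set js \<subseteq> {0, 1, -1} \<and> length js = 1}"
    using M(1) unfolding counter_automaton_wf_def by auto
  moreover have "finite \<dots>"
    using fin by (intro finite_SigmaI finite_lists_length_eq) auto
  ultimately have fint: "finite (ca_trans M)" by (rule finite_subset)
  have tr: "\<exists>z j. zs = [z] \<and> js = [j] \<and> z \<in> {0, 1} \<and> j \<in> {0, 1, -1} \<and> (z = 0 \<longrightarrow> j \<noteq> -1)
     \<and> q \<in> ca_states M \<and> q' \<in> ca_states M \<and> a \<in> insert None (Some ` ca_alphabet M)"
    if "(q, a, zs, q', js) \<in> ca_trans M" for q a zs q' js
    using M(1) that unfolding counter_automaton_wf_def by (fastforce simp: length_Suc_conv)
  have "pushdown_automaton_wf P"
    unfolding pushdown_automaton_wf_def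
  proof (intro conjI)
    show "pda_trans P \<subseteq> pda_states P \<times> insert None (Some ` pda_alphabet P) \<times> pda_stack P \<times> pda_states P \<times> lists (pda_stack P)"
    proof
      fix t assume "t \<in> pda_trans P"
      then obtain q a zs q' js where t: "(q, a, zs, q', js) \<in> ca_trans M" "t = tr (q, a, zs, q', js)"
        unfolding P_def by auto
      then show "t \<in> pda_states P \<times> insert None (Some ` pda_alphabet P) \<times> pda_stack P \<times> pda_states P \<times> lists (pda_stack P)"
        using tr[OF t(1)] M(2) by (auto simp: P_def tr_def st_def in_lists_conv_set)
    qed
  qed (use fint M(1,2) in \<open>auto simp: P_def counter_automaton_wf_def\<close>)
  moreover have step: "pda_step P a (q, st c) (q', s') \<longleftrightarrow> (\<exists>c'. s' = st c' \<and> counter_step M a (q, [c]) (q', [c']))" for a q c q' s'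
  proof
    assume "pda_step P a (q, st c) (q', s')"
    then obtain zs js Z \<gamma> where t: "(q, a, zs, q', js) \<in> ca_trans M" "st c = hd zs # \<gamma>"
      "s' = (if hd zs = 0 then st (nat (hd js)) else replicate (nat (1 + hd js)) 1) @ \<gamma>"
      unfolding pda_step_def P_def tr_def by auto
    obtain z j where zj: "zs = [z]" "js = [j]" "z \<in> {0, 1}" "j \<in> {0, 1, -1}" "z = 0 \<longrightarrow> j \<noteq> -1"
      using tr[OF t(1)] by (elim exE conjE) (rule that; assumption)
    show "\<exists>c'. s' = st c' \<and> counter_step M a (q, [c]) (q', [c'])"
    proof (cases c)
      case 0
      then have "z = 0" "\<gamma> = []" using t(2) zj by (auto simp: st_def)
      then show ?thesis using t zj 0 unfolding counter_step_def
        by (intro exI[of _ "nat j"] conjI) (auto intro!: exI[of _ "[j]"])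
    next
      case (Suc k)
      then have "z = 1" "\<gamma> = st k" using t(2) zj by (auto simp: st_def)
      then show ?thesis using t zj Suc unfolding counter_step_def
        by (intro exI[of _ "nat (1 + j) + k"] conjI) (auto simp: st_def replicate_add intro!: exI[of _ "[j]"])
    qed
  next
    assume "\<exists>c'. s' = st c' \<and> counter_step M a (q, [c]) (q', [c'])"
    then obtain c' js where t: "s' = st c'" "(q, a, [if c = 0 then 0 else 1], q', js) \<in> ca_trans M"
      "map int [c'] = map2 (\<lambda>c j. int c + j) [c] js" unfolding counter_step_def by auto
    obtain z j where j: "[if c = 0 then 0 else 1::nat] = [z]" "js = [j]" "j \<in> {0, 1, -1}" "z = 0 \<longrightarrow> j \<noteq> -1"
      using tr[OF t(2)] by (elim exE conjE) (rule that; assumption)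
    then have j: "js = [j]" "j \<in> {0, 1, -1}" "c = 0 \<longrightarrow> j \<noteq> -1" by (auto split: if_splits)
    then have c': "int c' = int c + j" using t(3) by simp
    have mem: "(q, a, if c = 0 then 0 else 1, q', if c = 0 then st (nat j) else replicate (nat (1 + j)) 1) \<in> pda_trans P"
      unfolding P_def tr_def using t(2) j(1) by (force simp: image_iff)
    show "pda_step P a (q, st c) (q', s')"
    proof (cases c)
      case 0
      then have "c' = nat j" using c' by simp
      then show ?thesis using mem 0 t(1) unfolding pda_step_def by (auto simp: st_def)
    next
      case (Suc k)
      then have "c' = nat (1 + j) + k" using c' j by auto
      then show ?thesis using mem Suc t(1) unfolding pda_step_def by (auto simp: st_def replicate_add)
    qed
  qed
  have "(\<exists>r. pda_run P \<sigma> r \<and> (\<exists>q\<in>pda_final P. \<exists>\<^sub>\<infinity>i. fst (r i) = q)) \<longleftrightarrow>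
      (\<exists>r. counter_run 1 M \<sigma> r \<and> (\<exists>q\<in>ca_final M. \<exists>\<^sub>\<infinity>i. fst (r i) = q))" (is "?L \<longleftrightarrow> ?R") for \<sigma>
  proof
    assume ?L
    then obtain r b q where r: "r 0 = (ca_init M, [0])" "\<And>i. pda_step P (b i) (r i) (r (Suc i))" "spells b \<sigma>"
      and q: "q \<in> ca_final M" "\<exists>\<^sub>\<infinity>i. fst (r i) = q" unfolding pda_run_def by (auto simp: P_def)
    have "\<exists>c. snd (r i) = st c" for i
    proof (induction i)
      case 0
      then show ?case using r(1) by (intro exI[of _ 0]) (simp add: st_def)
    next
      case (Suc i)
      then show ?case using r(2)[of i] step by (metis prod.collapse)
    qed
    then obtain c where c: "\<And>i. snd (r i) = st (c i)" by metis
    have "length (st (c 0)) = 1" using arg_cong[OF c[of 0], of length] r(1) by simp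
    then have "c 0 = 0" by (simp add: st_def)
    have inj: "st x = st y \<longleftrightarrow> x = y" for x y
      by (metis st_def length_append length_replicate add_right_cancel)
    have "counter_step M (b i) (fst (r i), [c i]) (fst (r (Suc i)), [c (Suc i)])" for i
      using r(2)[of i] step[of "b i" "fst (r i)" "c i" "fst (r (Suc i))" "snd (r (Suc i))"] c[of i] c[of "Suc i"] inj
      by (metis prod.collapse)
    then have "counter_run 1 M \<sigma> (\<lambda>i. (fst (r i), [c i]))"
      unfolding counter_run_def using r \<open>c 0 = 0\<close> by auto
    then show ?R using q by (intro exI[of _ "\<lambda>i. (fst (r i), [c i])"]) auto
  next
    assume ?R
    then obtain r b q where r: "r 0 = (ca_init M, [0])" "\<And>i. counter_step M (b i) (r i) (r (Suc i))" "spells b \<sigma>"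
      and q: "q \<in> ca_final M" "\<exists>\<^sub>\<infinity>i. fst (r i) = q" unfolding counter_run_def by auto
    have "\<exists>c. snd (r i) = [c]" for i
    proof (induction i)
      case (Suc i)
      then obtain c where c: "snd (r i) = [c]" by blast
      obtain js where "(fst (r i), b i, [if c = 0 then 0 else 1], fst (r (Suc i)), js) \<in> ca_trans M"
        "map int (snd (r (Suc i))) = map2 (\<lambda>c j. int c + j) [c] js"
        using r(2)[of i] c unfolding counter_step_def by (auto split: prod.splits)
      then show ?case using tr by (fastforce simp: map_eq_Cons_conv)
    qed (use r in simp)
    then obtain c where c: "\<And>i. snd (r i) = [c i]" by metis
    have "pda_step P (b i) (fst (r i), st (c i)) (fst (r (Suc i)), st (c (Suc i)))" for i
      using r(2)[of i] step c by (metis prod.collapse)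
    moreover have "c 0 = 0" using c[of 0] r(1) by simp
    ultimately have "pda_run P \<sigma> (\<lambda>i. (fst (r i), st (c i)))"
      unfolding pda_run_def using r by (auto simp: P_def st_def)
    then show ?L using q by (intro exI[of _ "\<lambda>i. (fst (r i), st (c i))"]) (auto simp: P_def)
  qed
  then have "pda_lang P = L" unfolding pda_lang_def M(3) counter_lang_def by (auto simp: P_def M(2))
  ultimately show "L \<in> CFL X" unfolding CFL_def by (auto simp: P_def)
qed

section \<open>The block game\<close>

type_synonym 's btrans = "'s \<times> cop \<times> (nat \<times> nat) option \<times> 's"

abbreviation t_src :: "'s btrans \<Rightarrow> 's" where "t_src t \<equiv> fst t"
abbreviation t_op :: "'s btrans \<Rightarrow> cop" where "t_op t \<equiv> fst (snd t)"
abbreviation t_ev :: "'s btrans \<Rightarrow> (nat \<times> nat) option" where "t_ev t \<equiv> fst (snd (snd t))"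
abbreviation t_dst :: "'s btrans \<Rightarrow> 's" where "t_dst t \<equiv> snd (snd (snd t))"

text \<open>Emptying the counter \<open>c\<close> at one unit per \<open>rate\<close> letters takes
  \<open>rate * c\<close> letters, and the same number is left over in the second block.
  \<open>Mul k\<close> stretches the emptying and adds one for each of these letters;
  \<open>Div m\<close> adds one for every m-th of them; \<open>NDiv m\<close> just restores
  \<open>c\<close>. The residue of the letters modulo \<open>period\<close>, kept in the state,
  decides divisibility at the end.\<close>

fun rate :: "cop \<Rightarrow> nat" where
  "rate (Mul k) = k" | "rate (Div m) = 1" | "rate (NDiv m) = 1"

fun period :: "cop \<Rightarrow> nat" where
  "period (Mul k) = 1" | "period (Div m) = m" | "period (NDiv m) = m"

fun tick :: "cop \<Rightarrow> nat \<Rightarrow> bool" where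
  "tick (Div m) r \<longleftrightarrow> Suc r = m" | "tick (Mul k) r \<longleftrightarrow> True" | "tick (NDiv m) r \<longleftrightarrow> True"

fun okres :: "cop \<Rightarrow> nat \<Rightarrow> bool" where
  "okres (Mul k) r \<longleftrightarrow> True" | "okres (Div m) r \<longleftrightarrow> r = 0" | "okres (NDiv m) r \<longleftrightarrow> r \<noteq> 0"

fun ticks :: "cop \<Rightarrow> nat \<Rightarrow> nat" where
  "ticks (Mul k) n = n" | "ticks (Div m) n = n div m" | "ticks (NDiv m) n = n"

text \<open>
  The automaton guesses either that Player 2 writes a block of a wrong length or that a run of the
  machine exists. In the first case \<open>E1\<close> counts a block, \<open>E2\<close> counts down in the
  next one, and \<open>E3\<close> is reached when that block has the right length so far. In the second
  case \<open>Pre\<close> skips the blocks of length 0 and 1, and a transition \<open>t\<close> is simulated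
  on two blocks: on the first one the counter is decreased once per \<open>rate\<close> letters
  (\<open>PA\<close>) and then counts up (\<open>PB\<close>); on the second one, after an extra letter
  (\<open>PC0\<close>), it is decreased (\<open>PC\<close>) and then builds up the result (\<open>PD\<close>).
\<close>

datatype 't phase = Init | E0 | E1 | E2 | E3 | Acc | Dead | Pre
  | PA 't nat | PB 't | PC0 't | PC 't | PD 't nat

definition dstep :: "'s btrans \<Rightarrow> nat \<Rightarrow> 's btrans phase \<times> int" where
  "dstep t r = (PD t (if Suc r = period (t_op t) then 0 else Suc r), if tick (t_op t) r then 1 else 0)"

text \<open>The reaction to a filler \<open>F\<close> of Player 2. In \<open>Init\<close> it is
  already a fault, as the block of length 0 must be empty; in \<open>E3\<close> it makes the block
  longer than its predecessor by at least two.\<close>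

fun fil :: "'s btrans phase \<Rightarrow> bool \<Rightarrow> 's btrans phase \<times> int" where
  "fil Init z = (Acc, 0)"
| "fil E0 z = (E0, 0)"
| "fil E1 z = (E1, 1)"
| "fil E2 z = (if z then (E3, 0) else (E2, -1))"
| "fil E3 z = (Acc, 0)"
| "fil Acc z = (Acc, 0)"
| "fil Dead z = (Dead, 0)"
| "fil Pre z = (Pre, 0)"
| "fil (PA t a) z = (if z then (PB t, 1) else if Suc a = rate (t_op t) then (PA t 0, -1) else (PA t (Suc a), 0))"
| "fil (PB t) z = (PB t, 1)"
| "fil (PC0 t) z = (PC t, 0)"
| "fil (PC t) z = (if z then dstep t 0 else (PC t, -1))"
| "fil (PD t r) z = dstep t r"

text \<open>
  Player 1 makes a real move at the end of a step by writing a letter other than \<open>F\<close>;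
  the letter that Player 2 writes as separator is then the answer.
\<close>

definition evm :: "nat \<Rightarrow> 's btrans \<Rightarrow> nat \<Rightarrow> nat \<Rightarrow> bool" where
  "evm F t p y \<longleftrightarrow> (case t_ev t of None \<Rightarrow> p = F | Some xy \<Rightarrow> xy = (p, y))"

definition endsep :: "nat \<Rightarrow> 's btrans set \<Rightarrow> 's btrans \<Rightarrow> nat \<Rightarrow> nat \<Rightarrow> nat \<Rightarrow> 's btrans phase \<Rightarrow> bool" where
  "endsep F B t r p y q' \<longleftrightarrow> okres (t_op t) r \<and> evm F t p y \<and> (\<exists>t'\<in>B. q' = PA t' 0 \<and> t_src t' = t_dst t)"

text \<open>The reaction to a separator. In \<open>E2\<close> it comes too early; in
  \<open>E3\<close> it comes in time, and the accusation fails. The branch from \<open>Init\<close>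
  to \<open>E2\<close> compares block 1 with the empty block 0. \<open>PA\<close> may be left here
  only with an empty counter, which happens when the block is exactly used up.\<close>

fun sepr :: "nat \<Rightarrow> 's btrans set \<Rightarrow> 's \<Rightarrow> 's btrans phase \<Rightarrow> bool \<Rightarrow> nat \<Rightarrow> nat \<Rightarrow> 's btrans phase \<Rightarrow> int \<Rightarrow> bool" where
  "sepr F B s0 Init z p y q' d \<longleftrightarrow> d = 0 \<and> q' \<in> {E0, E1, E2, Pre}"
| "sepr F B s0 E0 z p y q' d \<longleftrightarrow> d = 0 \<and> q' \<in> {E0, E1}"
| "sepr F B s0 E1 z p y q' d \<longleftrightarrow> d = 0 \<and> q' = E2"
| "sepr F B s0 E2 z p y q' d \<longleftrightarrow> d = 0 \<and> q' = Acc"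
| "sepr F B s0 E3 z p y q' d \<longleftrightarrow> d = 0 \<and> q' = Dead"
| "sepr F B s0 Acc z p y q' d \<longleftrightarrow> d = 0 \<and> q' = Acc"
| "sepr F B s0 Dead z p y q' d \<longleftrightarrow> d = 0 \<and> q' = Dead"
| "sepr F B s0 Pre z p y q' d \<longleftrightarrow> d = 1 \<and> (\<exists>t\<in>B. q' = PA t 0 \<and> t_src t = s0)"
| "sepr F B s0 (PA t a) z p y q' d \<longleftrightarrow> z \<and> d = 0 \<and> q' = PC0 t"
| "sepr F B s0 (PB t) z p y q' d \<longleftrightarrow> d = 0 \<and> q' = PC0 t"
| "sepr F B s0 (PC0 t) z p y q' d \<longleftrightarrow> False"
| "sepr F B s0 (PC t) z p y q' d \<longleftrightarrow> z \<and> d = 0 \<and> endsep F B t 0 p y q'"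
| "sepr F B s0 (PD t r) z p y q' d \<longleftrightarrow> d = 0 \<and> endsep F B t r p y q'"

definition ptr :: "nat \<Rightarrow> 's btrans set \<Rightarrow> 's \<Rightarrow> 's btrans phase \<Rightarrow> bool \<Rightarrow> nat \<Rightarrow> nat \<Rightarrow> 's btrans phase \<Rightarrow> int \<Rightarrow> bool" where
  "ptr F B s0 q z p y q' d \<longleftrightarrow> (if y = F then (q', d) = fil q z else sepr F B s0 q z p y q' d)"

fun ftr :: "'s btrans phase \<Rightarrow> 's btrans option" where
  "ftr (PA t a) = Some t" | "ftr (PB t) = Some t" | "ftr (PC0 t) = Some t" | "ftr (PC t) = Some t"
| "ftr (PD t a) = Some t" | "ftr _ = None"

definition pstates :: "'s btrans set \<Rightarrow> 's btrans phase set" where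
  "pstates B = {Init, E0, E1, E2, E3, Acc, Dead, Pre} \<union>
     (\<Union>t\<in>B. {PB t, PC0 t, PC t} \<union> PA t ` {..<rate (t_op t)} \<union> PD t ` {..<period (t_op t)})"

text \<open>A step of the machine from a state in \<open>G\<close> counts as accepting during all of
  its rounds. As blocks are finite, such rounds recur iff such steps do.\<close>

definition pacc :: "'s btrans set \<Rightarrow> 's set \<Rightarrow> 's btrans phase set" where
  "pacc B G = {q \<in> pstates B. q = Acc \<or> (\<exists>t. ftr q = Some t \<and> t_src t \<in> G)}"

definition game_lang :: "nat \<Rightarrow> nat set \<Rightarrow> 's btrans set \<Rightarrow> 's \<Rightarrow> 's set \<Rightarrow> nat word set" where
  "game_lang F X B s0 G = {\<rho> \<in> omega_words (insert F X).
     \<exists>r. round_run (ptr F B s0) Init \<rho> r \<and> (\<exists>\<^sub>\<infinity>i. fst (r i) \<in> pacc B G)}"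

lemma rate_period_pos: "cop_arg I > 0 \<Longrightarrow> rate I > 0 \<and> period I > 0"
  by (cases I) auto

lemma pstates_iff [simp]:
  "PA t a \<in> pstates B \<longleftrightarrow> t \<in> B \<and> a < rate (t_op t)" "PB t \<in> pstates B \<longleftrightarrow> t \<in> B"
  "PC0 t \<in> pstates B \<longleftrightarrow> t \<in> B" "PC t \<in> pstates B \<longleftrightarrow> t \<in> B"
  "PD t a \<in> pstates B \<longleftrightarrow> t \<in> B \<and> a < period (t_op t)"
  "Init \<in> pstates B" "E0 \<in> pstates B" "E1 \<in> pstates B" "E2 \<in> pstates B" "E3 \<in> pstates B"
  "Acc \<in> pstates B" "Dead \<in> pstates B" "Pre \<in> pstates B"
  by (auto simp: pstates_def)

lemma pstates_closed:
  assumes B: "\<And>t. t \<in> B \<Longrightarrow> cop_arg (t_op t) > 0"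
    and q: "q \<in> pstates B" and tr: "ptr F B s0 q z p y q' d"
  shows "q' \<in> pstates B \<and> d \<in> {-1, 0, 1} \<and> (z \<longrightarrow> d \<noteq> -1)"
proof (cases "y = F")
  case True
  then have "(q', d) = fil q z" using tr by (simp add: ptr_def)
  then show ?thesis using q rate_period_pos[OF B]
    by (cases q) (auto simp: dstep_def intro!: Suc_lessI split: if_splits)
next
  case False
  then have "sepr F B s0 q z p y q' d" using tr by (simp add: ptr_def)
  then show ?thesis using q rate_period_pos[OF B]
    by (cases q) (auto simp: endsep_def)
qed

lemma game_lang_r_BCL:
  assumes "finite X" "finite B" "\<And>t. t \<in> B \<Longrightarrow> cop_arg (t_op t) > 0"
  shows "game_lang F X B s0 G \<in> r_BCL 1 (insert F X)"
  unfolding game_lang_def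
proof (rule round_automaton)
  show "finite (pstates B)" using assms(2) unfolding pstates_def by auto
  show "finite (insert F X)" using assms(1) by simp
  show "Init \<in> pstates B" "pacc B G \<subseteq> pstates B" by (auto simp: pstates_def pacc_def)
qed (rule pstates_closed[OF assms(3)])

section \<open>Runs on plays with the correct block structure\<close>

definition fstep :: "'s btrans phase \<times> nat \<Rightarrow> 's btrans phase \<times> nat" where
  "fstep x = (fst (fil (fst x) (snd x = 0)), nat (int (snd x) + snd (fil (fst x) (snd x = 0))))"

lemma fil_nonneg: "0 \<le> int c + snd (fil q (c = 0))"
  by (cases q) (auto simp: dstep_def)

lemma fil_iff: "(q', int c' - int c) = fil q (c = 0) \<longleftrightarrow> (q', c') = fstep (q, c)"
  using fil_nonneg[of c q] by (auto simp: fstep_def prod_eq_iff)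

lemma ftr_fstep: "ftr (fst (fstep x)) = ftr (fst x)"
  unfolding fstep_def by (cases "fst x") (auto simp: dstep_def)

lemma ftr_fstep_pow: "ftr (fst ((fstep ^^ n) x)) = ftr (fst x)"
  by (induction n) (simp_all add: ftr_fstep)

definition sepstep where
  "sepstep F B s0 p y x x' \<longleftrightarrow> sepr F B s0 (fst x) (snd x = 0) p y (fst x') (int (snd x') - int (snd x))"

definition blk :: "nat \<Rightarrow> nat" where "blk n = pfst n + psnd n"

text \<open>
  Round \<open>pair o d\<close> is the round at offset \<open>o\<close> in the block of length \<open>o + d\<close>, so the
  separators sit exactly at the rounds \<open>pair j 0\<close>.
\<close>

definition proper :: "nat \<Rightarrow> nat word \<Rightarrow> bool" where
  "proper F \<rho> \<longleftrightarrow> (\<forall>n. \<rho> (2 * n + 1) = F \<longleftrightarrow> psnd n \<noteq> 0)"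

text \<open>The antidiagonals of the pairing have 1, 2, 3, ... places, just as many as the blocks of
  length 0, 1, 2, ... together with their separators. Walking along the pairing is therefore the
  clock of a proper play.\<close>

lemma Suc_pair: "Suc (pair a (Suc d)) = pair (Suc a) d" "Suc (pair a 0) = pair 0 (Suc a)"
  by (simp_all add: pair_def prod_encode_def)

definition seg :: "(nat \<Rightarrow> 's btrans phase \<times> nat) \<Rightarrow> nat \<Rightarrow> 's btrans phase \<times> nat" where
  "seg st n = (fstep ^^ pfst n) (st (blk n))"

lemma seg_pair: "seg st (pair a d) = (fstep ^^ a) (st (a + d))"
  by (simp add: seg_def blk_def)

lemma seg_step:
  assumes "\<rho> (2 * n + 1) = F \<longleftrightarrow> psnd n \<noteq> 0"
    "psnd n = 0 \<Longrightarrow> sepstep F B s0 (\<rho> (2 * n)) (\<rho> (2 * n + 1)) ((fstep ^^ pfst n) (st (pfst n))) (st (Suc (pfst n)))"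
  shows "ptr F B s0 (fst (seg st n)) (snd (seg st n) = 0) (\<rho> (2 * n)) (\<rho> (2 * n + 1))
    (fst (seg st (Suc n))) (int (snd (seg st (Suc n))) - int (snd (seg st n)))"
proof -
  obtain a d where n: "n = pair a d" by (metis pair_surj)
  show ?thesis
  proof (cases d)
    case 0
    then have "\<rho> (2 * n + 1) \<noteq> F" using assms(1) n by simp
    moreover have "seg st (Suc n) = st (Suc a)" "seg st n = (fstep ^^ a) (st a)"
      unfolding n 0 by (simp_all only: Suc_pair seg_pair) simp_all
    ultimately show ?thesis using assms(2) unfolding ptr_def sepstep_def n 0 by simp
  next
    case (Suc d')
    then have "\<rho> (2 * n + 1) = F" using assms(1) n by simp
    moreover have "seg st (Suc n) = fstep (seg st n)"
      unfolding n Suc Suc_pair seg_pair by simp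
    then have "(fst (seg st (Suc n)), int (snd (seg st (Suc n))) - int (snd (seg st n))) = fil (fst (seg st n)) (snd (seg st n) = 0)"
      unfolding fil_iff by simp
    ultimately show ?thesis unfolding ptr_def by simp
  qed
qed

text \<open>Fillers act deterministically, so a run is determined by its configurations
  \<open>st j\<close> at the starts of the blocks; \<open>seg\<close> fills in the rounds between.
  All choices are made at separators.\<close>

lemma proper_run_iff:
  assumes "proper F \<rho>"
  shows "round_run (ptr F B s0) Init \<rho> r \<longleftrightarrow> (\<exists>st. r = seg st \<and> st 0 = (Init, 0) \<and>
     (\<forall>j. sepstep F B s0 (\<rho> (2 * pair j 0)) (\<rho> (2 * pair j 0 + 1)) ((fstep ^^ j) (st j)) (st (Suc j))))"
    (is "?L \<longleftrightarrow> ?R")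
proof
  assume L: ?L
  define st where "st j = r (pair 0 j)" for j
  have step: "ptr F B s0 (fst (r n)) (snd (r n) = 0) (\<rho> (2 * n)) (\<rho> (2 * n + 1)) (fst (r (Suc n)))
        (int (snd (r (Suc n))) - int (snd (r n)))" for n
    using L unfolding round_run_def by blast
  have pr: "r (pair a d) = (fstep ^^ a) (st (a + d))" for a d
  proof (induction a arbitrary: d)
    case 0
    then show ?case by (simp add: st_def)
  next
    case (Suc a)
    have "\<rho> (2 * pair a (Suc d) + 1) = F" using assms unfolding proper_def by simp
    then have "(fst (r (Suc (pair a (Suc d)))), snd (r (Suc (pair a (Suc d))))) =
        fstep (fst (r (pair a (Suc d))), snd (r (pair a (Suc d))))"
      using step[of "pair a (Suc d)"] unfolding ptr_def fil_iff by presburger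
    then have "r (Suc (pair a (Suc d))) = fstep (r (pair a (Suc d)))" by simp
    then show ?case using Suc[of "Suc d"] unfolding Suc_pair by simp
  qed
  have "r = seg st"
  proof
    fix n show "r n = seg st n" using pr[of "pfst n" "psnd n"] by (simp add: seg_def blk_def)
  qed
  moreover have "st 0 = (Init, 0)" using L unfolding st_def round_run_def by simp
  moreover have "sepstep F B s0 (\<rho> (2 * pair j 0)) (\<rho> (2 * pair j 0 + 1)) ((fstep ^^ j) (st j)) (st (Suc j))" for j
  proof -
    have "\<rho> (2 * pair j 0 + 1) \<noteq> F" using assms unfolding proper_def by simp
    then show ?thesis using step[of "pair j 0"] pr[of j 0]
      unfolding ptr_def sepstep_def Suc_pair by (simp add: st_def)
  qed
  ultimately show ?R by blast
next
  assume ?R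
  then obtain st where st: "r = seg st" "st 0 = (Init, 0)"
     "\<And>j. sepstep F B s0 (\<rho> (2 * pair j 0)) (\<rho> (2 * pair j 0 + 1)) ((fstep ^^ j) (st j)) (st (Suc j))" by blast
  have "ptr F B s0 (fst (seg st n)) (snd (seg st n) = 0) (\<rho> (2 * n)) (\<rho> (2 * n + 1))
    (fst (seg st (Suc n))) (int (snd (seg st (Suc n))) - int (snd (seg st n)))" for n
  proof (rule seg_step)
    show "\<rho> (2 * n + 1) = F \<longleftrightarrow> psnd n \<noteq> 0" using assms unfolding proper_def by blast
    show "sepstep F B s0 (\<rho> (2 * n)) (\<rho> (2 * n + 1)) ((fstep ^^ pfst n) (st (pfst n))) (st (Suc (pfst n)))" if "psnd n = 0"
      using st(3)[of "pfst n"] pair_surj[of n] that by simp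
  qed
  moreover have "seg st 0 = (Init, 0)" using st(2) by (simp add: seg_def blk_def)
  ultimately show ?L unfolding round_run_def st(1) by blast
qed

lemma fstep_PA:
  assumes "rate (t_op t) > 0" "n \<le> rate (t_op t) * c"
  shows "(fstep ^^ n) (PA t 0, c) = (PA t (n mod rate (t_op t)), c - n div rate (t_op t))"
  using assms(2)
proof (induction n)
  case (Suc n)
  let ?k = "rate (t_op t)"
  have "n div ?k < c" using Suc.prems assms(1) by (simp add: less_mult_imp_div_less mult.commute)
  then show ?case using Suc assms(1)
    by (auto simp: fstep_def mod_Suc div_Suc)
qed simp

lemma fstep_PB:
  assumes "rate (t_op t) > 0"
  shows "(fstep ^^ (n + rate (t_op t) * c)) (PA t 0, c) = (if n = 0 then PA t 0 else PB t, n)"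
proof (induction n)
  case 0
  then show ?case using fstep_PA[OF assms order_refl, of c] assms by simp
next
  case (Suc n)
  then show ?case by (auto simp: fstep_def nat_add_distrib)
qed

lemma fstep_PC: "n \<le> g \<Longrightarrow> (fstep ^^ n) (PC t, g) = (PC t, g - n)"
  by (induction n) (auto simp: fstep_def)

lemma fstep_PD:
  assumes "period (t_op t) > 0"
  shows "(fstep ^^ n) (PC t, 0) = (if n = 0 then PC t else PD t (n mod period (t_op t)), ticks (t_op t) n)"
proof (induction n)
  case 0
  then show ?case by (cases "t_op t") auto
next
  case (Suc n)
  have tk: "nat (int (ticks I n) + (if tick I (n mod period I) then 1 else 0)) = ticks I (Suc n)"
    if "period I > 0" for I
    using that by (cases I) (auto simp: div_Suc mod_Suc nat_add_distrib)
  have md: "(if Suc (n mod period (t_op t)) = period (t_op t) then 0 else Suc (n mod period (t_op t))) = Suc n mod period (t_op t)"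
    by (simp add: mod_Suc)
  have "(fstep ^^ Suc n) (PC t, 0) = fstep (if n = 0 then PC t else PD t (n mod period (t_op t)), ticks (t_op t) n)"
    using Suc by simp
  also have "\<dots> = (PD t (Suc n mod period (t_op t)), ticks (t_op t) (Suc n))"
  proof (cases "n = 0")
    case True
    then have "ticks (t_op t) 0 = 0" by (cases "t_op t") auto
    then show ?thesis using True tk[OF assms] md by (simp add: fstep_def dstep_def)
  next
    case False
    then show ?thesis using tk[OF assms] md by (simp add: fstep_def dstep_def)
  qed
  finally show ?case by simp
qed

lemma cop_rel_ticks:
  "cop_rel I c c' \<longleftrightarrow> okres I (rate I * c mod period I) \<and> c' = ticks I (rate I * c)"
  by (cases I) (auto simp: dvd_eq_mod_eq_0)

text \<open>
  On a block of length \<open>l\<close> the counter goes from \<open>c\<close> to \<open>l - k c\<close>, where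
  \<open>k\<close> is the rate, and so \<open>k c\<close> letters of the next block remain for the result.
\<close>

lemma pair_of_blocks:
  assumes "cop_arg (t_op t) > 0"
  shows "(\<exists>m. sepstep F B s0 p0 y0 ((fstep ^^ l) (PA t 0, c)) m \<and>
      sepstep F B s0 p y ((fstep ^^ Suc l) m) x) \<longleftrightarrow>
    rate (t_op t) * c \<le> l \<and> cop_rel (t_op t) c (snd x) \<and> evm F t p y \<and>
    (\<exists>t'\<in>B. fst x = PA t' 0 \<and> t_src t' = t_dst t)"
    and "sepstep F B s0 p0 y0 ((fstep ^^ l) (PA t 0, c)) m \<Longrightarrow> m = (PC0 t, l - rate (t_op t) * c)"
proof -
  note pos = rate_period_pos[OF assms]
  have first: "sepstep F B s0 p0 y0 ((fstep ^^ l) (PA t 0, c)) m \<longleftrightarrow>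
     rate (t_op t) * c \<le> l \<and> m = (PC0 t, l - rate (t_op t) * c)" for m
  proof (cases "rate (t_op t) * c \<le> l")
    case True
    then have "(fstep ^^ l) (PA t 0, c) = (if l - rate (t_op t) * c = 0 then PA t 0 else PB t, l - rate (t_op t) * c)"
      using fstep_PB[of t "l - rate (t_op t) * c" c] pos by simp
    then show ?thesis using True unfolding sepstep_def by (cases m) (auto simp del: of_nat_diff)
  next
    \<comment> \<open>The block is too short: its separator finds \<open>PA\<close> with a positive
      counter, where the run is stuck.\<close>
    case False
    then have "(fstep ^^ l) (PA t 0, c) = (PA t (l mod rate (t_op t)), c - l div rate (t_op t))"
      using fstep_PA[of t l c] pos by simp
    moreover have "l div rate (t_op t) < c" using False pos by (simp add: less_mult_imp_div_less mult.commute)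
    ultimately show ?thesis using False unfolding sepstep_def by simp
  qed
  then show "sepstep F B s0 p0 y0 ((fstep ^^ l) (PA t 0, c)) m \<Longrightarrow> m = (PC0 t, l - rate (t_op t) * c)"
    by blast
  have second: "sepstep F B s0 p y ((fstep ^^ Suc l) (PC0 t, l - rate (t_op t) * c)) x \<longleftrightarrow>
      cop_rel (t_op t) c (snd x) \<and> evm F t p y \<and> (\<exists>t'\<in>B. fst x = PA t' 0 \<and> t_src t' = t_dst t)"
    if le: "rate (t_op t) * c \<le> l"
  proof -
    let ?n = "rate (t_op t) * c"
    have PC0: "fstep (PC0 t, g) = (PC t, g)" for g by (simp add: fstep_def)
    have "(fstep ^^ Suc l) (PC0 t, l - ?n) = (fstep ^^ l) (fstep (PC0 t, l - ?n))"
      by (simp only: funpow_Suc_right o_apply)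
    also have "\<dots> = (fstep ^^ (?n + (l - ?n))) (PC t, l - ?n)"
      using le by (simp add: PC0)
    also have "\<dots> = (fstep ^^ ?n) (PC t, 0)"
      unfolding funpow_add o_apply by (simp add: fstep_PC)
    also have "\<dots> = (if ?n = 0 then PC t else PD t (?n mod period (t_op t)), ticks (t_op t) ?n)"
      by (rule fstep_PD) (use pos in blast)
    finally have eq: "(fstep ^^ Suc l) (PC0 t, l - ?n) = (if ?n = 0 then PC t else PD t (?n mod period (t_op t)), ticks (t_op t) ?n)" .
    have "ticks (t_op t) 0 = 0" by (cases "t_op t") auto
    then show ?thesis unfolding sepstep_def eq cop_rel_ticks
      by (cases "?n = 0") (auto simp: endsep_def)
  qed
  show "(\<exists>m. sepstep F B s0 p0 y0 ((fstep ^^ l) (PA t 0, c)) m \<and>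
      sepstep F B s0 p y ((fstep ^^ Suc l) m) x) \<longleftrightarrow>
    rate (t_op t) * c \<le> l \<and> cop_rel (t_op t) c (snd x) \<and> evm F t p y \<and>
    (\<exists>t'\<in>B. fst x = PA t' 0 \<and> t_src t' = t_dst t)"
    unfolding first using second by blast
qed

lemma fstep_const: "fil q True = (q, 0) \<Longrightarrow> fil q False = (q, 0) \<Longrightarrow> (fstep ^^ n) (q, c) = (q, c)"
  by (cases "c = 0"; induction n) (simp_all add: fstep_def)

lemma fstep_E1: "(fstep ^^ n) (E1, c) = (E1, c + n)"
  by (induction n) (simp_all add: fstep_def nat_add_distrib)

lemma fstep_E2: "n \<le> c \<Longrightarrow> (fstep ^^ n) (E2, c) = (E2, c - n)"
  by (induction n) (auto simp: fstep_def)

lemma fstep_E2_Suc: "(fstep ^^ Suc c) (E2, c) = (E3, 0)"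
  unfolding funpow.simps o_apply fstep_E2[OF order_refl] by (simp add: fstep_def)

text \<open>What an accusing run can look like at the start of block \<open>j\<close> of a proper
  play. In \<open>E2\<close> the counter holds the length of the previous block, so block
  \<open>j\<close> ends precisely in \<open>E3\<close> and \<open>Acc\<close> is never
  reached.\<close>

definition err_inv :: "nat \<Rightarrow> 's btrans phase \<times> nat \<Rightarrow> bool" where
  "err_inv j x \<longleftrightarrow> (\<exists>c. x = (Dead, c)) \<or> x = (E0, 0) \<or> x = (E1, 0) \<or> (\<exists>c. x = (E2, c) \<and> Suc c = j)"

lemma err_inv_fstep:
  fixes x :: "'s btrans phase \<times> nat"
  assumes "err_inv j x" "n \<le> j"
  shows "fst ((fstep ^^ n) x) \<in> {Dead, E0, E1, E2, E3}"
proof -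
  have "fst ((fstep ^^ n) (E2 :: 's btrans phase, c)) \<in> {E2, E3}" if "Suc c = j" for c
  proof (cases "n \<le> c")
    case False
    then have "n = Suc c" using that assms(2) by simp
    show ?thesis unfolding \<open>n = Suc c\<close> fstep_E2_Suc by simp
  qed (simp add: fstep_E2)
  then show ?thesis using assms(1) unfolding err_inv_def
    by (auto simp: fstep_const fstep_E1)
qed

lemma err_inv_sepstep:
  assumes "err_inv j x" "sepstep F B s0 p y ((fstep ^^ j) x) x'"
  shows "err_inv (Suc j) x'"
proof -
  from assms(1) consider c where "x = (Dead, c)" | "x = (E0, 0)" | "x = (E1, 0)" | c where "x = (E2, c)" "Suc c = j"
    unfolding err_inv_def by blast
  then show ?thesis
  proof cases
    case 4
    then have "(fstep ^^ j) x = (E3, 0)" using fstep_E2_Suc by metis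
    then show ?thesis using assms(2) unfolding sepstep_def err_inv_def by (cases x') auto
  qed (use assms(2) in \<open>cases x'; auto simp: sepstep_def err_inv_def fstep_const fstep_E1\<close>)+
qed

text \<open>
  Step \<open>i\<close> of the machine takes place on the blocks of lengths \<open>2 i + 2\<close> and
  \<open>2 i + 3\<close>; its event is read at the separator of the latter.
\<close>

definition brun :: "nat \<Rightarrow> 's btrans set \<Rightarrow> 's \<Rightarrow> 's set \<Rightarrow> nat word \<Rightarrow> bool" where
  "brun F B s0 G \<rho> \<longleftrightarrow> (\<exists>t c. t_src (t 0) = s0 \<and> c 0 = 1 \<and> (\<forall>i. t i \<in> B \<and> t_dst (t i) = t_src (t (Suc i)) \<and>
      rate (t_op (t i)) * c i \<le> 2 * i + 2 \<and> cop_rel (t_op (t i)) (c i) (c (Suc i)) \<and>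
      evm F (t i) (\<rho> (2 * pair (2 * i + 3) 0)) (\<rho> (2 * pair (2 * i + 3) 0 + 1))) \<and>
      (\<exists>\<^sub>\<infinity>i. t_src (t i) \<in> G))"

lemma blk_bound: "n \<le> triangle (blk n) + blk n"
  using pair_surj[of n] by (simp add: pair_def prod_encode_def blk_def)

lemma blk_eq_0: "blk n = 0 \<Longrightarrow> n = 0"
  using blk_bound[of n] by simp

text \<open>By \<open>blk_bound\<close> only finitely many rounds belong to the blocks up to a given
  one, so recurrence over rounds and over blocks agree.\<close>

lemma INFM_blk: "(\<exists>\<^sub>\<infinity>n. P (blk n)) \<longleftrightarrow> (\<exists>\<^sub>\<infinity>j. P j)"
proof
  assume P: "\<exists>\<^sub>\<infinity>n. P (blk n)"
  show "\<exists>\<^sub>\<infinity>j. P j" unfolding INFM_nat_le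
  proof
    fix m
    obtain n where n: "n \<ge> Suc (triangle m + m)" "P (blk n)" using P unfolding INFM_nat_le by blast
    have "m \<le> blk n"
    proof (rule ccontr)
      assume "\<not> m \<le> blk n"
      then have "triangle (blk n) + blk n \<le> triangle m + m" using triangle_mono[of "blk n" m] by simp
      then show False using n(1) blk_bound[of n] by simp
    qed
    then show "\<exists>j\<ge>m. P j" using n(2) by blast
  qed
next
  assume P: "\<exists>\<^sub>\<infinity>j. P j"
  show "\<exists>\<^sub>\<infinity>n. P (blk n)" unfolding INFM_nat_le
  proof
    fix m
    obtain j where j: "j \<ge> m" "P j" using P unfolding INFM_nat_le by blast
    have "blk (pair 0 j) = j" by (simp add: blk_def)
    moreover have "j \<le> pair 0 j" using le_prod_encode_2[of j 0] by (simp add: pair_def)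
    ultimately show "\<exists>n\<ge>m. P (blk n)" using j by (metis order_trans)
  qed
qed

text \<open>Accusations fail on a proper play, so an accepting run has to enter \<open>Pre\<close>.
  From block 2 on its block starts alternate between \<open>PA\<close> and \<open>PC0\<close>, and
  the steps of the machine are read off from them.\<close>

lemma proper_accept_iff:
  fixes B :: "'s btrans set"
  assumes \<rho>: "proper F \<rho>" and B: "\<And>t. t \<in> B \<Longrightarrow> cop_arg (t_op t) > 0"
  shows "(\<exists>r. round_run (ptr F B s0) Init \<rho> r \<and> (\<exists>\<^sub>\<infinity>i. fst (r i) \<in> pacc B G)) \<longleftrightarrow> brun F B s0 G \<rho>"
    (is "?L \<longleftrightarrow> ?R")
proof
  assume ?L
  then obtain r where run: "round_run (ptr F B s0) Init \<rho> r" and acc: "\<exists>\<^sub>\<infinity>i. fst (r i) \<in> pacc B G" by blast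
  then obtain st where st: "r = seg st" "st 0 = (Init, 0)"
    "\<And>j. sepstep F B s0 (\<rho> (2 * pair j 0)) (\<rho> (2 * pair j 0 + 1)) ((fstep ^^ j) (st j)) (st (Suc j))"
    unfolding proper_run_iff[OF \<rho>] by blast
  have st1: "snd (st 1) = 0" "fst (st 1) \<in> {E0, E1, E2, Pre}"
    using st(3)[of 0] st(2) unfolding sepstep_def by auto
  have pre: "st 1 = (Pre, 0)"
  proof (rule ccontr)
    assume "st 1 \<noteq> (Pre, 0)"
    then have e1: "err_inv 1 (st 1)" using st1 unfolding err_inv_def by (cases "st 1") auto
    have e: "err_inv (Suc j) (st (Suc j))" for j
    proof (induction j)
      case 0 then show ?case using e1 by simp
    next
      case (Suc j) then show ?case using st(3)[of "Suc j"] by (rule err_inv_sepstep)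
    qed
    have "fst (r n) \<notin> pacc B G" if "n > 0" for n
    proof -
      have "blk n \<noteq> 0" using that blk_eq_0 by blast
      then obtain j where j: "blk n = Suc j" using not0_implies_Suc by blast
      have "fst (r n) \<in> {Dead, E0, E1, E2, E3}"
        unfolding st(1) seg_def j
        by (rule err_inv_fstep[OF e]) (use j in \<open>simp add: blk_def\<close>)
      then show ?thesis unfolding pacc_def by auto
    qed
    then show False using acc unfolding INFM_nat_le by (metis less_eq_Suc_le)
  qed
  have "(fstep ^^ 1) (st 1) = (Pre, 0)" unfolding pre by (rule fstep_const) simp_all
  then have st2: "\<exists>t\<in>B. st 2 = (PA t 0, 1) \<and> t_src t = s0"
    using st(3)[of 1] unfolding sepstep_def by (cases "st 2") (auto simp: numeral_2_eq_2)
  have ne: "rate (t_op t) * c \<le> 2 * i + 2 \<and> cop_rel (t_op t) c (snd (st (2 * Suc i + 2))) \<and>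
      evm F t (\<rho> (2 * pair (2 * i + 3) 0)) (\<rho> (2 * pair (2 * i + 3) 0 + 1)) \<and>
      (\<exists>t'\<in>B. fst (st (2 * Suc i + 2)) = PA t' 0 \<and> t_src t' = t_dst t)"
    if "st (2 * i + 2) = (PA t 0, c)" "t \<in> B" for i t c
  proof -
    have "sepstep F B s0 (\<rho> (2 * pair (2 * i + 2) 0)) (\<rho> (2 * pair (2 * i + 2) 0 + 1))
       ((fstep ^^ (2 * i + 2)) (PA t 0, c)) (st (2 * i + 3))"
      using st(3)[of "2 * i + 2"] that by (simp add: numeral_3_eq_3)
    moreover have "sepstep F B s0 (\<rho> (2 * pair (2 * i + 3) 0)) (\<rho> (2 * pair (2 * i + 3) 0 + 1))
       ((fstep ^^ Suc (2 * i + 2)) (st (2 * i + 3))) (st (2 * Suc i + 2))"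
    proof -
      have "Suc (2 * i + 2) = 2 * i + 3" "Suc (2 * i + 3) = 2 * Suc i + 2" by simp_all
      then show ?thesis using st(3)[of "2 * i + 3"] by metis
    qed
    ultimately show ?thesis using pair_of_blocks(1)[OF B[OF that(2)]] by blast
  qed
  have ex: "\<exists>t c. t \<in> B \<and> st (2 * i + 2) = (PA t 0, c)" for i
  proof (induction i)
    case 0
    then show ?case using st2 by (auto simp: numeral_2_eq_2)
  next
    case (Suc i)
    then show ?case using ne by (metis prod.collapse)
  qed
  then obtain t c where tc: "\<And>i. t i \<in> B" "\<And>i. st (2 * i + 2) = (PA (t i) 0, c i)" by metis
  have "\<exists>\<^sub>\<infinity>i. t_src (t i) \<in> G"
  proof (rule ccontr)
    assume "\<not> ?thesis"
    then obtain N where N: "\<And>i. i \<ge> N \<Longrightarrow> t_src (t i) \<notin> G" unfolding INFM_nat_le by blast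
    have ft: "ftr (fst (st j)) = Some (t ((j - 2) div 2))" if "j \<ge> 2" for j
    proof -
      define i where "i = (j - 2) div 2"
      have "j = 2 * i + 2 \<or> j = 2 * i + 3" using that unfolding i_def by linarith
      then consider "j = 2 * i + 2" | "j = 2 * i + 3" by blast
      then show ?thesis
      proof cases
        case 1
        then show ?thesis using tc(2)[of i] by (simp add: i_def[symmetric])
      next
        case 2
        have "sepstep F B s0 (\<rho> (2 * pair (2 * i + 2) 0)) (\<rho> (2 * pair (2 * i + 2) 0 + 1))
            ((fstep ^^ (2 * i + 2)) (PA (t i) 0, c i)) (st j)"
          using st(3)[of "2 * i + 2"] tc(2)[of i] 2 by (simp add: numeral_3_eq_3)
        then show ?thesis using pair_of_blocks(2)[OF B[OF tc(1)]] by (fastforce simp: i_def[symmetric])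
      qed
    qed
    \<comment> \<open>In other words, infinitely many rounds would lie in blocks before 2 N + 2,
      because no later round is accepting.\<close>
    have "\<exists>\<^sub>\<infinity>n. blk n \<ge> 2 * N + 2 \<longrightarrow> False"
    proof -
      have "fst (r n) \<notin> pacc B G" if "blk n \<ge> 2 * N + 2" for n
      proof -
        have "ftr (fst (r n)) = Some (t ((blk n - 2) div 2))"
          unfolding st(1) seg_def ftr_fstep_pow using that by (intro ft) simp
        moreover have "t_src (t ((blk n - 2) div 2)) \<notin> G" using that by (intro N) linarith
        ultimately show ?thesis unfolding pacc_def by auto
      qed
      then show ?thesis using acc by (auto elim: INFM_mono)
    qed
    then have "\<exists>\<^sub>\<infinity>j. j \<ge> 2 * N + 2 \<longrightarrow> False" using INFM_blk[of "\<lambda>j. j \<ge> 2 * N + 2 \<longrightarrow> False"] by simp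
    then show False unfolding INFM_nat_le by (meson le_refl order_trans)
  qed
  moreover have "t_src (t 0) = s0 \<and> c 0 = 1" using st2 tc(2)[of 0] by (auto simp: numeral_2_eq_2)
  moreover have "t_dst (t i) = t_src (t (Suc i)) \<and>
      rate (t_op (t i)) * c i \<le> 2 * i + 2 \<and> cop_rel (t_op (t i)) (c i) (c (Suc i)) \<and>
      evm F (t i) (\<rho> (2 * pair (2 * i + 3) 0)) (\<rho> (2 * pair (2 * i + 3) 0 + 1))" for i
    using ne[OF tc(2) tc(1), of i] tc(2)[of "Suc i"] by auto
  ultimately show ?R unfolding brun_def using tc(1) by blast
next
  assume ?R
  then obtain t c where t0: "t_src (t 0) = s0" "c 0 = 1"
    and t: "\<And>i. t i \<in> B" "\<And>i. t_dst (t i) = t_src (t (Suc i))"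
      "\<And>i. rate (t_op (t i)) * c i \<le> 2 * i + 2" "\<And>i. cop_rel (t_op (t i)) (c i) (c (Suc i))"
      "\<And>i. evm F (t i) (\<rho> (2 * pair (2 * i + 3) 0)) (\<rho> (2 * pair (2 * i + 3) 0 + 1))"
    and G: "\<exists>\<^sub>\<infinity>i. t_src (t i) \<in> G" unfolding brun_def by blast
  \<comment> \<open>The odd block \<open>j\<close> = 2 i + 3 starts with what the preceding block,
    of length j - 1, has counted up after its first \<open>rate * c\<close> letters.\<close>
  define st where "st j = (if j = 0 then (Init, 0) else if j = 1 then (Pre, 0)
     else if even j then (PA (t ((j - 2) div 2)) 0, c ((j - 2) div 2))
     else (PC0 (t ((j - 2) div 2)), j - 1 - rate (t_op (t ((j - 2) div 2))) * c ((j - 2) div 2)))" for j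
  have ste: "st (2 * i + 2) = (PA (t i) 0, c i)"
    and sto: "st (2 * i + 3) = (PC0 (t i), 2 * i + 2 - rate (t_op (t i)) * c i)" for i
  proof -
    have "even (2 * i + 2)" "odd (2 * i + 3)" "(2 * i + 2 - 2) div 2 = i" "(2 * i + 3 - 2) div 2 = i"
      "2 * i + 3 - 1 = 2 * i + 2" "2 * i + 2 \<noteq> 0" "2 * i + 2 \<noteq> 1" "2 * i + 3 \<noteq> 0" "2 * i + 3 \<noteq> 1"
      by presburger+
    then show "st (2 * i + 2) = (PA (t i) 0, c i)"
      "st (2 * i + 3) = (PC0 (t i), 2 * i + 2 - rate (t_op (t i)) * c i)"
      unfolding st_def by (simp_all only: if_False if_True simp_thms)
  qed
  have "sepstep F B s0 (\<rho> (2 * pair j 0)) (\<rho> (2 * pair j 0 + 1)) ((fstep ^^ j) (st j)) (st (Suc j))" for j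
  proof -
    consider "j = 0" | "j = 1" | i where "j = 2 * i + 2" | i where "j = 2 * i + 3" 
    proof -
      have "j = 0 \<or> j = 1 \<or> j = 2 * ((j - 2) div 2) + 2 \<or> j = 2 * ((j - 2) div 2) + 3" by linarith
      then show thesis using that by blast
    qed
    then show ?thesis
    proof cases
      case 1
      then show ?thesis by (simp add: st_def sepstep_def)
    next
      case 2
      have "(fstep ^^ 1) (st 1) = (Pre, 0)" unfolding st_def by (simp add: fstep_def)
      moreover have "st (Suc 1) = (PA (t 0) 0, 1)" using ste[of 0] t0 by (simp add: numeral_2_eq_2)
      ultimately show ?thesis unfolding 2 sepstep_def using t(1) t0 by auto
    next
      case 3
      have "\<exists>m. sepstep F B s0 (\<rho> (2 * pair (2 * i + 2) 0)) (\<rho> (2 * pair (2 * i + 2) 0 + 1)) ((fstep ^^ (2 * i + 2)) (PA (t i) 0, c i)) m \<and>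
         sepstep F B s0 (\<rho> (2 * pair (2 * i + 3) 0)) (\<rho> (2 * pair (2 * i + 3) 0 + 1)) ((fstep ^^ Suc (2 * i + 2)) m)
           (PA (t (Suc i)) 0, c (Suc i))"
        unfolding pair_of_blocks(1)[OF B[OF t(1)]] using t by auto
      then have "sepstep F B s0 (\<rho> (2 * pair (2 * i + 2) 0)) (\<rho> (2 * pair (2 * i + 2) 0 + 1))
          ((fstep ^^ (2 * i + 2)) (st (2 * i + 2))) (st (2 * i + 3))"
        using pair_of_blocks(2)[OF B[OF t(1)]] unfolding sto ste by blast
      moreover have "Suc (2 * i + 2) = 2 * i + 3" by simp
      ultimately show ?thesis unfolding 3 by metis
    next
      case 4
      \<comment> \<open>The separator between the two blocks of a step is processed without looking
        at its letters, hence the dummies 0 0.\<close>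
      have "\<exists>m. sepstep F B s0 0 0 ((fstep ^^ (2 * i + 2)) (PA (t i) 0, c i)) m \<and>
         sepstep F B s0 (\<rho> (2 * pair (2 * i + 3) 0)) (\<rho> (2 * pair (2 * i + 3) 0 + 1)) ((fstep ^^ Suc (2 * i + 2)) m)
           (PA (t (Suc i)) 0, c (Suc i))"
        unfolding pair_of_blocks(1)[OF B[OF t(1)]] using t by auto
      then have "sepstep F B s0 (\<rho> (2 * pair (2 * i + 3) 0)) (\<rho> (2 * pair (2 * i + 3) 0 + 1))
          ((fstep ^^ Suc (2 * i + 2)) (st (2 * i + 3))) (PA (t (Suc i)) 0, c (Suc i))"
        using pair_of_blocks(2)[OF B[OF t(1)]] unfolding sto by blast
      moreover have "Suc (2 * i + 2) = 2 * i + 3" "st (Suc (2 * i + 3)) = (PA (t (Suc i)) 0, c (Suc i))"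
        using ste[of "Suc i"] by (simp_all add: eval_nat_numeral)
      ultimately show ?thesis unfolding 4 by metis
    qed
  qed
  then have "round_run (ptr F B s0) Init \<rho> (seg st)"
    unfolding proper_run_iff[OF \<rho>] by (intro exI[of _ st]) (simp add: st_def)
  moreover have "\<exists>\<^sub>\<infinity>n. fst (seg st n) \<in> pacc B G"
    unfolding INFM_nat_le
  proof
    fix m
    obtain i where i: "i \<ge> m" "t_src (t i) \<in> G" using G unfolding INFM_nat_le by blast
    have "seg st (pair 0 (2 * i + 2)) = (PA (t i) 0, c i)" by (simp add: seg_pair ste[simplified])
    moreover have "PA (t i) 0 \<in> pacc B G"
      unfolding pacc_def using i(2) t(1)[of i] rate_period_pos[OF B[OF t(1)[of i]]] by (cases "t i") auto
    moreover have "m \<le> pair 0 (2 * i + 2)" using le_prod_encode_2[of "2 * i + 2" 0] i(1) by (simp add: pair_def)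
    ultimately show "\<exists>n\<ge>m. fst (seg st n) \<in> pacc B G" by (metis fst_conv)
  qed
  ultimately show ?L by blast
qed

text \<open>The least faulty round \<open>n\<close> determines the block \<open>j\<close> to be
  accused: block j - 1 is measured and block \<open>j\<close> compared with it. All rounds before
  \<open>n\<close> are as in a proper play, so \<open>seg\<close> still describes the run up to
  there. For \<open>j = 0\<close> the fault is caught in \<open>Init\<close>.\<close>

lemma improper_accept:
  fixes B :: "'s btrans set"
  assumes "\<not> proper F \<rho>"
  shows "\<exists>r. round_run (ptr F B s0) Init \<rho> r \<and> (\<exists>\<^sub>\<infinity>i. fst (r i) \<in> pacc B G)"
proof -
  define n where "n = (LEAST n. (\<rho> (2 * n + 1) = F) \<noteq> (psnd n \<noteq> 0))"
  have n: "(\<rho> (2 * n + 1) = F) \<noteq> (psnd n \<noteq> 0)"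
    unfolding n_def by (rule LeastI_ex) (use assms in \<open>auto simp: proper_def\<close>)
  have before: "\<rho> (2 * m + 1) = F \<longleftrightarrow> psnd m \<noteq> 0" if "m < n" for m
    using not_less_Least[of m "\<lambda>n. (\<rho> (2 * n + 1) = F) \<noteq> (psnd n \<noteq> 0)"] that unfolding n_def by blast
  define j where "j = blk n"
  define st :: "nat \<Rightarrow> 's btrans phase \<times> nat" where "st i = (if i = 0 then (Init, 0) else if Suc i < j then (E0, 0)
     else if Suc i = j then (E1, 0) else (E2, j - 1))" for i
  define c where "c = snd (seg st n)"
  define r where "r m = (if m \<le> n then seg st m else (Acc, c))" for m
  have sep: "sepstep F B s0 p y ((fstep ^^ i) (st i)) (st (Suc i))" if "i < j" for i p y
  proof -
    have E0: "(fstep ^^ i) (E0, 0) = (E0 :: 's btrans phase, 0)" by (rule fstep_const) simp_all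
    show ?thesis using that unfolding st_def
      by (cases "i = 0") (auto simp: sepstep_def E0 fstep_E1)
  qed
  have blk_mono: "blk m < j" if "psnd m = 0" "m < n" for m
  proof (rule ccontr)
    assume "\<not> blk m < j"
    then have "triangle j + j \<le> triangle (blk m) + blk m" using triangle_mono[of j "blk m"] by simp
    also have "\<dots> = m" using pair_surj[of m] that(1) by (simp add: pair_def prod_encode_def blk_def)
    finally show False using blk_bound[of n] that(2) unfolding j_def by simp
  qed
  have step: "ptr F B s0 (fst (r m)) (snd (r m) = 0) (\<rho> (2 * m)) (\<rho> (2 * m + 1)) (fst (r (Suc m)))
        (int (snd (r (Suc m))) - int (snd (r m)))" for m
  proof -
    consider "m < n" | "m = n" | "m > n" by linarith
    then show ?thesis
    proof cases
      case 1
      have "ptr F B s0 (fst (seg st m)) (snd (seg st m) = 0) (\<rho> (2 * m)) (\<rho> (2 * m + 1)) (fst (seg st (Suc m)))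
        (int (snd (seg st (Suc m))) - int (snd (seg st m)))"
      proof (rule seg_step)
        show "\<rho> (2 * m + 1) = F \<longleftrightarrow> psnd m \<noteq> 0" by (rule before[OF 1])
        show "sepstep F B s0 (\<rho> (2 * m)) (\<rho> (2 * m + 1)) ((fstep ^^ pfst m) (st (pfst m))) (st (Suc (pfst m)))" if "psnd m = 0"
          using blk_mono[OF that 1] that by (intro sep) (simp add: blk_def)
      qed
      then show ?thesis using 1 unfolding r_def by simp
    next
      case 2
      have rn: "r m = seg st n" "r (Suc m) = (Acc, c)" using 2 by (simp_all add: r_def)
      show ?thesis
      proof (cases "j = 0")
        case True
        then have "n = 0" using blk_eq_0 unfolding j_def by blast
        then have "seg st n = (Init, 0)" "\<rho> (2 * m + 1) = F"
          using n 2 by (simp_all add: seg_def blk_def st_def)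
        then show ?thesis unfolding rn ptr_def by (simp add: c_def)
      next
        case False
        then have stj: "st j = (E2, j - 1)" by (simp add: st_def)
        show ?thesis
        proof (cases "psnd n = 0")
          case True
          then have "pfst n = Suc (j - 1)" using False unfolding j_def blk_def by simp
          then have "seg st n = (E3, 0)" unfolding seg_def j_def[symmetric] stj using fstep_E2_Suc by metis
          moreover have "\<rho> (2 * m + 1) = F" using n True 2 by simp
          ultimately show ?thesis unfolding rn ptr_def by (simp add: c_def)
        next
          case False
          then have "pfst n \<le> j - 1" unfolding j_def blk_def by simp
          then have "seg st n = (E2, j - 1 - pfst n)" unfolding seg_def j_def[symmetric] stj by (rule fstep_E2)
          moreover have "\<rho> (2 * m + 1) \<noteq> F" using n False 2 by simp
          ultimately show ?thesis unfolding rn ptr_def by (simp add: c_def)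
        qed
      qed
    next
      case 3
      then show ?thesis unfolding r_def ptr_def by simp
    qed
  qed
  have "r 0 = (Init, 0)" unfolding r_def by (simp add: seg_def blk_def st_def)
  then have "round_run (ptr F B s0) Init \<rho> r" unfolding round_run_def using step by blast
  moreover have "\<exists>\<^sub>\<infinity>i. fst (r i) \<in> pacc B G"
    unfolding INFM_nat_le
  proof
    fix m
    show "\<exists>i\<ge>m. fst (r i) \<in> pacc B G"
      by (intro exI[of _ "Suc (m + n)"]) (simp add: r_def pacc_def pstates_def)
  qed
  ultimately show ?thesis by blast
qed

lemma mem_game_lang_iff:
  assumes "\<And>t. t \<in> B \<Longrightarrow> cop_arg (t_op t) > 0" "\<rho> \<in> omega_words (insert F X)"
  shows "\<rho> \<in> game_lang F X B s0 G \<longleftrightarrow> \<not> proper F \<rho> \<or> brun F B s0 G \<rho>"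
  using assms(2) improper_accept[of F \<rho> B s0 G] proper_accept_iff[of F \<rho> B s0 G, OF _ assms(1)]
  unfolding game_lang_def by blast

section \<open>The register machine in the block game\<close>

text \<open>Steps carry their index because it bounds the counter values that fit: step
  \<open>i\<close> has a first block of 2 i + 2 letters.\<close>

inductive timed :: "(nat \<Rightarrow> 'c \<Rightarrow> 'c \<Rightarrow> bool) \<Rightarrow> nat \<Rightarrow> nat \<Rightarrow> 'c \<Rightarrow> 'c \<Rightarrow> bool" for R where
  timed_refl: "timed R a a x x"
| timed_step: "timed R a b x y \<Longrightarrow> R b y z \<Longrightarrow> timed R a (Suc b) x z"

lemma timed_trans: "timed R b c y z \<Longrightarrow> timed R a b x y \<Longrightarrow> timed R a c x z"
  by (induction rule: timed.induct) (auto intro: timed_step)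

lemma timed_le: "timed R a b x y \<Longrightarrow> a \<le> b"
  by (induction rule: timed.induct) auto

lemma timed_fun: "timed R a b x y \<Longrightarrow> \<exists>r. r a = x \<and> r b = y \<and> (\<forall>i. a \<le> i \<and> i < b \<longrightarrow> R i (r i) (r (Suc i)))"
proof (induction rule: timed.induct)
  case (timed_step a b x y z)
  then obtain r where r: "r a = x" "r b = y" "\<And>i. a \<le> i \<and> i < b \<Longrightarrow> R i (r i) (r (Suc i))" by blast
  have "a \<le> b" using timed_step(1) by (rule timed_le)
  then show ?case using r timed_step(2)
    by (intro exI[of _ "r(Suc b := z)"]) (auto simp: less_Suc_eq)
qed auto

lemma timed_concat:
  assumes h: "strict_mono h" "h 0 = 0" and seg: "\<And>n. timed R (h n) (h (Suc n)) (z n) (z (Suc n))"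
  obtains r where "\<And>i. R i (r i) (r (Suc i))" "\<And>n. r (h n) = z n"
proof -
  have "\<forall>n. \<exists>r. r (h n) = z n \<and> r (h (Suc n)) = z (Suc n) \<and> (\<forall>i. h n \<le> i \<and> i < h (Suc n) \<longrightarrow> R i (r i) (r (Suc i)))"
    using timed_fun[OF seg] by blast
  then obtain rr where rr: "\<And>n. rr n (h n) = z n" "\<And>n. rr n (h (Suc n)) = z (Suc n)"
    "\<And>n i. h n \<le> i \<and> i < h (Suc n) \<Longrightarrow> R i (rr n i) (rr n (Suc i))"
    by metis
  define idx where "idx i = (GREATEST n. h n \<le> i)" for i
  have idx: "idx i = n" if "h n \<le> i" "i < h (Suc n)" for i n
    unfolding idx_def
  proof (rule Greatest_equality)
    show "y \<le> n" if "h y \<le> i" for y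
      using that \<open>i < h (Suc n)\<close> h(1) by (metis not_less_eq_eq order_le_less_trans order_less_irrefl strict_mono_less_eq)
  qed (rule that)
  have ex: "\<exists>n. h n \<le> i \<and> i < h (Suc n)" for i
  proof (induction i)
    case 0
    have "h 0 < h (Suc 0)" using h(1) by (simp add: strict_mono_Suc_iff)
    then show ?case using h(2) by (intro exI[of _ 0]) simp
  next
    case (Suc i)
    then obtain n where n: "h n \<le> i" "i < h (Suc n)" by blast
    have "h (Suc n) < h (Suc (Suc n))" using h(1) by (simp add: strict_mono_Suc_iff)
    then show ?case using n
      by (cases "Suc i < h (Suc n)") (auto intro: exI[of _ n] exI[of _ "Suc n"])
  qed
  define r where "r i = rr (idx i) i" for i
  have rh: "r (h n) = z n" for n
  proof -
    have "h n < h (Suc n)" using h(1) by (simp add: strict_mono_Suc_iff)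
    then show ?thesis unfolding r_def using idx[of n "h n"] rr(1) by simp
  qed
  moreover have "R i (r i) (r (Suc i))" for i
  proof -
    obtain n where n: "h n \<le> i" "i < h (Suc n)" using ex by blast
    have "r (Suc i) = rr n (Suc i)"
    proof (cases "Suc i < h (Suc n)")
      case True
      then show ?thesis using idx[of n "Suc i"] n unfolding r_def by simp
    next
      case False
      then have "Suc i = h (Suc n)" using n by simp
      then show ?thesis using rh[of "Suc n"] rr(2)[of n] by simp
    qed
    then show ?thesis using rr(3)[of n i] idx[OF n] n unfolding r_def by simp
  qed
  ultimately show thesis using that by blast
qed

lemma strict_mono_range_unique:
  fixes f g :: "nat \<Rightarrow> nat"
  assumes f: "strict_mono f" and g: "strict_mono g" and eq: "range f = range g"
  shows "f = g"
proof
  fix n show "f n = g n"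
  proof (induction n rule: less_induct)
    case (less n)
    obtain m where m: "f n = g m" using eq by blast
    obtain k where k: "g n = f k" using eq by (metis rangeE rangeI)
    have "\<not> m < n" using less[of m] m strict_mono_eq[OF f, of m n] by auto
    moreover have "\<not> k < n" using less[of k] k strict_mono_eq[OF g, of k n] by auto
    ultimately have "g n \<le> f n" "f n \<le> g n"
      using m k strict_mono_less_eq[OF f, of n k] strict_mono_less_eq[OF g, of n m] by auto
    then show ?case by simp
  qed
qed

lemma enumerate_range:
  assumes "strict_mono (g :: nat \<Rightarrow> nat)"
  shows "enumerate (range g) = g"
proof -
  have "infinite (range g)" using assms by (simp add: range_inj_infinite strict_mono_imp_inj_on)
  then show ?thesis
    by (intro strict_mono_range_unique strict_mono_enumerate range_enumerate assms)
qed

definition bstep :: "nat \<Rightarrow> 's btrans set \<Rightarrow> nat word \<Rightarrow> nat word \<Rightarrow> nat \<Rightarrow> 's \<times> nat \<Rightarrow> 's \<times> nat \<Rightarrow> bool" where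
  "bstep F B ep ey i x x' \<longleftrightarrow> (\<exists>t\<in>B. t_src t = fst x \<and> t_dst t = fst x' \<and> rate (t_op t) * snd x \<le> 2 * i + 2 \<and>
     cop_rel (t_op t) (snd x) (snd x') \<and> evm F t (ep i) (ey i))"

definition sepround :: "nat \<Rightarrow> nat" where "sepround i = pair (2 * i + 3) 0"

lemma brun_iff:
  "brun F B s0 G \<rho> \<longleftrightarrow> (\<exists>r. r 0 = (s0, 1) \<and>
     (\<forall>i. bstep F B (\<lambda>i. \<rho> (2 * sepround i)) (\<lambda>i. \<rho> (2 * sepround i + 1)) i (r i) (r (Suc i))) \<and>
     (\<exists>\<^sub>\<infinity>i. fst (r i) \<in> G))" (is "?L \<longleftrightarrow> ?R")
proof
  assume ?L
  then obtain t c where t: "t_src (t 0) = s0 \<and> c 0 = 1" "\<forall>i. t i \<in> B \<and> t_dst (t i) = t_src (t (Suc i)) \<and>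
      rate (t_op (t i)) * c i \<le> 2 * i + 2 \<and> cop_rel (t_op (t i)) (c i) (c (Suc i)) \<and>
      evm F (t i) (\<rho> (2 * pair (2 * i + 3) 0)) (\<rho> (2 * pair (2 * i + 3) 0 + 1))"
      "\<exists>\<^sub>\<infinity>i. t_src (t i) \<in> G" unfolding brun_def by blast
  then show ?R unfolding bstep_def sepround_def
    by (intro exI[of _ "\<lambda>i. (t_src (t i), c i)"] conjI allI bexI[of _ "t i" for i]) auto
next
  assume ?R
  then obtain r where r: "r 0 = (s0, 1)"
     "\<And>i. bstep F B (\<lambda>i. \<rho> (2 * sepround i)) (\<lambda>i. \<rho> (2 * sepround i + 1)) i (r i) (r (Suc i))"
     "\<exists>\<^sub>\<infinity>i. fst (r i) \<in> G" by blast
  from r(2) have "\<forall>i. \<exists>t. t \<in> B \<and> t_src t = fst (r i) \<and> t_dst t = fst (r (Suc i)) \<and> rate (t_op t) * snd (r i) \<le> 2 * i + 2 \<and>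
     cop_rel (t_op t) (snd (r i)) (snd (r (Suc i))) \<and> evm F t (\<rho> (2 * sepround i)) (\<rho> (2 * sepround i + 1))"
    unfolding bstep_def by blast
  from choice[OF this] obtain t where t: "\<And>i. t i \<in> B \<and> t_src (t i) = fst (r i) \<and> t_dst (t i) = fst (r (Suc i)) \<and> rate (t_op (t i)) * snd (r i) \<le> 2 * i + 2 \<and>
     cop_rel (t_op (t i)) (snd (r i)) (snd (r (Suc i))) \<and> evm F (t i) (\<rho> (2 * sepround i)) (\<rho> (2 * sepround i + 1))"
    by blast
  show ?L unfolding brun_def
    by (rule exI[of _ t], rule exI[of _ "\<lambda>i. snd (r i)"]) (use r t in \<open>simp add: sepround_def\<close>)
qed

text \<open>
  The machine waits in \<open>W\<close> for the moves \<open>x\<close> and \<open>y\<close>, guesses whether the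
  next state of the normal form is accepting (\<open>f\<close>), and verifies the guess in the states
  \<open>Ns\<close>. It cannot idle in \<open>Gs\<close>, so these states recur only if the moves do.
\<close>

datatype bst = W | Gs nat nat bool | Ns nat nat bool nat

definition code :: "nat \<Rightarrow> nat" where "code S = nprime 0 ^ S"

definition go_rounds :: "nat \<Rightarrow> nat word \<Rightarrow> nat set" where
  "go_rounds F ep = {i. ep i \<noteq> F}"

text \<open>The play of the original game inside the block game, where \<open>ep\<close> and
  \<open>ey\<close> list the letters of the two players at the separators that end a step.\<close>

definition moves :: "nat \<Rightarrow> nat word \<Rightarrow> nat word \<Rightarrow> nat word" where
  "moves F ep ey m = (if even m then ep else ey) (enumerate (go_rounds F ep) (m div 2))"

locale round_machine =
  fixes step acc :: "nat list \<Rightarrow> nat" and X :: "nat set" and F :: nat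
    and T :: "nat \<Rightarrow> nat \<Rightarrow> bool \<Rightarrow> (nat \<times> cop \<times> nat) set"
  assumes F: "F \<notin> X" and finX: "finite X"
    and T_fin: "finite (T x y f)" and T_pos: "(q, I, q') \<in> T x y f \<Longrightarrow> cop_arg I > 0"
    and T: "((0, code S), (1, c)) \<in> (cstep (T x y f))\<^sup>* \<longleftrightarrow>
       (\<exists>b\<in>{0, 1}. c = code (step [S, b, x, y]) \<and> (f \<longleftrightarrow> acc [step [S, b, x, y]] = 0))"
begin

text \<open>\<open>Mul 1\<close> leaves the counter alone. The loop at \<open>W\<close> lets Player
  1 postpone her next move; the loop at \<open>Ns x y f 0\<close> lets a program wait until the
  blocks are long enough for its intermediate values.\<close>

definition btr :: "bst btrans set" where
  "btr = {(W, Mul 1, None, W)} \<union>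
     (\<Union>x\<in>X. \<Union>y\<in>X. \<Union>f. {(W, Mul 1, Some (x, y), Gs x y f), (Gs x y f, Mul 1, None, Ns x y f 0),
        (Ns x y f 0, Mul 1, None, Ns x y f 0), (Ns x y f 1, Mul 1, None, W)} \<union>
        (\<lambda>(q, I, q'). (Ns x y f q, I, None, Ns x y f q')) ` T x y f)"

definition bfin :: "bst set" where "bfin = {Gs x y True |x y. True}"

lemma btr_fin: "finite btr"
  unfolding btr_def using finX T_fin by auto

lemma btr_pos: "t \<in> btr \<Longrightarrow> cop_arg (t_op t) > 0"
  unfolding btr_def using T_pos by auto

lemma btrI:
  "(W, Mul 1, None, W) \<in> btr"
  "x \<in> X \<Longrightarrow> y \<in> X \<Longrightarrow> (W, Mul 1, Some (x, y), Gs x y f) \<in> btr"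
  "x \<in> X \<Longrightarrow> y \<in> X \<Longrightarrow> (Gs x y f, Mul 1, None, Ns x y f 0) \<in> btr"
  "x \<in> X \<Longrightarrow> y \<in> X \<Longrightarrow> (Ns x y f 0, Mul 1, None, Ns x y f 0) \<in> btr"
  "x \<in> X \<Longrightarrow> y \<in> X \<Longrightarrow> (Ns x y f 1, Mul 1, None, W) \<in> btr"
  "x \<in> X \<Longrightarrow> y \<in> X \<Longrightarrow> (q, I, q') \<in> T x y f \<Longrightarrow> (Ns x y f q, I, None, Ns x y f q') \<in> btr"
  unfolding btr_def by (blast, blast, blast, blast, blast, force)

lemma btrE:
  assumes "t \<in> btr"
  obtains "t = (W, Mul 1, None, W)"
  | x y f where "x \<in> X" "y \<in> X" "t = (W, Mul 1, Some (x, y), Gs x y f)"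
  | x y f where "x \<in> X" "y \<in> X" "t = (Gs x y f, Mul 1, None, Ns x y f 0)"
  | x y f where "x \<in> X" "y \<in> X" "t = (Ns x y f 0, Mul 1, None, Ns x y f 0)"
  | x y f where "x \<in> X" "y \<in> X" "t = (Ns x y f 1, Mul 1, None, W)"
  | x y f q I q' where "x \<in> X" "y \<in> X" "(q, I, q') \<in> T x y f" "t = (Ns x y f q, I, None, Ns x y f q')"
  using assms unfolding btr_def by auto

abbreviation bs where "bs \<equiv> bstep F btr"

lemma code_0 [simp]: "code 0 = 1"
  by (simp add: code_def)

lemma code_inj: "code S = code S' \<longleftrightarrow> S = S'"
  unfolding code_def using prime_gt_1_nat[OF prime_nprime[of 0]] by (simp add: power_inject_exp)

lemma bs_go:
  assumes "bs ep ey i (s, c) x" "ep i \<noteq> F"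
  shows "s = W \<and> ep i \<in> X \<and> ey i \<in> X \<and> (\<exists>f. x = (Gs (ep i) (ey i) f, c))"
proof -
  obtain t where t: "t \<in> btr" "t_src t = s" "t_dst t = fst x" "cop_rel (t_op t) c (snd x)" "evm F t (ep i) (ey i)"
    using assms(1) unfolding bstep_def by auto
  from t(1) show ?thesis
    by (cases rule: btrE) (use t assms(2) in \<open>cases x; auto simp: evm_def\<close>)+
qed

lemma bs_nogo:
  assumes "bs ep ey i (s, c) x" "ep i = F"
  shows "(s = W \<and> x = (W, c)) \<or> (\<exists>x' y f. s = Gs x' y f \<and> x = (Ns x' y f 0, c)) \<or>
    (\<exists>x' y f q q' c'. s = Ns x' y f q \<and> x = (Ns x' y f q', c') \<and> ((q, c), (q', c')) \<in> (cstep (T x' y f))\<^sup>*) \<or>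
    (\<exists>x' y f. s = Ns x' y f 1 \<and> x = (W, c))"
proof -
  obtain t where t: "t \<in> btr" "t_src t = s" "t_dst t = fst x" "cop_rel (t_op t) c (snd x)" "evm F t (ep i) (ey i)"
    using assms(1) unfolding bstep_def by auto
  from t(1) show ?thesis
  proof (cases rule: btrE)
    case (2 x y f)
    then show ?thesis using t assms(2) F by (auto simp: evm_def)
  next
    case (6 x' y f q I q')
    then have "((q, c), (q', snd x)) \<in> cstep (T x' y f)" using t unfolding cstep_def by auto
    then show ?thesis using t 6 by (cases x) auto
  qed (use t in \<open>cases x; auto\<close>)+
qed

text \<open>A move of Player 1 can be processed only in \<open>W\<close>, so between two moves a
  program has run from entry to exit, which verifies the guess \<open>f\<close>. A state in
  \<open>bfin\<close> can be entered only by a move, so acceptance implies infinitely many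
  moves.\<close>

lemma sound:
  assumes r0: "r 0 = (W, 1)" and r: "\<And>i. bs ep ey i (r i) (r (Suc i))" and fin: "\<exists>\<^sub>\<infinity>i. fst (r i) \<in> bfin"
  shows "infinite (go_rounds F ep)" and "moves F ep ey \<in> omega_words X"
    and "\<exists>\<tau>\<in>omega_words {0, 1}. \<exists>\<^sub>\<infinity>m. acc [state_seq step \<tau> (moves F ep ey) (Suc m)] = 0"
proof -
  have G_go: "ep i \<noteq> F" if "fst (r (Suc i)) \<in> bfin" for i
    using bs_nogo[of ep ey i "fst (r i)" "snd (r i)" "r (Suc i)"] r[of i] that unfolding bfin_def by auto
  have inf_go: "\<exists>i\<ge>m. ep i \<noteq> F \<and> fst (r (Suc i)) \<in> bfin" for m
  proof -
    obtain i where i: "i \<ge> Suc m" "fst (r i) \<in> bfin" using fin unfolding INFM_nat_le by blast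
    then obtain i' where "i = Suc i'" by (cases i) auto
    then show ?thesis using i G_go by (intro exI[of _ i']) auto
  qed
  then have "\<exists>i\<ge>m. i \<in> go_rounds F ep" for m unfolding go_rounds_def by blast
  then show inf: "infinite (go_rounds F ep)" by (metis infinite_nat_iff_unbounded_le)
  define g where "g = enumerate (go_rounds F ep)"
  have g: "ep (g n) \<noteq> F" for n using enumerate_in_set[OF inf] unfolding g_def go_rounds_def by blast
  have gmono: "strict_mono g" unfolding g_def by (rule strict_mono_enumerate[OF inf])
  have grange: "\<exists>n. i = g n" if "ep i \<noteq> F" for i
    using range_enumerate[OF inf] that unfolding g_def go_rounds_def by blast
  have gap: "ep i = F" if "g n < i" "i < g (Suc n)" for i n
    using grange[of i] that gmono by (metis less_antisym not_less_eq strict_mono_less)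
  have gap0: "ep i = F" if "i < g 0" for i
    using grange[of i] that gmono by (metis not_less_zero strict_mono_less)
  have go: "fst (r (g n)) = W \<and> ep (g n) \<in> X \<and> ey (g n) \<in> X \<and> (\<exists>f. r (Suc (g n)) = (Gs (ep (g n)) (ey (g n)) f, snd (r (g n))))" for n
    using bs_go[of ep ey "g n" "fst (r (g n))" "snd (r (g n))"] r[of "g n"] g[of n] by simp
  then obtain f where f: "\<And>n. r (Suc (g n)) = (Gs (ep (g n)) (ey (g n)) (f n), snd (r (g n)))" by metis
  have mv: "moves F ep ey (2 * n) = ep (g n)" "moves F ep ey (2 * n + 1) = ey (g n)" for n
    unfolding moves_def g_def by simp_all
  show "moves F ep ey \<in> omega_words X"
    unfolding omega_words_def using go unfolding moves_def g_def[symmetric] by auto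
  have first: "i \<le> g 0 \<Longrightarrow> r i = (W, 1)" for i
  proof (induction i)
    case (Suc i)
    then show ?case using r[of i] bs_nogo[of ep ey i W 1 "r (Suc i)"] gap0[of i] by simp
  qed (use r0 in simp)
  have round: "\<exists>b\<in>{0, 1}. r (g (Suc n)) = (W, code (step [S, b, ep (g n), ey (g n)])) \<and>
      (f n \<longleftrightarrow> acc [step [S, b, ep (g n), ey (g n)]] = 0)"
    if S: "r (g n) = (W, code S)" for n S
  proof -
    let ?x = "ep (g n)" and ?y = "ey (g n)"
    have inv: "(r i = (Gs ?x ?y (f n), code S)) \<or>
        (\<exists>q c. r i = (Ns ?x ?y (f n) q, c) \<and> ((0, code S), (q, c)) \<in> (cstep (T ?x ?y (f n)))\<^sup>*) \<or>
        (\<exists>c. r i = (W, c) \<and> ((0, code S), (1, c)) \<in> (cstep (T ?x ?y (f n)))\<^sup>*)"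
      if "Suc (g n) \<le> i" "i \<le> g (Suc n)" for i
      using that
    proof (induction rule: dec_induct)
      case base
      then show ?case using f[of n] S by simp
    next
      case (step i)
      have "ep i = F" using gap[of n i] step by simp
      then show ?case
        using step.IH step.prems bs_nogo[of ep ey i "fst (r i)" "snd (r i)" "r (Suc i)"] r[of i]
        by (auto intro: rtrancl_trans)
    qed
    have "g n < g (Suc n)" using gmono by (simp add: strict_mono_Suc_iff)
    then have "\<exists>c. r (g (Suc n)) = (W, c) \<and> ((0, code S), (1, c)) \<in> (cstep (T ?x ?y (f n)))\<^sup>*"
      using inv[of "g (Suc n)"] go[of "Suc n"] by auto
    then show ?thesis unfolding T by auto
  qed
  have "\<exists>S. r (g n) = (W, code S)" for n
  proof (induction n)
    case 0
    then show ?case using first[of "g 0"] by (intro exI[of _ 0]) simp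
  next
    case (Suc n)
    then show ?case using round by blast
  qed
  then obtain S where S: "\<And>n. r (g n) = (W, code (S n))" by metis
  have "code (S 0) = code 0" using S[of 0] first[of "g 0"] by simp
  then have S0: "S 0 = 0" unfolding code_inj .
  have "\<forall>n. \<exists>b. b \<in> {0, 1} \<and> S (Suc n) = step [S n, b, ep (g n), ey (g n)] \<and> (f n \<longleftrightarrow> acc [S (Suc n)] = 0)"
  proof
    fix n
    obtain b where b: "b \<in> {0, 1}" "r (g (Suc n)) = (W, code (step [S n, b, ep (g n), ey (g n)]))"
      "f n \<longleftrightarrow> acc [step [S n, b, ep (g n), ey (g n)]] = 0" using round[OF S[of n]] by (elim bexE conjE) (rule that; assumption)
    have "code (S (Suc n)) = code (step [S n, b, ep (g n), ey (g n)])" using S[of "Suc n"] b(2) by simp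
    then have "S (Suc n) = step [S n, b, ep (g n), ey (g n)]" unfolding code_inj .
    then show "\<exists>b. b \<in> {0, 1} \<and> S (Suc n) = step [S n, b, ep (g n), ey (g n)] \<and> (f n \<longleftrightarrow> acc [S (Suc n)] = 0)"
      using b by (intro exI[of _ b]) simp
  qed
  from choice[OF this] obtain \<tau> where \<tau>: "\<And>n. \<tau> n \<in> {0, 1}"
     "\<And>n. S (Suc n) = step [S n, \<tau> n, ep (g n), ey (g n)]" "\<And>n. f n \<longleftrightarrow> acc [S (Suc n)] = 0" by blast
  have "state_seq step \<tau> (moves F ep ey) n = S n" for n
  proof (induction n)
    case (Suc n)
    then show ?case using \<tau>(2)[of n] mv[of n] by simp
  qed (simp add: S0)
  moreover have "\<exists>\<^sub>\<infinity>n. acc [S (Suc n)] = 0"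
    unfolding INFM_nat_le
  proof
    fix m
    obtain i where i: "i \<ge> g m" "ep i \<noteq> F" "fst (r (Suc i)) \<in> bfin" using inf_go by blast
    obtain n where n: "i = g n" using grange[OF i(2)] by blast
    then have "m \<le> n" using i(1) gmono by (simp add: strict_mono_less_eq)
    moreover have "f n" using i(3) f[of n] unfolding n bfin_def by simp
    ultimately show "\<exists>n\<ge>m. acc [S (Suc n)] = 0" using \<tau>(3) by blast
  qed
  moreover have "\<tau> \<in> omega_words {0, 1}" using \<tau>(1) unfolding omega_words_def by blast
  ultimately show "\<exists>\<tau>\<in>omega_words {0, 1}. \<exists>\<^sub>\<infinity>m. acc [state_seq step \<tau> (moves F ep ey) (Suc m)] = 0"
    by (intro bexI[of _ \<tau>]) (simp_all del: state_seq.simps)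
qed

section \<open>Completeness: fitting the computations into the blocks\<close>

lemma bs_Nop:
  assumes "(s, Mul 1, e, s') \<in> btr" "c \<le> 2 * i + 2" "case e of None \<Rightarrow> ep i = F | Some xy \<Rightarrow> xy = (ep i, ey i)"
  shows "bs ep ey i (s, c) (s', c)"
  unfolding bstep_def using assms by (intro bexI[OF _ assms(1)]) (auto simp: evm_def)

lemma timed_idle:
  assumes "(s, Mul 1, None, s) \<in> btr" "c \<le> 2 * a + 2" "a \<le> b" "\<And>i. a \<le> i \<Longrightarrow> i < b \<Longrightarrow> ep i = F"
  shows "timed (bs ep ey) a b (s, c) (s, c)"
  using assms(3,4)
proof (induction rule: dec_induct)
  case (step n)
  then show ?case using assms(1,2) by (intro timed_step[OF step.IH] bs_Nop) auto
qed (rule timed_refl)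

text \<open>A path meets only finitely many counter values, so one threshold \<open>N\<close> makes
  room for all its operations. As the blocks keep growing, the path can also be run at any later
  time.\<close>

lemma timed_path:
  assumes "((q, c), (q', c')) \<in> (cstep (T x y f))\<^sup>*" "x \<in> X" "y \<in> X"
  shows "\<exists>N L. \<forall>ep ey a. N \<le> a \<longrightarrow> (\<forall>i. a \<le> i \<and> i < a + L \<longrightarrow> ep i = F) \<longrightarrow>
    timed (bs ep ey) a (a + L) (Ns x y f q, c) (Ns x y f q', c')"
  using assms(1)
proof (induction rule: rtrancl_induct2)
  case refl
  then show ?case by (intro exI[of _ 0]) (simp add: timed_refl)
next
  case (step p d p' d')
  then obtain N L where NL: "\<And>ep ey a. N \<le> a \<Longrightarrow> (\<forall>i. a \<le> i \<and> i < a + L \<longrightarrow> ep i = F) \<Longrightarrow>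
    timed (bs ep ey) a (a + L) (Ns x y f q, c) (Ns x y f p, d)" by blast
  obtain I where I: "(p, I, p') \<in> T x y f" "cop_rel I d d'" using step(2) unfolding cstep_def by auto
  have "timed (bs ep ey) a (a + Suc L) (Ns x y f q, c) (Ns x y f p', d')"
    if a: "N + rate I * d \<le> a" "\<forall>i. a \<le> i \<and> i < a + Suc L \<longrightarrow> ep i = F" for ep ey a
  proof -
    have "bs ep ey (a + L) (Ns x y f p, d) (Ns x y f p', d')"
      unfolding bstep_def by (rule bexI[OF _ btrI(6)[OF assms(2,3) I(1)]]) (use I(2) a in \<open>auto simp: evm_def\<close>)
    then show ?thesis using timed_step[OF NL[of a ep ey]] a by simp
  qed
  then show ?case by blast
qed

lemma timed_round:
  assumes "x \<in> X" "y \<in> X" "b \<in> {0, 1}"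
  shows "\<exists>N. \<forall>ep ey a a'. code S \<le> 2 * a + 2 \<longrightarrow> a + N \<le> a' \<longrightarrow> (\<forall>i. a < i \<and> i < a' \<longrightarrow> ep i = F) \<longrightarrow>
    code (step [S, b, x, y]) \<le> 2 * a' + 2 \<and>
    timed (bs ep ey) (Suc a) a' (Gs x y (acc [step [S, b, x, y]] = 0), code S) (W, code (step [S, b, x, y]))"
proof -
  let ?f = "acc [step [S, b, x, y]] = 0" and ?S' = "step [S, b, x, y]"
  have "((0, code S), (1, code ?S')) \<in> (cstep (T x y ?f))\<^sup>*"
    unfolding T using assms(3) by blast
  from timed_path[OF this assms(1,2)] obtain N L where NL:
    "\<And>ep ey a. N \<le> a \<Longrightarrow> (\<forall>i. a \<le> i \<and> i < a + L \<longrightarrow> ep i = F) \<Longrightarrow>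
      timed (bs ep ey) a (a + L) (Ns x y ?f 0, code S) (Ns x y ?f 1, code ?S')" by blast
  have "code ?S' \<le> 2 * a' + 2 \<and> timed (bs ep ey) (Suc a) a' (Gs x y ?f, code S) (W, code ?S')"
    if a: "code S \<le> 2 * a + 2" "a + (N + L + code ?S' + 4) \<le> a'" "\<forall>i. a < i \<and> i < a' \<longrightarrow> ep i = F" for ep ey a a'
  proof -
    \<comment> \<open>The time at which the program is started: two steps after the move at
      \<open>a\<close>, late enough for the path (\<open>N\<close>) and for carrying the new value
      afterwards.\<close>
    define u where "u = a + 2 + N + code ?S'"
    have u: "u + L < a'" "a + 2 \<le> u" "N \<le> u" "code ?S' \<le> u" using a(2) unfolding u_def by auto
    have 1: "timed (bs ep ey) (Suc a) (Suc (Suc a)) (Gs x y ?f, code S) (Ns x y ?f 0, code S)"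
      by (rule timed_step[OF timed_refl]) (rule bs_Nop[OF btrI(3)[OF assms(1,2)]], use a u in auto)
    have 2: "timed (bs ep ey) (Suc (Suc a)) u (Ns x y ?f 0, code S) (Ns x y ?f 0, code S)"
      by (rule timed_idle[OF btrI(4)[OF assms(1,2)]]) (use a u in auto)
    have 3: "timed (bs ep ey) u (u + L) (Ns x y ?f 0, code S) (Ns x y ?f 1, code ?S')"
      by (rule NL) (use a u in auto)
    have 4: "timed (bs ep ey) (u + L) (Suc (u + L)) (Ns x y ?f 1, code ?S') (W, code ?S')"
      by (rule timed_step[OF timed_refl]) (rule bs_Nop[OF btrI(5)[OF assms(1,2)]], use a u in auto)
    have 5: "timed (bs ep ey) (Suc (u + L)) a' (W, code ?S') (W, code ?S')"
      by (rule timed_idle[OF btrI(1)]) (use a u in auto)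
    have "timed (bs ep ey) (Suc a) a' (Gs x y ?f, code S) (W, code ?S')"
      by (rule timed_trans[OF 5 timed_trans[OF 4 timed_trans[OF 3 timed_trans[OF 2 1]]]])
    moreover have "code ?S' \<le> 2 * a' + 2" using u by simp
    ultimately show ?thesis by blast
  qed
  then show ?thesis by (intro exI[of _ "N + L + code ?S' + 4"]) blast
qed

definition reachable_states :: "nat \<Rightarrow> nat set" where
  "reachable_states n = {state_seq step \<tau> \<sigma> n |\<tau> \<sigma>. \<tau> \<in> omega_words {0, 1} \<and> \<sigma> \<in> omega_words X}"

lemma finite_reachable: "finite (reachable_states n)"
proof (induction n)
  case 0
  have "reachable_states 0 \<subseteq> {0}" unfolding reachable_states_def by auto
  then show ?case by (rule finite_subset) simp
next
  case (Suc n)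
  have "reachable_states (Suc n) \<subseteq> (\<lambda>(S, b, x, y). step [S, b, x, y]) ` (reachable_states n \<times> {0, 1} \<times> X \<times> X)"
  proof
    fix S assume "S \<in> reachable_states (Suc n)"
    then obtain \<tau> \<sigma> where *: "S = state_seq step \<tau> \<sigma> (Suc n)" "\<tau> \<in> omega_words {0, 1}" "\<sigma> \<in> omega_words X"
      unfolding reachable_states_def by blast
    then have "\<tau> n \<in> {0, 1}" "\<sigma> (2 * n) \<in> X" "\<sigma> (2 * n + 1) \<in> X" "state_seq step \<tau> \<sigma> n \<in> reachable_states n"
      unfolding reachable_states_def omega_words_def by blast+
    then show "S \<in> (\<lambda>(S, b, x, y). step [S, b, x, y]) ` (reachable_states n \<times> {0, 1} \<times> X \<times> X)"
      using *(1) by (intro image_eqI[of _ _ "(state_seq step \<tau> \<sigma> n, \<tau> n, \<sigma> (2 * n), \<sigma> (2 * n + 1))"]) auto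
  qed
  then show ?case by (rule finite_subset) (use Suc finX in auto)
qed

text \<open>One schedule \<open>g\<close> has to serve all plays and all witnesses, since the times
  of the moves are fixed without knowing the answers of Player 2 or the bits that the machine will
  guess.\<close>

lemma complete:
  obtains g :: "nat \<Rightarrow> nat" where "strict_mono g"
    "\<And>ep ey \<tau>. go_rounds F ep = range g \<Longrightarrow> moves F ep ey \<in> omega_words X \<Longrightarrow> \<tau> \<in> omega_words {0, 1} \<Longrightarrow>
       \<exists>\<^sub>\<infinity>m. acc [state_seq step \<tau> (moves F ep ey) (Suc m)] = 0 \<Longrightarrow>
       \<exists>r. r 0 = (W, 1) \<and> (\<forall>i. bs ep ey i (r i) (r (Suc i))) \<and> (\<exists>\<^sub>\<infinity>i. fst (r i) \<in> bfin)"
proof -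
  define P where "P N S b x y \<longleftrightarrow>
    (\<forall>ep ey a a'. code S \<le> 2 * a + 2 \<longrightarrow> a + N \<le> a' \<longrightarrow> (\<forall>i. a < i \<and> i < a' \<longrightarrow> ep i = F) \<longrightarrow>
    code (step [S, b, x, y]) \<le> 2 * a' + 2 \<and>
    timed (bs ep ey) (Suc a) a' (Gs x y (acc [step [S, b, x, y]] = 0), code S) (W, code (step [S, b, x, y])))"
    for N S b x y
  have "\<exists>N. P N S b x y" if "x \<in> X" "y \<in> X" "b \<in> {0, 1}" for S b x y
    unfolding P_def by (rule timed_round[OF that])
  then have "\<forall>z. \<exists>N. case z of (S, b, x, y) \<Rightarrow> x \<in> X \<and> y \<in> X \<and> b \<in> {0, 1} \<longrightarrow> P N S b x y"
    by simp
  from choice[OF this] obtain N where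
    "\<forall>z. case z of (S, b, x, y) \<Rightarrow> x \<in> X \<and> y \<in> X \<and> b \<in> {0, 1} \<longrightarrow> P (N z) S b x y" ..
  then have NP: "P (N (S, b, x, y)) S b x y" if "x \<in> X" "y \<in> X" "b \<in> {0, 1}" for S b x y
    using that by simp
  note N = NP[unfolded P_def, rule_format]
  \<comment> \<open>Only finitely many machine states occur after \<open>n\<close> moves, so one waiting time serves them all.\<close>
  define Z where "Z n = reachable_states n \<times> {0, 1::nat} \<times> X \<times> X" for n
  have Zfin: "finite (Z n)" for n unfolding Z_def using finite_reachable finX by simp
  define M where "M n = Max (insert 0 (N ` Z n))" for n
  have M: "N z \<le> M n" if "z \<in> Z n" for z n
    unfolding M_def using that Zfin by (intro Max_ge) auto
  define g where "g = rec_nat 0 (\<lambda>n k. Suc (k + M n))"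
  have g: "g 0 = 0" "g (Suc n) = Suc (g n + M n)" for n unfolding g_def by simp_all
  have gmono: "strict_mono g" unfolding strict_mono_Suc_iff g by simp
  have "\<exists>r. r 0 = (W, 1) \<and> (\<forall>i. bs ep ey i (r i) (r (Suc i))) \<and> (\<exists>\<^sub>\<infinity>i. fst (r i) \<in> bfin)"
    if range: "go_rounds F ep = range g" and X: "moves F ep ey \<in> omega_words X" and \<tau>: "\<tau> \<in> omega_words {0, 1}"
      and acc: "\<exists>\<^sub>\<infinity>m. acc [state_seq step \<tau> (moves F ep ey) (Suc m)] = 0" for ep ey \<tau>
  proof -
    define \<sigma> where "\<sigma> = moves F ep ey"
    have "enumerate (go_rounds F ep) = g"
      unfolding range by (rule enumerate_range[OF gmono])
    then have mv: "\<sigma> (2 * n) = ep (g n)" "\<sigma> (2 * n + 1) = ey (g n)" for n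
      unfolding \<sigma>_def moves_def by simp_all
    have inX: "ep (g n) \<in> X" "ey (g n) \<in> X" for n
      using X mv[of n] unfolding \<sigma>_def[symmetric] omega_words_def by (metis PiE UNIV_I)+
    have gap: "\<forall>i. g n < i \<and> i < g (Suc n) \<longrightarrow> ep i = F" for n
    proof (intro allI impI)
      fix i assume i: "g n < i \<and> i < g (Suc n)"
      then have "i \<notin> range g" using gmono by (metis imageE less_antisym not_less_eq strict_mono_less)
      then show "ep i = F" using range unfolding go_rounds_def by blast
    qed
    define S where "S = state_seq step \<tau> \<sigma>"
    have S: "S 0 = 0" "S (Suc n) = step [S n, \<tau> n, ep (g n), ey (g n)]" for n
      unfolding S_def using mv[of n] by simp_all
    have \<tau>01: "\<tau> n \<in> {0, 1}" for n using \<tau> unfolding omega_words_def by blast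
    have mem: "(S n, \<tau> n, ep (g n), ey (g n)) \<in> Z n" for n
      unfolding Z_def reachable_states_def S_def using \<tau> X inX[of n] \<tau>01[of n] \<sigma>_def by auto
    have round: "code (S n) \<le> 2 * g n + 2 \<Longrightarrow> code (S (Suc n)) \<le> 2 * g (Suc n) + 2 \<and>
      timed (bs ep ey) (Suc (g n)) (g (Suc n)) (Gs (ep (g n)) (ey (g n)) (acc [S (Suc n)] = 0), code (S n)) (W, code (S (Suc n)))" for n
      unfolding S(2) by (rule N[OF inX \<tau>01]) (use gap[of n] M[OF mem[of n]] in \<open>auto simp: g(2)\<close>)
    have room: "code (S n) \<le> 2 * g n + 2" for n
      by (induction n) (use round in \<open>auto simp: S(1)\<close>)
    have event: "bs ep ey (g n) (W, code (S n)) (Gs (ep (g n)) (ey (g n)) f, code (S n))" for n f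
      by (rule bs_Nop[OF btrI(2)[OF inX]]) (use room in auto)
    \<comment> \<open>The times right after the moves. There the machine is in a \<open>Gs\<close>
      state that already carries the correct guess about the next value of \<open>acc\<close>; time
      0 is the initial configuration.\<close>
    define h where "h n = (case n of 0 \<Rightarrow> 0 | Suc m \<Rightarrow> Suc (g m))" for n
    define z where "z n = (case n of 0 \<Rightarrow> (W, 1) | Suc m \<Rightarrow> (Gs (ep (g m)) (ey (g m)) (acc [S (Suc m)] = 0), code (S m)))" for n
    have "timed (bs ep ey) (h n) (h (Suc n)) (z n) (z (Suc n))" for n
    proof (cases n)
      case 0
      then show ?thesis using event[of 0] unfolding h_def z_def
        by (auto simp: g(1) S(1) intro: timed_step[OF timed_refl])
    next
      case (Suc m)
      have "timed (bs ep ey) (Suc (g m)) (Suc (g (Suc m))) (Gs (ep (g m)) (ey (g m)) (acc [S (Suc m)] = 0), code (S m))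
         (Gs (ep (g (Suc m))) (ey (g (Suc m))) (acc [S (Suc (Suc m))] = 0), code (S (Suc m)))"
        using timed_step[OF conjunct2[OF round[OF room]] event] .
      then show ?thesis unfolding h_def z_def Suc by simp
    qed
    moreover have "strict_mono h" unfolding strict_mono_Suc_iff h_def using gmono
      by (auto split: nat.split simp: strict_mono_Suc_iff)
    moreover have "h 0 = 0" by (simp add: h_def)
    ultimately obtain r where r: "\<And>i. bs ep ey i (r i) (r (Suc i))" "\<And>n. r (h n) = z n"
      using timed_concat[of h "bs ep ey" z] by blast
    have "r 0 = (W, 1)" using r(2)[of 0] by (simp add: h_def z_def)
    moreover have "\<exists>\<^sub>\<infinity>i. fst (r i) \<in> bfin"
      unfolding INFM_nat_le
    proof
      fix m
      obtain n where n: "n \<ge> m" "acc [S (Suc n)] = 0" using acc unfolding INFM_nat_le S_def \<sigma>_def by blast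
      have "m \<le> Suc (g n)" using n(1) strict_mono_imp_increasing[OF gmono, of n] by simp
      moreover have "fst (r (Suc (g n))) \<in> bfin" using r(2)[of "Suc n"] n(2) by (simp add: h_def z_def bfin_def)
      ultimately show "\<exists>i\<ge>m. fst (r i) \<in> bfin" by blast
    qed
    ultimately show ?thesis using r(1) by blast
  qed
  then show thesis using that[OF gmono] by blast
qed

end

section \<open>Transfer of winning strategies\<close>

primrec hist :: "(nat list \<Rightarrow> nat) \<Rightarrow> nat \<Rightarrow> nat list" where
  "hist nx 0 = []"
| "hist nx (Suc m) = hist nx m @ [nx (hist nx m)]"

definition play :: "(nat list \<Rightarrow> nat) \<Rightarrow> nat word" where
  "play nx m = nx (hist nx m)"

lemma length_hist [simp]: "length (hist nx m) = m"
  by (induction m) auto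

lemma prefix_play: "prefix m (play nx) = hist nx m"
  by (induction m) (simp_all add: play_def)

lemma nth_hist: "i < m \<Longrightarrow> hist nx m ! i = play nx i"
  unfolding prefix_play[symmetric] by simp

lemma play_in_omega_words:
  assumes "\<And>h. h \<in> lists Y \<Longrightarrow> nx h \<in> Y"
  shows "play nx \<in> omega_words Y"
proof -
  have "hist nx m \<in> lists Y" for m by (induction m) (use assms in auto)
  then show ?thesis unfolding omega_words_def play_def using assms by blast
qed

lemma sepround_mono: "strict_mono sepround"
  unfolding strict_mono_Suc_iff sepround_def pair_def prod_encode_def
  by (simp add: eval_nat_numeral)

lemma sepround_less: "sepround i < sepround j \<longleftrightarrow> i < j"
  using strict_mono_less[OF sepround_mono] .

lemma sepround_eq: "sepround i = sepround j \<longleftrightarrow> i = j"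
  using strict_mono_eq[OF sepround_mono] .

lemma psnd_sepround [simp]: "psnd (sepround i) = 0"
  by (simp add: sepround_def)

lemma card_below_enumerate:
  fixes S :: "nat set"
  assumes "infinite S"
  shows "card {i \<in> S. i < enumerate S n} = n"
proof -
  have "{i \<in> S. i < enumerate S n} = enumerate S ` {..<n}"
  proof
    show "{i \<in> S. i < enumerate S n} \<subseteq> enumerate S ` {..<n}"
    proof
      fix i assume i: "i \<in> {i \<in> S. i < enumerate S n}"
      then obtain k where "i = enumerate S k" using range_enumerate[OF assms] by blast
      then show "i \<in> enumerate S ` {..<n}" using i enumerate_mono_iff[OF assms] by auto
    qed
  qed (use assms enumerate_in_set[OF assms] in \<open>auto intro: enumerate_mono\<close>)
  then show ?thesis by (simp add: card_image inj_on_subset[OF inj_enumerate[OF assms]])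
qed

lemma enumerate_eqI:
  fixes S :: "nat set"
  assumes "infinite S" "i \<in> S" "card {j \<in> S. j < i} = n"
  shows "enumerate S n = i"
proof -
  obtain k where "i = enumerate S k" using range_enumerate[OF assms(1)] assms(2) by blast
  then show ?thesis using card_below_enumerate[OF assms(1), of k] assms(3) by simp
qed

abbreviation sep1 :: "nat word \<Rightarrow> nat word" where "sep1 \<rho> \<equiv> \<lambda>i. \<rho> (2 * sepround i)"
abbreviation sep2 :: "nat word \<Rightarrow> nat word" where "sep2 \<rho> \<equiv> \<lambda>i. \<rho> (2 * sepround i + 1)"

text \<open>The asymmetry reflects who is simulated. A strategy of Player 1 in the block game times
  its moves as it likes, so \<open>sound\<close> covers every timing; against a strategy of Player 2
  the timing is chosen here, so \<open>complete\<close> is needed for the schedule \<open>g\<close>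
  only.\<close>

locale game_transfer =
  fixes X :: "nat set" and F x0 :: nat and A L :: "nat word set" and g :: "nat \<Rightarrow> nat"
  assumes F: "F \<notin> X" and x0: "x0 \<in> X"
    and improper: "\<And>\<rho>. \<rho> \<in> omega_words (insert F X) \<Longrightarrow> \<not> proper F \<rho> \<Longrightarrow> \<rho> \<in> L"
    and sound: "\<And>\<rho>. \<rho> \<in> omega_words (insert F X) \<Longrightarrow> proper F \<rho> \<Longrightarrow> \<rho> \<in> L \<Longrightarrow>
      infinite (go_rounds F (sep1 \<rho>)) \<and> moves F (sep1 \<rho>) (sep2 \<rho>) \<in> A"
    and g: "strict_mono g"
    and complete: "\<And>\<rho>. \<rho> \<in> omega_words (insert F X) \<Longrightarrow> proper F \<rho> \<Longrightarrow> go_rounds F (sep1 \<rho>) = range g \<Longrightarrow>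
      moves F (sep1 \<rho>) (sep2 \<rho>) \<in> A \<Longrightarrow> \<rho> \<in> L"
begin

text \<open>A move counts only once its answer is written too. When Player 2 is about to answer, the
  number of counted moves is thus the index of the current one.\<close>

definition past_goes :: "nat list \<Rightarrow> nat set" where
  "past_goes h = {i. 2 * sepround i + 1 < length h \<and> h ! (2 * sepround i) \<noteq> F}"

lemma finite_past_goes: "finite (past_goes h)"
proof (rule finite_subset)
  show "past_goes h \<subseteq> {..length h}"
    unfolding past_goes_def using strict_mono_imp_increasing[OF sepround_mono] by (fastforce intro: order_trans)
qed simp

lemma past_goes_hist: "past_goes (hist nx m) = {i \<in> go_rounds F (sep1 (play nx)). 2 * sepround i + 1 < m}"
  unfolding past_goes_def go_rounds_def by (auto simp: nth_hist)

text \<open>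
  Player 1 follows \<open>F1\<close>; Player 2 keeps the block structure and answers the \<open>n\<close>-th
  real move with \<open>\<beta> n\<close>.
\<close>

definition next1 :: "(nat list \<Rightarrow> nat) \<Rightarrow> (nat \<Rightarrow> nat) \<Rightarrow> nat list \<Rightarrow> nat" where
  "next1 F1 \<beta> h = (if even (length h) then F1 h
     else if psnd (length h div 2) \<noteq> 0 then F
     else if length h div 2 \<in> range sepround \<and> last h \<noteq> F then \<beta> (card (past_goes h)) else x0)"

text \<open>Player 2 respects the block structure, so this play is won by Player 1 through the
  machine alone. Soundness then forces infinitely many real moves: waiting forever would
  lose.\<close>

lemma next1_play:
  assumes F1: "winning1 (insert F X) L F1" and \<beta>: "\<And>n. \<beta> n \<in> X"
  defines "\<rho> \<equiv> play (next1 F1 \<beta>)"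
  shows "\<rho> \<in> omega_words (insert F X)" "proper F \<rho>" "infinite (go_rounds F (sep1 \<rho>))"
    "moves F (sep1 \<rho>) (sep2 \<rho>) \<in> A" "moves F (sep1 \<rho>) (sep2 \<rho>) (2 * n + 1) = \<beta> n"
proof -
  show om: "\<rho> \<in> omega_words (insert F X)"
    unfolding \<rho>_def
  proof (rule play_in_omega_words)
    fix h assume "h \<in> lists (insert F X)"
    then show "next1 F1 \<beta> h \<in> insert F X"
      using F1 \<beta> x0 unfolding next1_def winning1_def strategy1_def by auto
  qed
  have odd: "\<rho> (2 * k + 1) = (if psnd k \<noteq> 0 then F
     else if k \<in> range sepround \<and> \<rho> (2 * k) \<noteq> F then \<beta> (card (past_goes (hist (next1 F1 \<beta>) (2 * k + 1)))) else x0)" for k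
  proof -
    have "last (hist (next1 F1 \<beta>) (2 * k + 1)) = \<rho> (2 * k)"
      by (simp add: \<rho>_def play_def)
    then show ?thesis unfolding \<rho>_def play_def[of _ "2 * k + 1"] next1_def
      by (simp del: hist.simps)
  qed
  have "\<beta> k \<noteq> F" for k using \<beta>[of k] F by auto
  then show pr: "proper F \<rho>" unfolding proper_def odd using x0 F by auto
  have "follows1 F1 \<rho>" unfolding follows1_def \<rho>_def prefix_play play_def next1_def by simp
  then have "\<rho> \<in> L" using F1 om unfolding winning1_def by blast
  from sound[OF om pr this] show inf: "infinite (go_rounds F (sep1 \<rho>))" and "moves F (sep1 \<rho>) (sep2 \<rho>) \<in> A" by blast+
  define k where "k = enumerate (go_rounds F (sep1 \<rho>)) n"
  have "\<rho> (2 * sepround k) \<noteq> F" using enumerate_in_set[OF inf, of n] unfolding k_def go_rounds_def by simp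
  then have "\<rho> (2 * sepround k + 1) = \<beta> (card (past_goes (hist (next1 F1 \<beta>) (2 * sepround k + 1))))"
    unfolding odd by simp
  also have "past_goes (hist (next1 F1 \<beta>) (2 * sepround k + 1)) = {i \<in> go_rounds F (sep1 \<rho>). i < k}"
    unfolding past_goes_hist \<rho>_def by (simp add: sepround_less)
  also have "card \<dots> = n" unfolding k_def by (rule card_below_enumerate[OF inf])
  finally show "moves F (sep1 \<rho>) (sep2 \<rho>) (2 * n + 1) = \<beta> n" unfolding moves_def k_def by simp
qed

text \<open>\<open>\<beta> k\<close> is consulted only when \<open>k\<close> moves are complete, and
  writing it completes another one. A history with at most \<open>n\<close> complete moves has
  therefore used \<open>\<beta>\<close> below \<open>n\<close> only.\<close>

lemma next1_hist_cong:
  assumes "\<And>k. k < n \<Longrightarrow> \<beta> k = \<beta>' k" "card (past_goes (hist (next1 F1 \<beta>) m)) \<le> n"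
  shows "hist (next1 F1 \<beta>) m = hist (next1 F1 \<beta>') m"
  using assms(2)
proof (induction m)
  case (Suc m)
  let ?h = "hist (next1 F1 \<beta>) m"
  have mono: "past_goes ?h \<subseteq> past_goes (hist (next1 F1 \<beta>) (Suc m))"
    unfolding past_goes_hist by auto
  have "card (past_goes ?h) \<le> card (past_goes (hist (next1 F1 \<beta>) (Suc m)))"
    by (rule card_mono[OF finite_past_goes mono])
  then have IH: "?h = hist (next1 F1 \<beta>') m" using Suc by linarith
  have "next1 F1 \<beta> ?h = next1 F1 \<beta>' ?h"
  proof (cases "odd m \<and> psnd (m div 2) = 0 \<and> m div 2 \<in> range sepround \<and> last ?h \<noteq> F")
    case True
    then obtain i where i: "m = 2 * sepround i + 1" by (metis imageE odd_two_times_div_two_succ)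
    have "last ?h = play (next1 F1 \<beta>) (2 * sepround i)" unfolding i by (simp add: play_def)
    then have "i \<in> past_goes (hist (next1 F1 \<beta>) (Suc m))" "i \<notin> past_goes ?h"
      using True unfolding past_goes_hist go_rounds_def i by auto
    then have "past_goes ?h \<subset> past_goes (hist (next1 F1 \<beta>) (Suc m))" using mono by blast
    then have "card (past_goes ?h) < n"
      using psubset_card_mono[OF finite_past_goes] Suc.prems by (meson order_less_le_trans)
    then show ?thesis unfolding next1_def using assms(1) by simp
  next
    case False
    then show ?thesis unfolding next1_def by auto
  qed
  then show ?case using IH by simp
qed simp

text \<open>Causality: this turns the moves read off from complete block plays into a strategy on
  finite words.\<close>

lemma next1_move_cong:
  assumes F1: "winning1 (insert F X) L F1" and \<beta>: "\<And>n. \<beta> n \<in> X" "\<And>n. \<beta>' n \<in> X"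
    and eq: "\<And>k. k < n \<Longrightarrow> \<beta> k = \<beta>' k"
  shows "moves F (sep1 (play (next1 F1 \<beta>))) (sep2 (play (next1 F1 \<beta>))) (2 * n) =
    moves F (sep1 (play (next1 F1 \<beta>'))) (sep2 (play (next1 F1 \<beta>'))) (2 * n)"
proof -
  let ?\<rho> = "play (next1 F1 \<beta>)" and ?\<rho>' = "play (next1 F1 \<beta>')"
  note inf = next1_play(3)[where \<beta> = \<beta>, OF F1 \<beta>(1)] and inf' = next1_play(3)[where \<beta> = \<beta>', OF F1 \<beta>(2)]
  define i where "i = enumerate (go_rounds F (sep1 ?\<rho>)) n"
  define m where "m = 2 * sepround i + 1"
  have c: "past_goes (hist (next1 F1 \<beta>) m) = {j \<in> go_rounds F (sep1 ?\<rho>). j < i}"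
    and c': "past_goes (hist (next1 F1 \<beta>') m) = {j \<in> go_rounds F (sep1 ?\<rho>'). j < i}"
    unfolding past_goes_hist m_def by (simp_all add: sepround_less)
  have n: "card (past_goes (hist (next1 F1 \<beta>) m)) = n"
    unfolding c i_def by (rule card_below_enumerate[OF inf])
  have h: "hist (next1 F1 \<beta>) m = hist (next1 F1 \<beta>') m"
    by (rule next1_hist_cong[where n = n]) (use eq n in auto)
  have lt: "2 * sepround i < m" by (simp add: m_def)
  have e: "?\<rho> (2 * sepround i) = ?\<rho>' (2 * sepround i)"
    using nth_hist[OF lt, of "next1 F1 \<beta>"] nth_hist[OF lt, of "next1 F1 \<beta>'"] h by simp
  have "i \<in> go_rounds F (sep1 ?\<rho>)" unfolding i_def by (rule enumerate_in_set[OF inf])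
  then have "i \<in> go_rounds F (sep1 ?\<rho>')" using e unfolding go_rounds_def by simp
  then have "enumerate (go_rounds F (sep1 ?\<rho>')) n = i"
    using enumerate_eqI[OF inf'] c' n h by simp
  then show ?thesis using e i_def by (simp add: moves_def)
qed

lemma transfer1:
  assumes F1: "winning1 (insert F X) L F1"
  shows "\<exists>G. winning1 X A G"
proof -
  define mv where "mv \<beta> = moves F (sep1 (play (next1 F1 \<beta>))) (sep2 (play (next1 F1 \<beta>)))" for \<beta>
  \<comment> \<open>\<open>x0\<close> stands in for the answers not yet given; by
    \<open>next1_move_cong\<close> the move that \<open>G\<close> reads off does not look at
    them.\<close>
  define bt where "bt w k = (if 2 * k + 1 < length w then w ! (2 * k + 1) else x0)" for w :: "nat list" and k
  define G where "G w = mv (bt w) (length w)" for w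
  have btX: "bt w k \<in> X" if "w \<in> lists X" for w k
    using that x0 unfolding bt_def by (auto simp: in_lists_conv_set)
  have mvX: "mv \<beta> (2 * n) \<in> X" if "\<And>n. \<beta> n \<in> X" for \<beta> n
  proof -
    let ?\<rho> = "play (next1 F1 \<beta>)"
    have "enumerate (go_rounds F (sep1 ?\<rho>)) n \<in> go_rounds F (sep1 ?\<rho>)"
      by (rule enumerate_in_set[OF next1_play(3)[where \<beta> = \<beta>, OF F1 that]])
    moreover have "?\<rho> i \<in> insert F X" for i
      using next1_play(1)[where \<beta> = \<beta>, OF F1 that] unfolding omega_words_def by blast
    ultimately show ?thesis unfolding mv_def moves_def go_rounds_def by auto
  qed
  have "strategy1 X G"
    unfolding strategy1_def
  proof
    fix w assume w: "w \<in> {w \<in> lists X. even (length w)}"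
    then obtain n where n: "length w = 2 * n" by (auto elim: evenE)
    show "G w \<in> X" unfolding G_def n using mvX[of "bt w"] btX w by blast
  qed
  moreover have "\<sigma> \<in> A" if \<sigma>: "\<sigma> \<in> omega_words X" "follows1 G \<sigma>" for \<sigma>
  proof -
    define \<beta> where "\<beta> n = \<sigma> (2 * n + 1)" for n
    have \<beta>: "\<beta> n \<in> X" for n using \<sigma>(1) unfolding \<beta>_def omega_words_def by blast
    have "mv \<beta> m = \<sigma> m" for m
    proof (cases "even m")
      case True
      then obtain n where m: "m = 2 * n" by (rule evenE)
      have w: "prefix (2 * n) \<sigma> \<in> lists X" by (rule set_prefix_subset[OF \<sigma>(1)])
      have "\<sigma> m = mv (bt (prefix (2 * n) \<sigma>)) (2 * n)"
        using \<sigma>(2) unfolding follows1_def G_def m by simp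
      also have "\<dots> = mv \<beta> (2 * n)"
        unfolding mv_def by (rule next1_move_cong[where \<beta> = "bt (prefix (2 * n) \<sigma>)" and \<beta>' = \<beta>, OF F1 btX[OF w] \<beta>]) (simp add: bt_def \<beta>_def)
      finally show ?thesis using m by simp
    next
      case False
      then obtain n where m: "m = 2 * n + 1" by (rule oddE)
      show ?thesis unfolding m mv_def using next1_play(5)[where \<beta> = \<beta>, OF F1 \<beta>] by (simp add: \<beta>_def)
    qed
    then have "mv \<beta> = \<sigma>" by blast
    then show ?thesis using next1_play(4)[where \<beta> = \<beta>, OF F1 \<beta>] unfolding mv_def by simp
  qed
  ultimately show ?thesis unfolding winning1_def by blast
qed

text \<open>
  Player 2 follows \<open>F2\<close>; Player 1 makes the \<open>n\<close>-th real move \<open>\<alpha> n\<close> in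
  the step \<open>g n\<close>.
\<close>

definition next2 :: "(nat list \<Rightarrow> nat) \<Rightarrow> (nat \<Rightarrow> nat) \<Rightarrow> nat list \<Rightarrow> nat" where
  "next2 F2 \<alpha> h = (if odd (length h) then F2 h
     else if length h div 2 \<in> range (sepround \<circ> g) then \<alpha> (inv (sepround \<circ> g) (length h div 2)) else F)"

lemma inv_sched: "inv (sepround \<circ> g) (sepround (g n)) = n"
proof -
  have "inj (sepround \<circ> g)"
    by (rule strict_mono_imp_inj_on) (use sepround_mono g in \<open>auto simp: strict_mono_def\<close>)
  from inv_f_f[OF this, of n] show ?thesis by simp
qed

text \<open>Improper plays belong to \<open>L\<close>, so a winning strategy of Player 2 keeps the
  block structure by itself. Since the moves occur exactly at the times \<open>g\<close>,
  completeness keeps them out of \<open>A\<close>.\<close>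

lemma next2_play:
  assumes F2: "winning2 (insert F X) L F2" and \<alpha>: "\<And>n. \<alpha> n \<in> X"
  defines "\<rho> \<equiv> play (next2 F2 \<alpha>)"
  shows "\<rho> \<in> omega_words (insert F X)" "proper F \<rho>" "enumerate (go_rounds F (sep1 \<rho>)) = g"
    "moves F (sep1 \<rho>) (sep2 \<rho>) \<notin> A" "moves F (sep1 \<rho>) (sep2 \<rho>) (2 * n) = \<alpha> n"
proof -
  show om: "\<rho> \<in> omega_words (insert F X)"
    unfolding \<rho>_def
  proof (rule play_in_omega_words)
    fix h assume "h \<in> lists (insert F X)"
    then show "next2 F2 \<alpha> h \<in> insert F X"
      using F2 \<alpha> unfolding next2_def winning2_def strategy2_def by auto
  qed
  have "follows2 F2 \<rho>" unfolding follows2_def \<rho>_def prefix_play play_def next2_def by simp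
  then have notL: "\<rho> \<notin> L" using F2 om unfolding winning2_def by blast
  then show pr: "proper F \<rho>" using improper[OF om] by blast
  have even: "\<rho> (2 * k) = (if k \<in> range (sepround \<circ> g) then \<alpha> (inv (sepround \<circ> g) k) else F)" for k
    unfolding \<rho>_def play_def next2_def by simp
  have eg: "\<rho> (2 * sepround (g n)) = \<alpha> n" for n
  proof -
    have "sepround (g n) \<in> range (sepround \<circ> g)" by auto
    then show ?thesis unfolding even by (simp add: inv_sched)
  qed
  have go: "go_rounds F (sep1 \<rho>) = range g"
  proof
    show "range g \<subseteq> go_rounds F (sep1 \<rho>)" unfolding go_rounds_def using eg \<alpha> F by auto
    show "go_rounds F (sep1 \<rho>) \<subseteq> range g"
      unfolding go_rounds_def even by (auto simp: sepround_eq split: if_splits)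
  qed
  then show en: "enumerate (go_rounds F (sep1 \<rho>)) = g" by (simp add: enumerate_range[OF g])
  show "moves F (sep1 \<rho>) (sep2 \<rho>) \<notin> A" using complete[OF om pr go] notL by blast
  show "moves F (sep1 \<rho>) (sep2 \<rho>) (2 * n) = \<alpha> n" unfolding moves_def en using eg by simp
qed

text \<open>The bound is the length reached when the answer to move \<open>n\<close> has been
  written, so this answer depends only on the moves of Player 1 up to \<open>n\<close>.\<close>

lemma next2_hist_cong:
  assumes "\<And>k. k \<le> n \<Longrightarrow> \<alpha> k = \<alpha>' k" "m \<le> 2 * sepround (g n) + 2"
  shows "hist (next2 F2 \<alpha>) m = hist (next2 F2 \<alpha>') m"
  using assms(2)
proof (induction m)
  case (Suc m)
  have "next2 F2 \<alpha> h = next2 F2 \<alpha>' h" if "length h = m" for h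
  proof (cases "even m \<and> m div 2 \<in> range (sepround \<circ> g)")
    case True
    then obtain k where k: "m = 2 * sepround (g k)" by auto
    then have "sepround (g k) \<le> sepround (g n)" using Suc.prems by simp
    then have "k \<le> n" using strict_mono_less_eq[OF sepround_mono] strict_mono_less_eq[OF g] by simp
    then show ?thesis unfolding next2_def that k using assms(1) by (simp add: inv_sched)
  next
    case False
    then show ?thesis unfolding next2_def that by auto
  qed
  then show ?case using Suc by simp
qed simp

lemma transfer2:
  assumes F2: "winning2 (insert F X) L F2"
  shows "\<exists>G. winning2 X A G"
proof -
  define mv where "mv \<alpha> = moves F (sep1 (play (next2 F2 \<alpha>))) (sep2 (play (next2 F2 \<alpha>)))" for \<alpha>
  define al where "al w k = (if 2 * k < length w then w ! (2 * k) else x0)" for w :: "nat list" and k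
  define G where "G w = mv (al w) (length w)" for w
  have alX: "al w k \<in> X" if "w \<in> lists X" for w k
    using that x0 unfolding al_def by (auto simp: in_lists_conv_set)
  have mv_odd: "mv \<alpha> (2 * n + 1) = play (next2 F2 \<alpha>) (2 * sepround (g n) + 1)" if "\<And>n. \<alpha> n \<in> X" for \<alpha> n
    unfolding mv_def moves_def next2_play(3)[where \<alpha> = \<alpha>, OF F2 that] by simp
  have mvX: "mv \<alpha> (2 * n + 1) \<in> X" if "\<And>n. \<alpha> n \<in> X" for \<alpha> n
  proof -
    have "play (next2 F2 \<alpha>) (2 * sepround (g n) + 1) \<noteq> F"
      using next2_play(2)[where \<alpha> = \<alpha>, OF F2 that] unfolding proper_def by simp
    moreover have "play (next2 F2 \<alpha>) i \<in> insert F X" for i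
      using next2_play(1)[where \<alpha> = \<alpha>, OF F2 that] unfolding omega_words_def by blast
    ultimately show ?thesis unfolding mv_odd[OF that] by blast
  qed
  have "strategy2 X G"
    unfolding strategy2_def
  proof
    fix w assume w: "w \<in> {w \<in> lists X. odd (length w)}"
    then obtain n where n: "length w = 2 * n + 1" by (auto elim: oddE)
    show "G w \<in> X" unfolding G_def n using mvX[of "al w"] alX w by blast
  qed
  moreover have "\<sigma> \<notin> A" if \<sigma>: "\<sigma> \<in> omega_words X" "follows2 G \<sigma>" for \<sigma>
  proof -
    define \<alpha> where "\<alpha> n = \<sigma> (2 * n)" for n
    have \<alpha>: "\<alpha> n \<in> X" for n using \<sigma>(1) unfolding \<alpha>_def omega_words_def by blast
    have "mv \<alpha> m = \<sigma> m" for m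
    proof (cases "even m")
      case True
      then obtain n where m: "m = 2 * n" by (rule evenE)
      show ?thesis unfolding m mv_def using next2_play(5)[where \<alpha> = \<alpha>, OF F2 \<alpha>] by (simp add: \<alpha>_def)
    next
      case False
      then obtain n where m: "m = 2 * n + 1" by (rule oddE)
      have w: "prefix (2 * n + 1) \<sigma> \<in> lists X" by (rule set_prefix_subset[OF \<sigma>(1)])
      have "\<sigma> m = G (prefix (2 * n + 1) \<sigma>)" using \<sigma>(2) unfolding follows2_def m by blast
      also have "\<dots> = mv (al (prefix (2 * n + 1) \<sigma>)) (2 * n + 1)" unfolding G_def by simp
      also have "\<dots> = play (next2 F2 (al (prefix (2 * n + 1) \<sigma>))) (2 * sepround (g n) + 1)"
        by (rule mv_odd[where \<alpha> = "al (prefix (2 * n + 1) \<sigma>)", OF alX[OF w]])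
      also have "\<dots> = play (next2 F2 \<alpha>) (2 * sepround (g n) + 1)"
      proof -
        have "hist (next2 F2 (al (prefix (2 * n + 1) \<sigma>))) (2 * sepround (g n) + 2) = hist (next2 F2 \<alpha>) (2 * sepround (g n) + 2)"
        proof (rule next2_hist_cong[of n])
          show "al (prefix (2 * n + 1) \<sigma>) k = \<alpha> k" if "k \<le> n" for k
            using that unfolding al_def \<alpha>_def by (simp del: subsequence_append prefix_suffix add: nth_append)
        qed simp
        then show ?thesis
          using nth_hist[of "2 * sepround (g n) + 1" "2 * sepround (g n) + 2"] by (metis less_add_one add_2_eq_Suc' Suc_eq_plus1)
      qed
      also have "\<dots> = mv \<alpha> m" unfolding m by (rule mv_odd[where \<alpha> = \<alpha>, OF \<alpha>, symmetric])
      finally show ?thesis by simp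
    qed
    then have "mv \<alpha> = \<sigma>" by blast
    then show ?thesis using next2_play(4)[where \<alpha> = \<alpha>, OF F2 \<alpha>] unfolding mv_def by simp
  qed
  ultimately show ?thesis unfolding winning2_def by blast
qed

end

text \<open>Over the empty alphabet there are neither infinite words nor words of odd length, so any
  function wins for Player 2. The case is separate because the transfer needs a letter
  \<open>x0\<close> for separators without a move.\<close>

lemma determined_empty: "determined {} A"
proof -
  have "winning2 {} A F" for F
    unfolding winning2_def strategy2_def omega_words_def by auto
  then show ?thesis unfolding determined_def by blast
qed

lemma Sigma11_determined:
  assumes det: "Det (r_BCL 1)" and X: "finite X" and A: "A \<in> Sigma11 X"
  shows "determined X A"
proof (cases "X = {}")
  case True
  then show ?thesis using determined_empty by blast
next
  case False
  then obtain x0 where x0: "x0 \<in> X" by blast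
  obtain F where F: "F \<notin> X" using X infinite_UNIV_nat by (metis ex_new_if_finite)
  obtain step acc where rec: "recfn 4 step" "recfn 1 acc"
    and A_eq: "A = {\<sigma> \<in> omega_words X. \<exists>\<tau>\<in>omega_words {0, 1}. \<exists>\<^sub>\<infinity>m. acc [state_seq step \<tau> \<sigma> (Suc m)] = 0}"
    by (rule Sigma11_machine[OF A])
  have "\<exists>T. finite T \<and> (\<forall>q I q'. (q, I, q') \<in> T \<longrightarrow> cop_arg I > 0) \<and>
    (\<forall>S c. ((0, code S), (1, c)) \<in> (cstep T)\<^sup>* \<longleftrightarrow>
       (\<exists>b\<in>{0, 1}. c = code (step [S, b, x, y]) \<and> (f \<longleftrightarrow> acc [step [S, b, x, y]] = 0)))" for x y f
    unfolding code_def by (rule round_programs[OF rec])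
  then have "\<forall>z. \<exists>T. finite T \<and> (\<forall>q I q'. (q, I, q') \<in> T \<longrightarrow> cop_arg I > 0) \<and>
    (\<forall>S c. ((0, code S), (1, c)) \<in> (cstep T)\<^sup>* \<longleftrightarrow> (\<exists>b\<in>{0, 1}. c = code (step [S, b, fst z, fst (snd z)]) \<and>
       (snd (snd z) \<longleftrightarrow> acc [step [S, b, fst z, fst (snd z)]] = 0)))" by blast
  from choice[OF this] obtain T' where T': "\<And>z. finite (T' z) \<and> (\<forall>q I q'. (q, I, q') \<in> T' z \<longrightarrow> cop_arg I > 0) \<and>
    (\<forall>S c. ((0, code S), (1, c)) \<in> (cstep (T' z))\<^sup>* \<longleftrightarrow> (\<exists>b\<in>{0, 1}. c = code (step [S, b, fst z, fst (snd z)]) \<and>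
       (snd (snd z) \<longleftrightarrow> acc [step [S, b, fst z, fst (snd z)]] = 0)))" by blast
  define T where "T x y f = T' (x, y, f)" for x y f
  have T: "finite (T x y f)" "(q, I, q') \<in> T x y f \<Longrightarrow> cop_arg I > 0"
    "((0, code S), (1, c)) \<in> (cstep (T x y f))\<^sup>* \<longleftrightarrow>
       (\<exists>b\<in>{0, 1}. c = code (step [S, b, x, y]) \<and> (f \<longleftrightarrow> acc [step [S, b, x, y]] = 0))" for x y f q I q' S c
    using T'[of "(x, y, f)"] unfolding T_def[symmetric] fst_conv snd_conv by blast+
  interpret round_machine step acc X F T
    by standard (fact F X T)+
  define L where "L = game_lang F X btr W bfin"
  have L: "L \<in> r_BCL 1 (insert F X)" unfolding L_def by (rule game_lang_r_BCL[OF X btr_fin btr_pos])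
  have mem: "\<rho> \<in> L \<longleftrightarrow> \<not> proper F \<rho> \<or> brun F btr W bfin \<rho>" if "\<rho> \<in> omega_words (insert F X)" for \<rho>
    unfolding L_def by (rule mem_game_lang_iff[OF btr_pos that])
  obtain g :: "nat \<Rightarrow> nat" where g: "strict_mono g"
    "\<And>ep ey \<tau>. go_rounds F ep = range g \<Longrightarrow> moves F ep ey \<in> omega_words X \<Longrightarrow> \<tau> \<in> omega_words {0, 1} \<Longrightarrow>
       \<exists>\<^sub>\<infinity>m. acc [state_seq step \<tau> (moves F ep ey) (Suc m)] = 0 \<Longrightarrow>
       \<exists>r. r 0 = (W, 1) \<and> (\<forall>i. bs ep ey i (r i) (r (Suc i))) \<and> (\<exists>\<^sub>\<infinity>i. fst (r i) \<in> bfin)"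
    by (rule complete) blast
  interpret game_transfer X F x0 A L g
  proof
    show "F \<notin> X" "x0 \<in> X" "strict_mono g" by (fact F x0 g(1))+
  next
    fix \<rho> assume \<rho>: "\<rho> \<in> omega_words (insert F X)"
    show "\<not> proper F \<rho> \<Longrightarrow> \<rho> \<in> L" using mem[OF \<rho>] by blast
    show "infinite (go_rounds F (sep1 \<rho>)) \<and> moves F (sep1 \<rho>) (sep2 \<rho>) \<in> A" if "proper F \<rho>" "\<rho> \<in> L"
    proof -
      have "brun F btr W bfin \<rho>" using mem[OF \<rho>] that by blast
      then obtain r where r: "r 0 = (W, 1) \<and> (\<forall>i. bs (sep1 \<rho>) (sep2 \<rho>) i (r i) (r (Suc i))) \<and> (\<exists>\<^sub>\<infinity>i. fst (r i) \<in> bfin)"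
        unfolding brun_iff ..
      note sound_r = sound[OF conjunct1[OF r] spec[OF conjunct1[OF conjunct2[OF r]]] conjunct2[OF conjunct2[OF r]]]
      show ?thesis unfolding A_eq using sound_r by simp
    qed
    show "\<rho> \<in> L" if "proper F \<rho>" and go: "go_rounds F (sep1 \<rho>) = range g" and mv: "moves F (sep1 \<rho>) (sep2 \<rho>) \<in> A"
    proof -
      obtain \<tau> where "moves F (sep1 \<rho>) (sep2 \<rho>) \<in> omega_words X" "\<tau> \<in> omega_words {0, 1}"
        "\<exists>\<^sub>\<infinity>m. acc [state_seq step \<tau> (moves F (sep1 \<rho>) (sep2 \<rho>)) (Suc m)] = 0"
        using mv unfolding A_eq by blast
      from g(2)[OF go this] have "brun F btr W bfin \<rho>" unfolding brun_iff .
      then show ?thesis using mem[OF \<rho>] by blast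
    qed
  qed
  have "L \<subseteq> omega_words (insert F X)" unfolding L_def game_lang_def by blast
  then have "determined (insert F X) L" using det L X unfolding Det_def by blast
  then show ?thesis unfolding determined_def using transfer1 transfer2 by blast
qed

theorem theorem3p4:
  shows "(Det Sigma11 \<longleftrightarrow> Det CFL) \<and> (Det CFL \<longleftrightarrow> Det (r_BCL 1))"
proof -
  have "Det Sigma11 \<Longrightarrow> Det CFL" using CFL_subset_Sigma11 unfolding Det_def by blast
  moreover have "Det CFL \<Longrightarrow> Det (r_BCL 1)" using r_BCL_subset_CFL unfolding Det_def by blast
  moreover have "Det (r_BCL 1) \<Longrightarrow> Det Sigma11"
    using Sigma11_determined unfolding Det_def[of Sigma11] by blast
  ultimately show ?thesis by blast
qed

end
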